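(* Let $(\mathcal F,\mathcal R)$ be a properly applied, accessible function passing AFSM. If $(\mathcal F,\mathcal R)$ is non-terminating, then there is an infinite $(\mathit{SDP}(\mathcal R),\mathcal R)$-dependency chain.
   Context: Types, terms, substitutions, rules. Fix a set $\mathcal S$ of sorts; types are sorts and $\sigma\to\tau$ ($\to$ right-associative); every type is uniquely $\sigma_1\to\cdots\to\sigma_m\to\iota$, $\iota\in\mathcal S$. Fix disjoint sets $\mathcal F$ (function symbols), $\mathcal V$ (variables), $\mathcal M$ (meta-variables), each symbol typed, each meta-variable $Z$ with a natural number $\mathit{arity}(Z)$; $\mathcal V,\mathcal M$ contain infinitely many symbols of every type. Meta-terms: $x:\sigma$ ($x:\sigma\in\mathcal V$); $\mathsf f:\sigma$ ($\mathsf f:\sigma\in\mathcal F$); $s\,t:\tau$ if $s:\sigma\to\tau,t:\sigma$; $\lambda x.s:\sigma\to\tau$ if $x:\sigma\in\mathcal V,s:\tau$; $Z\langle s_1,..,s_k\rangle:\sigma_{k+1}\to\cdots\to\iota$ if $Z:\sigma_1\to\cdots\to\sigma_m\to\iota$ has arity $k$ and $s_i:\sigma_i$ (write $Z$ for $Z\langle\rangle$). Terms are meta-terms without meta-variables. Application is left-associative; $\lambda$ binds; modulo $\alpha$; $FV,FMV$ denote free variables and meta-variables; closed means no free variables. Subterms: $s\unrhd t$ iff $s=t$ or $s\rhd t$, with $\lambda x.s'\rhd t$ if $s'\unrhd t$ and $s_1s_2\rhd t$ if $s_1\unrhd t$ or $s_2\unrhd t$. Fully applied subterms: $s\mathbin{\underline{\blacktriangleright}}t$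 iff $s=t$ or $s\blacktriangleright t$, with $\lambda x.s'\blacktriangleright t$ if $s'\mathbin{\underline{\blacktriangleright}}t$, and $s_1s_2\blacktriangleright t$ if $s_2\mathbin{\underline{\blacktriangleright}}t$ or $s_1\blacktriangleright t$. A pattern is $Z\langle x_1,..,x_k\rangle$ (distinct variables), $\lambda x.\ell$ ($\ell$ a pattern), or $a\,\ell_1\cdots\ell_n$ ($a\in\mathcal F\cup\mathcal V$, $\ell_i$ patterns). Substitutions $\gamma$ map variables and meta-variables type-preservingly to meta-terms (to terms, for a substitution); the domain consists of $x$ with $\gamma(x)\ne x$ and $Z$ of arity $k$ with $\gamma(Z)\ne\lambda y_1..y_k.Z\langle y_1,..,y_k\rangle$. Application is homomorphic and capture-avoiding, except $Z\langle s_1,..,s_k\rangle\gamma=u[x_1:=s_1\gamma,..,x_n:=s_n\gamma](s_{n+1}\gamma)\cdots(s_k\gamma)$ when $Z\in\mathrm{dom}(\gamma)$ and $\gamma(Z)=\lambda x_1..x_n.u$ with $n=k$, or $n<k$ and $u$ not an abstraction. A rule is a pair $\ell\Rightarrow r$ of closed meta-terms of the same type, $\ell$ a pattern $\mathsf f\,\ell_1\cdots\ell_n$ ($\mathsf f\in\mathcal F$), $FMV(r)\subseteq FMV(\ell)$. $\to_{\mathcal R}$ is the smallest relation on terms closed under all contexts (including under $\lambda$) containing $\ell\delta\to r\delta$ for rules and substitutions with $\mathrm{dom}(\delta)=FMV(\ell)$, and $(\lambda x.s)t\to s[x:=t]$. Defined symbols $\mathcal D$: symbols heading a rule's left-hand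 side. An AFSM $(\mathcal F,\mathcal R)$ is terminating if there is no infinite $\to_{\mathcal R}$-reduction on terms. Properly applied: for each $\mathsf f\in\mathcal D$ there is $k$ such that every rule $\ell\Rightarrow r$ has: if $\ell=\mathsf f\,\ell_1\cdots\ell_n$ then $n=k$, and if $r\mathbin{\underline{\blacktriangleright}}\mathsf f\,r_1\cdots r_n$ then $n\ge k$; write $\mathit{minar}(\mathsf f)=k$. Accessible function passing (AFP): a quasi-ordering $\succeq^{\mathcal S}$ on sorts with well-founded strict part $\succ^{\mathcal S}$; for $\sigma=\sigma_1\to\cdots\to\sigma_m\to\kappa$ and sort $\iota$: $\iota\succeq^{\mathcal S}_+\sigma$ iff $\iota\succeq^{\mathcal S}\kappa$ and $\iota\succ^{\mathcal S}_-\sigma_i$ for all $i$; $\iota\succ^{\mathcal S}_-\sigma$ iff $\iota\succ^{\mathcal S}\kappa$ and $\iota\succeq^{\mathcal S}_+\sigma_i$ for all $i$. For $\mathsf f:\sigma_1\to\cdots\to\sigma_m\to\iota\in\mathcal F$, $\mathit{Acc}(\mathsf f)=\{i\mid\iota\succeq^{\mathcal S}_+\sigma_i\}$; for $x\in\mathcal V$ of that type, $\mathit{Acc}(x)=\{i\mid\sigma_i=\tau_1\to\cdots\to\tau_n\to\kappa,\ \iota\succeq^{\mathcal S}\kappa\}$. $s\unrhd_{\mathrm{acc}}t$ iff $s=t$, or $s=\lambda x.s'$ with $s'\unrhd_{\mathrm{acc}}t$, or $s=a\,s_1\cdots s_n$ with $a\in\mathcal F\cup\mathcal V$ and $s_i\unrhd_{\mathrm{acc}}t$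 for some $i\in\mathit{Acc}(a)$ with $a\notin FV(s_i)$. The AFSM is AFP if there exists such $\succeq^{\mathcal S}$ such that for every rule $\mathsf f\,\ell_1\cdots\ell_n\Rightarrow r$ and every $Z\in FMV(r)$ there are $i$ and variables $x_1,..,x_k$ with $\ell_i\unrhd_{\mathrm{acc}}Z\langle x_1,..,x_k\rangle$. Static dependency pairs: $\mathcal F^\sharp=\mathcal F\uplus\{\mathsf f^\sharp:\sigma\mid\mathsf f:\sigma\in\mathcal D\}$; for $s=\mathsf f\,s_1\cdots s_k$ with $\mathsf f\in\mathcal D$, $k=\mathit{minar}(\mathsf f)$, let $s^\sharp=\mathsf f^\sharp s_1\cdots s_k$. A dependency pair (DP) is a triple $\ell\Rrightarrow p\ (A)$ with $\ell$ a closed pattern $\mathsf f\,\ell_1\cdots\ell_k$, $p$ a closed meta-term $\mathsf g\,p_1\cdots p_n$, and $A$ a set of meta-variable conditions $Z:i$. A substitution $\gamma$ respects $A$ if for all $Z:i\in A$, $\gamma(Z)=\lambda x_1..x_j.t$ with $i>j$, or $i\le j$ and $x_i\in FV(t)$. Define $s\trianglerighteq^\beta_A t$ by: $s=t$; or $s=\lambda x.u$ and $u\trianglerighteq^\beta_A t$; or $s=(\lambda x.u)\,s_0\cdots s_n$ and some $s_i\trianglerighteq^\beta_A t$ or $u[x:=s_0]\,s_1\cdots s_n\trianglerighteq^\beta_A t$; or $s=a\,s_1\cdots s_n$ with $a\in\mathcal F\cup\mathcal V$ and some $s_i\trianglerighteq^\beta_A t$; or $s=Z\langle t_1,..,t_e\rangle\,s_1\cdots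 s_n$ and some $s_i\trianglerighteq^\beta_A t$; or $s=Z\langle t_1,..,t_e\rangle\,s_1\cdots s_n$ and $t_i\trianglerighteq^\beta_A t$ for some $i$ with $(Z:i)\in A$. The candidates $\mathsf{cand}(s)$ are the pairs $t\ (A)$ with $t=\mathsf f\,s_1\cdots s_k$, $\mathsf f\in\mathcal D$, $k=\mathit{minar}(\mathsf f)$, such that $s\trianglerighteq^\beta_A t\,s_{k+1}\cdots s_n$ for some $s_{k+1},..,s_n$, and there is no $A'\subsetneq A$ with $s\trianglerighteq^\beta_{A'}t$. $\mathit{metafy}(s)$ is $s$ with every free variable replaced by a corresponding fresh meta-variable of arity $0$. $\mathit{SDP}(\mathcal R)=\{\ell^\sharp\Rrightarrow\mathit{metafy}(p^\sharp)\ (A)\mid\ell\Rightarrow r\in\mathcal R,\ p\ (A)\in\mathsf{cand}(r)\}$. Chains: for a set $\mathcal P$ of DPs and rules $\mathcal R$, a $(\mathcal P,\mathcal R)$-dependency chain is a finite or infinite sequence $[(\ell_0\Rrightarrow p_0\,(A_0),s_0,t_0),(\ell_1\Rrightarrow p_1\,(A_1),s_1,t_1),\dots]$ with each DP in $\mathcal P$ and $s_i,t_i$ terms over $\mathcal F^\sharp$ such that for all $i$: there is a substitution $\gamma$ with domain $FMV(\ell_i)\cup FMV(p_i)$ respecting $A_i$ with $s_i=\ell_i\gamma$, $t_i=p_i\gamma$; and $t_i=\mathsf f\,u_1\cdots u_n$, $s_{i+1}=\mathsf f\,w_1\cdots w_n$ with each $u_j\to^*_{\mathcal R}w_j$.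
   Formalization: In "properly applied", fully applied subterms also include those inside meta-variable arguments Z⟨s1,..,sk⟩; else f X ⇒ h (g (λx.k (x X))), g (λx.Z⟨x⟩) ⇒ Z⟨f⟩ is a counterexample. Each type is taken to have infinitely many arity-0 meta-variables, as metafy needs. *)

theory Defs
  imports Main
begin

datatype 's ty = Sort 's | Arrow "'s ty" "'s ty" (infixr "\<rightarrow>" 65)

primrec ty_args :: "'s ty \<Rightarrow> 's ty list" where
  "ty_args (Sort \<iota>) = []"
| "ty_args (\<sigma> \<rightarrow> \<tau>) = \<sigma> # ty_args \<tau>"

primrec ty_res :: "'s ty \<Rightarrow> 's" where
  "ty_res (Sort \<iota>) = \<iota>"
| "ty_res (\<sigma> \<rightarrow> \<tau>) = ty_res \<tau>"

abbreviation arrows :: "'s ty list \<Rightarrow> 's ty \<Rightarrow> 's ty" where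
  "arrows \<sigma>s \<tau> \<equiv> foldr Arrow \<sigma>s \<tau>"

text \<open>
  Locally nameless raw syntax: free variables are named, bound variables are de Bruijn indices, so
  that \<open>\<alpha>\<close>-equivalence is equality. The actual meta-terms are the well-typed ones
  (\<open>has_type\<close> below); these have no dangling indices. Since only free variables are
  named, the generated set functions \<open>FV\<close> and \<open>FMV\<close> are the free variables and
  the meta-variables.
\<close>

datatype ('f, FV: 'v, FMV: 'm, 's) mt =
    Bd nat
  | Fv 'v
  | Fn 'f
  | App "('f, 'v, 'm, 's) mt" "('f, 'v, 'm, 's) mt"
  | Lam "'s ty" "('f, 'v, 'm, 's) mt"
  | Meta 'm "('f, 'v, 'm, 's) mt list"

text \<open>The sorts and the sets of variables and meta-variables are the types \<open>'s\<close>, \<open>'v\<close>, \<open>'m\<close>.\<close>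

record ('f, 'v, 'm, 's) afsm_sig =
  funs :: "'f set"
  ftype :: "'f \<Rightarrow> 's ty"
  vtype :: "'v \<Rightarrow> 's ty"
  mtype :: "'m \<Rightarrow> 's ty"
  arity :: "'m \<Rightarrow> nat"

text \<open>The arity-0 condition is what makes replacing variables by fresh meta-variables possible.\<close>

definition wf_sig :: "('f, 'v, 'm, 's) afsm_sig \<Rightarrow> bool" where
  "wf_sig \<Sigma> \<longleftrightarrow>
     (\<forall>\<sigma>. infinite {x. vtype \<Sigma> x = \<sigma>}) \<and>
     (\<forall>\<sigma>. infinite {Z. mtype \<Sigma> Z = \<sigma> \<and> arity \<Sigma> Z = 0})"

abbreviation apps :: "('f, 'v, 'm, 's) mt \<Rightarrow> ('f, 'v, 'm, 's) mt list \<Rightarrow> ('f, 'v, 'm, 's) mt" where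
  "apps s ts \<equiv> foldl App s ts"

primrec close :: "'v \<Rightarrow> nat \<Rightarrow> ('f, 'v, 'm, 's) mt \<Rightarrow> ('f, 'v, 'm, 's) mt" where
  "close x d (Bd i) = Bd i"
| "close x d (Fv y) = (if y = x then Bd d else Fv y)"
| "close x d (Fn f) = Fn f"
| "close x d (App s t) = App (close x d s) (close x d t)"
| "close x d (Lam \<sigma> s) = Lam \<sigma> (close x (Suc d) s)"
| "close x d (Meta Z ss) = Meta Z (map (close x d) ss)"

text \<open>
  \<open>lam \<Sigma> x s\<close> is the abstraction \<open>\<lambda>x. s\<close> modulo \<open>\<alpha>\<close>; it has the intended
  meaning only for \<open>s\<close> without dangling indices.
\<close>

definition lam :: "('f, 'v, 'm, 's) afsm_sig \<Rightarrow> 'v \<Rightarrow> ('f, 'v, 'm, 's) mt \<Rightarrow> ('f, 'v, 'm, 's) mt" where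
  "lam \<Sigma> x s = Lam (vtype \<Sigma> x) (close x 0 s)"

inductive has_type :: "('f, 'v, 'm, 's) afsm_sig \<Rightarrow> ('f, 'v, 'm, 's) mt \<Rightarrow> 's ty \<Rightarrow> bool"
  for \<Sigma> :: "('f, 'v, 'm, 's) afsm_sig" where
  var: "has_type \<Sigma> (Fv x) (vtype \<Sigma> x)"
| fn: "f \<in> funs \<Sigma> \<Longrightarrow> has_type \<Sigma> (Fn f) (ftype \<Sigma> f)"
| app: "has_type \<Sigma> s (\<sigma> \<rightarrow> \<tau>) \<Longrightarrow> has_type \<Sigma> t \<sigma> \<Longrightarrow> has_type \<Sigma> (App s t) \<tau>"
| lam: "has_type \<Sigma> s \<tau> \<Longrightarrow> has_type \<Sigma> (lam \<Sigma> x s) (vtype \<Sigma> x \<rightarrow> \<tau>)"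
| meta: "mtype \<Sigma> Z = arrows \<sigma>s \<tau> \<Longrightarrow> length \<sigma>s = arity \<Sigma> Z \<Longrightarrow>
         list_all2 (has_type \<Sigma>) ss \<sigma>s \<Longrightarrow> has_type \<Sigma> (Meta Z ss) \<tau>"

definition is_mterm :: "('f, 'v, 'm, 's) afsm_sig \<Rightarrow> ('f, 'v, 'm, 's) mt \<Rightarrow> bool" where
  "is_mterm \<Sigma> s \<longleftrightarrow> (\<exists>\<sigma>. has_type \<Sigma> s \<sigma>)"

definition is_term :: "('f, 'v, 'm, 's) afsm_sig \<Rightarrow> ('f, 'v, 'm, 's) mt \<Rightarrow> bool" where
  "is_term \<Sigma> s \<longleftrightarrow> is_mterm \<Sigma> s \<and> FMV s = {}"

text \<open>
  The strict relation. The last clause descends into meta-variable arguments, so that in a properly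
  applied system a defined symbol cannot occur with too few arguments there either. Without it, the
  rules \<open>f X \<Rightarrow> h (g (\<lambda>x. k (x X)))\<close> and \<open>g (\<lambda>x. Z\<langle>x\<rangle>) \<Rightarrow> Z\<langle>f\<rangle>\<close> would be properly applied and
  non-terminating, but without an infinite chain.
\<close>

inductive fully_applied_subterm ::
  "('f, 'v, 'm, 's) afsm_sig \<Rightarrow> ('f, 'v, 'm, 's) mt \<Rightarrow> ('f, 'v, 'm, 's) mt \<Rightarrow> bool"
  for \<Sigma> :: "('f, 'v, 'm, 's) afsm_sig" where
  "is_mterm \<Sigma> s \<Longrightarrow> s = t \<or> fully_applied_subterm \<Sigma> s t \<Longrightarrow> fully_applied_subterm \<Sigma> (lam \<Sigma> x s) t"
| "s2 = t \<or> fully_applied_subterm \<Sigma> s2 t \<Longrightarrow> fully_applied_subterm \<Sigma> (App s1 s2) t"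
| "fully_applied_subterm \<Sigma> s1 t \<Longrightarrow> fully_applied_subterm \<Sigma> (App s1 s2) t"
| "s \<in> set ss \<Longrightarrow> s = t \<or> fully_applied_subterm \<Sigma> s t \<Longrightarrow> fully_applied_subterm \<Sigma> (Meta Z ss) t"

inductive pattern :: "('f, 'v, 'm, 's) afsm_sig \<Rightarrow> ('f, 'v, 'm, 's) mt \<Rightarrow> bool"
  for \<Sigma> :: "('f, 'v, 'm, 's) afsm_sig" where
  "distinct xs \<Longrightarrow> pattern \<Sigma> (Meta Z (map Fv xs))"
| "pattern \<Sigma> l \<Longrightarrow> pattern \<Sigma> (lam \<Sigma> x l)"
| "\<forall>l\<in>set ls. pattern \<Sigma> l \<Longrightarrow> pattern \<Sigma> (apps (Fn f) ls)"
| "\<forall>l\<in>set ls. pattern \<Sigma> l \<Longrightarrow> pattern \<Sigma> (apps (Fv y) ls)"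

text \<open>A substitution maps variables (\<open>Inl\<close>) and meta-variables (\<open>Inr\<close>) to meta-terms.\<close>

type_synonym ('f, 'v, 'm, 's) subst = "'v + 'm \<Rightarrow> ('f, 'v, 'm, 's) mt"

text \<open>\<open>id_meta \<Sigma> Z\<close> is \<open>\<lambda>y\<^sub>1\<dots>y\<^sub>k. Z\<langle>y\<^sub>1,\<dots>,y\<^sub>k\<rangle>\<close> for \<open>Z\<close> of arity \<open>k\<close>.\<close>

definition id_meta :: "('f, 'v, 'm, 's) afsm_sig \<Rightarrow> 'm \<Rightarrow> ('f, 'v, 'm, 's) mt" where
  "id_meta \<Sigma> Z = foldr Lam (take (arity \<Sigma> Z) (ty_args (mtype \<Sigma> Z)))
     (Meta Z (map Bd (rev [0..<arity \<Sigma> Z])))"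

definition id_subst :: "('f, 'v, 'm, 's) afsm_sig \<Rightarrow> ('f, 'v, 'm, 's) subst" where
  "id_subst \<Sigma> = case_sum Fv (id_meta \<Sigma>)"

definition sdom :: "('f, 'v, 'm, 's) afsm_sig \<Rightarrow> ('f, 'v, 'm, 's) subst \<Rightarrow> ('v + 'm) set" where
  "sdom \<Sigma> \<gamma> = {a. \<gamma> a \<noteq> id_subst \<Sigma> a}"

definition is_subst :: "('f, 'v, 'm, 's) afsm_sig \<Rightarrow> ('f, 'v, 'm, 's) subst \<Rightarrow> bool" where
  "is_subst \<Sigma> \<gamma> \<longleftrightarrow>
     (\<forall>a\<in>sdom \<Sigma> \<gamma>. is_term \<Sigma> (\<gamma> a) \<and> has_type \<Sigma> (\<gamma> a) (case_sum (vtype \<Sigma>) (mtype \<Sigma>) a))"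

text \<open>
  \<open>inst d ss u\<close> replaces the \<open>length ss\<close> dangling indices from \<open>d\<close> on by \<open>ss\<close> (the last
  element of \<open>ss\<close> for index \<open>d\<close>, since the innermost binder has the least index). The elements of
  \<open>ss\<close> may contain dangling indices themselves, because they are the arguments of a meta-variable
  that can occur below a binder.
\<close>

primrec lift :: "nat \<Rightarrow> nat \<Rightarrow> ('f, 'v, 'm, 's) mt \<Rightarrow> ('f, 'v, 'm, 's) mt" where
  "lift c n (Bd i) = Bd (if i < c then i else i + n)"
| "lift c n (Fv y) = Fv y"
| "lift c n (Fn f) = Fn f"
| "lift c n (App s t) = App (lift c n s) (lift c n t)"
| "lift c n (Lam \<sigma> s) = Lam \<sigma> (lift (Suc c) n s)"
| "lift c n (Meta Z ss) = Meta Z (map (lift c n) ss)"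

primrec inst :: "nat \<Rightarrow> ('f, 'v, 'm, 's) mt list \<Rightarrow> ('f, 'v, 'm, 's) mt \<Rightarrow> ('f, 'v, 'm, 's) mt" where
  "inst d ss (Bd i) =
     (if i < d then Bd i
      else if i - d < length ss then lift 0 d (rev ss ! (i - d))
      else Bd (i - length ss))"
| "inst d ss (Fv y) = Fv y"
| "inst d ss (Fn f) = Fn f"
| "inst d ss (App s t) = App (inst d ss s) (inst d ss t)"
| "inst d ss (Lam \<sigma> s) = Lam \<sigma> (inst (Suc d) ss s)"
| "inst d ss (Meta Z ts) = Meta Z (map (inst d ss) ts)"

text \<open>
  \<open>strip_lams k t\<close> writes \<open>t\<close> as \<open>\<lambda>x\<^sub>1\<dots>x\<^sub>n. u\<close> with \<open>n = k\<close>, or \<open>n < k\<close> and \<open>u\<close> not an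
  abstraction; then \<open>meta_inst\<close> yields \<open>u[x\<^sub>1:=s\<^sub>1,\<dots>,x\<^sub>n:=s\<^sub>n] s\<^sub>n\<^sub>+\<^sub>1 \<dots> s\<^sub>k\<close>.
\<close>

fun strip_lams :: "nat \<Rightarrow> ('f, 'v, 'm, 's) mt \<Rightarrow> nat \<times> ('f, 'v, 'm, 's) mt" where
  "strip_lams (Suc k) (Lam \<sigma> t) = (let (n, u) = strip_lams k t in (Suc n, u))"
| "strip_lams k t = (0, t)"

definition meta_inst :: "('f, 'v, 'm, 's) mt \<Rightarrow> ('f, 'v, 'm, 's) mt list \<Rightarrow> ('f, 'v, 'm, 's) mt" where
  "meta_inst t ss =
     (let (n, u) = strip_lams (length ss) t in apps (inst 0 (take n ss) u) (drop n ss))"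

text \<open>
  Values of \<open>\<gamma>\<close> have no dangling indices, so going below a binder needs no adjustment and cannot
  capture.
\<close>

primrec subst ::
  "('f, 'v, 'm, 's) afsm_sig \<Rightarrow> ('f, 'v, 'm, 's) subst \<Rightarrow> ('f, 'v, 'm, 's) mt \<Rightarrow> ('f, 'v, 'm, 's) mt" where
  "subst \<Sigma> \<gamma> (Bd i) = Bd i"
| "subst \<Sigma> \<gamma> (Fv x) = \<gamma> (Inl x)"
| "subst \<Sigma> \<gamma> (Fn f) = Fn f"
| "subst \<Sigma> \<gamma> (App s t) = App (subst \<Sigma> \<gamma> s) (subst \<Sigma> \<gamma> t)"
| "subst \<Sigma> \<gamma> (Lam \<sigma> s) = Lam \<sigma> (subst \<Sigma> \<gamma> s)"
| "subst \<Sigma> \<gamma> (Meta Z ss) =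
     (if Inr Z \<in> sdom \<Sigma> \<gamma> then meta_inst (\<gamma> (Inr Z)) (map (subst \<Sigma> \<gamma>) ss)
      else Meta Z (map (subst \<Sigma> \<gamma>) ss))"

definition subst1 ::
  "('f, 'v, 'm, 's) afsm_sig \<Rightarrow> 'v \<Rightarrow> ('f, 'v, 'm, 's) mt \<Rightarrow> ('f, 'v, 'm, 's) mt \<Rightarrow> ('f, 'v, 'm, 's) mt" where
  "subst1 \<Sigma> x t s = subst \<Sigma> ((id_subst \<Sigma>)(Inl x := t)) s"

type_synonym ('f, 'v, 'm, 's) rule = "('f, 'v, 'm, 's) mt \<times> ('f, 'v, 'm, 's) mt"

definition is_rule :: "('f, 'v, 'm, 's) afsm_sig \<Rightarrow> ('f, 'v, 'm, 's) rule \<Rightarrow> bool" where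
  "is_rule \<Sigma> = (\<lambda>(l, r).
     (\<exists>\<sigma>. has_type \<Sigma> l \<sigma> \<and> has_type \<Sigma> r \<sigma>) \<and> FV l = {} \<and> FV r = {} \<and>
     pattern \<Sigma> l \<and> (\<exists>f ls. l = apps (Fn f) ls) \<and> FMV r \<subseteq> FMV l)"

definition afsm :: "('f, 'v, 'm, 's) afsm_sig \<Rightarrow> ('f, 'v, 'm, 's) rule set \<Rightarrow> bool" where
  "afsm \<Sigma> R \<longleftrightarrow> wf_sig \<Sigma> \<and> (\<forall>\<rho>\<in>R. is_rule \<Sigma> \<rho>)"

inductive rstep ::
  "('f, 'v, 'm, 's) afsm_sig \<Rightarrow> ('f, 'v, 'm, 's) rule set \<Rightarrow>
   ('f, 'v, 'm, 's) mt \<Rightarrow> ('f, 'v, 'm, 's) mt \<Rightarrow> bool"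
  for \<Sigma> :: "('f, 'v, 'm, 's) afsm_sig" and R :: "('f, 'v, 'm, 's) rule set" where
  rule: "(l, r) \<in> R \<Longrightarrow> is_subst \<Sigma> \<delta> \<Longrightarrow> sdom \<Sigma> \<delta> = Inr ` FMV l \<Longrightarrow>
         rstep \<Sigma> R (subst \<Sigma> \<delta> l) (subst \<Sigma> \<delta> r)"
| beta: "is_term \<Sigma> s \<Longrightarrow> is_term \<Sigma> t \<Longrightarrow> has_type \<Sigma> t (vtype \<Sigma> x) \<Longrightarrow>
         rstep \<Sigma> R (App (lam \<Sigma> x s) t) (subst1 \<Sigma> x t s)"
| appl: "rstep \<Sigma> R s s' \<Longrightarrow> is_term \<Sigma> (App s t) \<Longrightarrow> rstep \<Sigma> R (App s t) (App s' t)"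
| appr: "rstep \<Sigma> R t t' \<Longrightarrow> is_term \<Sigma> (App s t) \<Longrightarrow> rstep \<Sigma> R (App s t) (App s t')"
| lam: "rstep \<Sigma> R s s' \<Longrightarrow> rstep \<Sigma> R (lam \<Sigma> x s) (lam \<Sigma> x s')"

definition terminating :: "('f, 'v, 'm, 's) afsm_sig \<Rightarrow> ('f, 'v, 'm, 's) rule set \<Rightarrow> bool" where
  "terminating \<Sigma> R \<longleftrightarrow>
     \<not> (\<exists>s :: nat \<Rightarrow> _. \<forall>i. is_term \<Sigma> (s i) \<and> rstep \<Sigma> R (s i) (s (Suc i)))"

definition defined :: "('f, 'v, 'm, 's) rule set \<Rightarrow> 'f set" where
  "defined R = {f. \<exists>ls r. (apps (Fn f) ls, r) \<in> R}"

definition min_applied ::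
  "('f, 'v, 'm, 's) afsm_sig \<Rightarrow> ('f, 'v, 'm, 's) rule set \<Rightarrow> 'f \<Rightarrow> nat \<Rightarrow> bool" where
  "min_applied \<Sigma> R f k \<longleftrightarrow> (\<forall>(l, r)\<in>R.
     (\<forall>ls. l = apps (Fn f) ls \<longrightarrow> length ls = k) \<and>
     (\<forall>rs. r = apps (Fn f) rs \<or> fully_applied_subterm \<Sigma> r (apps (Fn f) rs) \<longrightarrow> length rs \<ge> k))"

definition properly_applied :: "('f, 'v, 'm, 's) afsm_sig \<Rightarrow> ('f, 'v, 'm, 's) rule set \<Rightarrow> bool" where
  "properly_applied \<Sigma> R \<longleftrightarrow> (\<forall>f\<in>defined R. \<exists>k. min_applied \<Sigma> R f k)"

definition minar :: "('f, 'v, 'm, 's) afsm_sig \<Rightarrow> ('f, 'v, 'm, 's) rule set \<Rightarrow> 'f \<Rightarrow> nat" where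
  "minar \<Sigma> R f = (THE k. min_applied \<Sigma> R f k)"

definition sort_order :: "('s \<Rightarrow> 's \<Rightarrow> bool) \<Rightarrow> bool" where
  "sort_order ge \<longleftrightarrow> reflp ge \<and> transp ge \<and> wf {(\<kappa>, \<iota>). ge \<iota> \<kappa> \<and> \<not> ge \<kappa> \<iota>}"

text \<open>
  \<open>ge_pos ge \<iota> \<sigma>\<close> and \<open>gt_neg ge \<iota> \<sigma>\<close> are \<open>\<iota> \<succeq>\<^sub>+ \<sigma>\<close> and \<open>\<iota> \<succ>\<^sub>- \<sigma>\<close>, by recursion on the arrows.
\<close>

fun ge_pos :: "('s \<Rightarrow> 's \<Rightarrow> bool) \<Rightarrow> 's \<Rightarrow> 's ty \<Rightarrow> bool"
  and gt_neg :: "('s \<Rightarrow> 's \<Rightarrow> bool) \<Rightarrow> 's \<Rightarrow> 's ty \<Rightarrow> bool" where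
  "ge_pos ge \<iota> (Sort \<kappa>) \<longleftrightarrow> ge \<iota> \<kappa>"
| "ge_pos ge \<iota> (\<sigma> \<rightarrow> \<tau>) \<longleftrightarrow> gt_neg ge \<iota> \<sigma> \<and> ge_pos ge \<iota> \<tau>"
| "gt_neg ge \<iota> (Sort \<kappa>) \<longleftrightarrow> ge \<iota> \<kappa> \<and> \<not> ge \<kappa> \<iota>"
| "gt_neg ge \<iota> (\<sigma> \<rightarrow> \<tau>) \<longleftrightarrow> ge_pos ge \<iota> \<sigma> \<and> gt_neg ge \<iota> \<tau>"

text \<open>Argument positions are counted from 1.\<close>

definition Acc_fun :: "('f, 'v, 'm, 's) afsm_sig \<Rightarrow> ('s \<Rightarrow> 's \<Rightarrow> bool) \<Rightarrow> 'f \<Rightarrow> nat set" where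
  "Acc_fun \<Sigma> ge f = (let \<sigma>s = ty_args (ftype \<Sigma> f); \<iota> = ty_res (ftype \<Sigma> f) in
     {i. 1 \<le> i \<and> i \<le> length \<sigma>s \<and> ge_pos ge \<iota> (\<sigma>s ! (i - 1))})"

definition Acc_var :: "('f, 'v, 'm, 's) afsm_sig \<Rightarrow> ('s \<Rightarrow> 's \<Rightarrow> bool) \<Rightarrow> 'v \<Rightarrow> nat set" where
  "Acc_var \<Sigma> ge x = (let \<sigma>s = ty_args (vtype \<Sigma> x); \<iota> = ty_res (vtype \<Sigma> x) in
     {i. 1 \<le> i \<and> i \<le> length \<sigma>s \<and> ge \<iota> (ty_res (\<sigma>s ! (i - 1)))})"

inductive acc_subterm ::
  "('f, 'v, 'm, 's) afsm_sig \<Rightarrow> ('s \<Rightarrow> 's \<Rightarrow> bool) \<Rightarrow>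
   ('f, 'v, 'm, 's) mt \<Rightarrow> ('f, 'v, 'm, 's) mt \<Rightarrow> bool"
  for \<Sigma> :: "('f, 'v, 'm, 's) afsm_sig" and ge :: "'s \<Rightarrow> 's \<Rightarrow> bool" where
  "acc_subterm \<Sigma> ge s s"
| "is_mterm \<Sigma> s \<Longrightarrow> acc_subterm \<Sigma> ge s t \<Longrightarrow> acc_subterm \<Sigma> ge (lam \<Sigma> x s) t"
| "i \<in> Acc_fun \<Sigma> ge f \<Longrightarrow> i \<le> length ss \<Longrightarrow> acc_subterm \<Sigma> ge (ss ! (i - 1)) t \<Longrightarrow>
   acc_subterm \<Sigma> ge (apps (Fn f) ss) t"
| "i \<in> Acc_var \<Sigma> ge x \<Longrightarrow> i \<le> length ss \<Longrightarrow> x \<notin> FV (ss ! (i - 1)) \<Longrightarrow>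
   acc_subterm \<Sigma> ge (ss ! (i - 1)) t \<Longrightarrow> acc_subterm \<Sigma> ge (apps (Fv x) ss) t"

definition accessible_function_passing ::
  "('f, 'v, 'm, 's) afsm_sig \<Rightarrow> ('f, 'v, 'm, 's) rule set \<Rightarrow> bool" where
  "accessible_function_passing \<Sigma> R \<longleftrightarrow> (\<exists>ge. sort_order ge \<and>
     (\<forall>f ls r. (apps (Fn f) ls, r) \<in> R \<longrightarrow>
        (\<forall>Z\<in>FMV r. \<exists>l\<in>set ls. \<exists>xs. acc_subterm \<Sigma> ge l (Meta Z (map Fv xs)))))"

text \<open>A meta-variable condition \<open>Z : i\<close> is the pair \<open>(Z, i)\<close>, with \<open>i\<close> counted from 1.\<close>

type_synonym ('f, 'v, 'm, 's) dp =
  "('f, 'v, 'm, 's) mt \<times> ('f, 'v, 'm, 's) mt \<times> ('m \<times> nat) set"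

text \<open>
  In \<open>\<gamma>(Z) = \<lambda>x\<^sub>1\<dots>x\<^sub>j. t\<close> all leading abstractions are stripped: if \<open>j\<close> could be chosen freely,
  \<open>j = 0\<close> would make every condition hold.
\<close>

definition respects_conds ::
  "('f, 'v, 'm, 's) afsm_sig \<Rightarrow> ('f, 'v, 'm, 's) subst \<Rightarrow> ('m \<times> nat) set \<Rightarrow> bool" where
  "respects_conds \<Sigma> \<gamma> A \<longleftrightarrow> (\<forall>(Z, i)\<in>A. \<exists>xs t.
     \<gamma> (Inr Z) = foldr (lam \<Sigma>) xs t \<and> distinct xs \<and> is_mterm \<Sigma> t \<and> (\<nexists>\<sigma> u. t = Lam \<sigma> u) \<and>
     (i > length xs \<or> i \<le> length xs \<and> xs ! (i - 1) \<in> FV t))"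

inductive beta_subterm ::
  "('f, 'v, 'm, 's) afsm_sig \<Rightarrow> ('m \<times> nat) set \<Rightarrow>
   ('f, 'v, 'm, 's) mt \<Rightarrow> ('f, 'v, 'm, 's) mt \<Rightarrow> bool"
  for \<Sigma> :: "('f, 'v, 'm, 's) afsm_sig" and A :: "('m \<times> nat) set" where
  "beta_subterm \<Sigma> A s s"
| "is_mterm \<Sigma> u \<Longrightarrow> beta_subterm \<Sigma> A u t \<Longrightarrow> beta_subterm \<Sigma> A (lam \<Sigma> x u) t"
| "is_mterm \<Sigma> u \<Longrightarrow> s \<in> set ss \<Longrightarrow> beta_subterm \<Sigma> A s t \<Longrightarrow>
   beta_subterm \<Sigma> A (apps (lam \<Sigma> x u) ss) t"
| "is_mterm \<Sigma> u \<Longrightarrow> beta_subterm \<Sigma> A (apps (subst1 \<Sigma> x s0 u) ss) t \<Longrightarrow>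
   beta_subterm \<Sigma> A (apps (lam \<Sigma> x u) (s0 # ss)) t"
| "s \<in> set ss \<Longrightarrow> beta_subterm \<Sigma> A s t \<Longrightarrow> beta_subterm \<Sigma> A (apps (Fn f) ss) t"
| "s \<in> set ss \<Longrightarrow> beta_subterm \<Sigma> A s t \<Longrightarrow> beta_subterm \<Sigma> A (apps (Fv y) ss) t"
| "s \<in> set ss \<Longrightarrow> beta_subterm \<Sigma> A s t \<Longrightarrow> beta_subterm \<Sigma> A (apps (Meta Z ts) ss) t"
| "(Z, i) \<in> A \<Longrightarrow> 1 \<le> i \<Longrightarrow> i \<le> length ts \<Longrightarrow> beta_subterm \<Sigma> A (ts ! (i - 1)) t \<Longrightarrow>
   beta_subterm \<Sigma> A (apps (Meta Z ts) ss) t"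

definition cand ::
  "('f, 'v, 'm, 's) afsm_sig \<Rightarrow> ('f, 'v, 'm, 's) rule set \<Rightarrow> ('f, 'v, 'm, 's) mt \<Rightarrow>
   (('f, 'v, 'm, 's) mt \<times> ('m \<times> nat) set) set" where
  "cand \<Sigma> R s = {(t, A).
     (\<exists>f ss. t = apps (Fn f) ss \<and> f \<in> defined R \<and> length ss = minar \<Sigma> R f) \<and>
     (\<exists>us. beta_subterm \<Sigma> A s (apps t us)) \<and>
     \<not> (\<exists>A'. A' \<subset> A \<and> beta_subterm \<Sigma> A' s t)}"

datatype 'f sharp_sym = Plain 'f | Sharp 'f

definition sharp_sig ::
  "('f, 'v, 'm, 's) afsm_sig \<Rightarrow> ('f, 'v, 'm, 's) rule set \<Rightarrow> ('f sharp_sym, 'v, 'm, 's) afsm_sig" where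
  "sharp_sig \<Sigma> R =
     \<lparr>funs = Plain ` funs \<Sigma> \<union> Sharp ` defined R,
      ftype = case_sharp_sym (ftype \<Sigma>) (ftype \<Sigma>),
      vtype = vtype \<Sigma>, mtype = mtype \<Sigma>, arity = arity \<Sigma>\<rparr>"

abbreviation emb :: "('f, 'v, 'm, 's) mt \<Rightarrow> ('f sharp_sym, 'v, 'm, 's) mt" where
  "emb \<equiv> map_mt Plain id id id"

definition emb_rules :: "('f, 'v, 'm, 's) rule set \<Rightarrow> ('f sharp_sym, 'v, 'm, 's) rule set" where
  "emb_rules R = map_prod emb emb ` R"

text \<open>\<open>sharp (f s\<^sub>1 \<dots> s\<^sub>k)\<close> marks the head symbol only; it is used on terms of this form only.\<close>

fun sharp :: "('f, 'v, 'm, 's) mt \<Rightarrow> ('f sharp_sym, 'v, 'm, 's) mt" where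
  "sharp (Fn f) = Fn (Sharp f)"
| "sharp (App s t) = App (sharp s) (emb t)"
| "sharp s = emb s"

text \<open>The meta-variables chosen by \<open>metafy \<Sigma> X s\<close> are fresh for \<open>s\<close> and for \<open>X\<close>.\<close>

definition metafy ::
  "('f, 'v, 'm, 's) afsm_sig \<Rightarrow> 'm set \<Rightarrow> ('f, 'v, 'm, 's) mt \<Rightarrow> ('f, 'v, 'm, 's) mt" where
  "metafy \<Sigma> X s =
     (let \<nu> = (SOME \<nu>. inj_on \<nu> (FV s) \<and>
            (\<forall>x\<in>FV s. mtype \<Sigma> (\<nu> x) = vtype \<Sigma> x \<and> arity \<Sigma> (\<nu> x) = 0 \<and> \<nu> x \<notin> X \<union> FMV s))
      in subst \<Sigma> (case_sum (\<lambda>x. if x \<in> FV s then Meta (\<nu> x) [] else Fv x) (id_meta \<Sigma>)) s)"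

definition SDP ::
  "('f, 'v, 'm, 's) afsm_sig \<Rightarrow> ('f, 'v, 'm, 's) rule set \<Rightarrow> ('f sharp_sym, 'v, 'm, 's) dp set" where
  "SDP \<Sigma> R = {(sharp l, metafy (sharp_sig \<Sigma> R) (FMV l) (sharp p), A) | l r p A.
     (l, r) \<in> R \<and> (p, A) \<in> cand \<Sigma> R r}"

definition infinite_chain ::
  "('f, 'v, 'm, 's) afsm_sig \<Rightarrow> ('f, 'v, 'm, 's) dp set \<Rightarrow> ('f, 'v, 'm, 's) rule set \<Rightarrow>
   (nat \<Rightarrow> ('f, 'v, 'm, 's) dp \<times> ('f, 'v, 'm, 's) mt \<times> ('f, 'v, 'm, 's) mt) \<Rightarrow> bool" where
  "infinite_chain \<Sigma> P R c \<longleftrightarrow> (\<forall>i. \<exists>l p A s t.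
     c i = ((l, p, A), s, t) \<and> (l, p, A) \<in> P \<and> is_term \<Sigma> s \<and> is_term \<Sigma> t \<and>
     (\<exists>\<gamma>. is_subst \<Sigma> \<gamma> \<and> sdom \<Sigma> \<gamma> = Inr ` (FMV l \<union> FMV p) \<and> respects_conds \<Sigma> \<gamma> A \<and>
          s = subst \<Sigma> \<gamma> l \<and> t = subst \<Sigma> \<gamma> p) \<and>
     (\<exists>f us ws dp' t'. t = apps (Fn f) us \<and> c (Suc i) = (dp', apps (Fn f) ws, t') \<and>
          list_all2 (rstep \<Sigma> R)\<^sup>*\<^sup>* us ws))"

end

theory Submission
  imports Defs
begin

text \<open>
  The proof is by a computability argument in the style of Tait and Girard. By well-founded recursion
  on the sort ordering and a least fixpoint inside each equivalence class of sorts there is a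
  computability predicate such that a computable term of base type is terminating and all accessible
  arguments of its reducts \<open>f s\<^sub>1 \<dots> s\<^sub>m\<close> are computable; positivity of the accessible positions
  makes the operator monotone. A non-terminating term is not computable, hence there is a minimal
  non-computable term \<open>f s\<^sub>1 \<dots> s\<^sub>k\<close>: the arguments are computable, \<open>f\<close> is defined and
  \<open>k = minar f\<close>. After reductions of the arguments some rule \<open>\<ell> \<Rightarrow> r\<close> applies at the root with
  \<open>r\<delta>\<close> not computable, and \<open>\<delta>\<close> is computable on the meta-variables of \<open>r\<close> because the system is
  accessible function passing. Descending into \<open>r\<close> along non-computable parts reaches a candidate \<open>p\<close>
  and an extension of \<open>\<delta>\<close> by computable terms that makes \<open>p\<close> minimal non-computable again; an argument
  \<open>i\<close> of a meta-variable \<open>Z\<close> has to be entered only if it occurs in the instance, which is the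
  condition \<open>Z : i\<close>. Iterating this step gives the chain.
\<close>

section \<open>Raw syntax\<close>

text \<open>Non-computability is always pushed to base type by supplying computable arguments. There
  \<open>f s1 ... sn\<close> with computable arguments can fail only through a root step, because
  argument steps decrease in a well-founded order. The first obstacle is that the rule substitution
  is known only through instances of the left-hand side, and an accessible
  \<open>Z<x1,...,xk>\<close> may lie below a variable-headed application, which gives no direct
  access to its arguments. Quantifying over all computable values of the free variables allows such
  heads to be replaced by projections. The descent into the right-hand side profits from the same
  freedom: entering a binder yields a free variable with a computable value, and these variables
  become the fresh meta-variables of \<open>metafy\<close>. The second obstacle is that applying the
  value of a meta-variable and instantiating it are different terms. They are joined by head
  \<beta>-steps, under which computability is invariant as long as the contracted arguments
  terminate. Minimal condition sets exist because the conditions considered are bounded by arities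
  and a finite domain.\<close>

fun lc :: "nat \<Rightarrow> ('f, 'v, 'm, 's) mt \<Rightarrow> bool" where
  "lc n (Bd i) \<longleftrightarrow> i < n"
| "lc n (Fv x) \<longleftrightarrow> True"
| "lc n (Fn f) \<longleftrightarrow> True"
| "lc n (App s t) \<longleftrightarrow> lc n s \<and> lc n t"
| "lc n (Lam \<sigma> s) \<longleftrightarrow> lc (Suc n) s"
| "lc n (Meta Z ss) \<longleftrightarrow> (\<forall>s\<in>set ss. lc n s)"

lemma lc_mono: "lc n s \<Longrightarrow> n \<le> m \<Longrightarrow> lc m s"
proof (induct s arbitrary: n m)
  case (Lam \<sigma> s)
  then show ?case by (metis Suc_le_mono lc.simps(5))
qed auto

lemma lift_lc: "lc n s \<Longrightarrow> n \<le> c \<Longrightarrow> lift c k s = s"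
  by (induct s arbitrary: n c) (auto intro!: map_idI)

lemma lift_0 [simp]: "lift c 0 s = s"
  by (induct s arbitrary: c) (auto simp: map_idI)

lemma lift_lift: "b \<le> c \<Longrightarrow> c \<le> b + d \<Longrightarrow> lift c e (lift b d s) = lift b (d + e) s"
  by (induct s arbitrary: b c) auto

lemma lift_lift_comm: "lift (c + e + d) n (lift c e s) = lift c e (lift (c + d) n s)"
proof (induct s arbitrary: c)
  case (Lam \<sigma> s)
  from Lam[of "Suc c"] show ?case by simp
qed auto

text \<open>The cutoff is split as \<open>c + e + d\<close> so that passing a \<open>Lam\<close>
  raises \<open>c\<close> alone. The gap of \<open>e\<close> indices made by \<open>lift\<close>
  lies below all indices that \<open>inst\<close> fills.\<close>

lemma inst_lift: "inst (c + e + d) rs (lift c e s) = lift c e (inst (c + d) rs s)"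
proof (induct s arbitrary: c)
  case (Lam \<sigma> s)
  from Lam[of "Suc c"] show ?case by simp
qed (auto simp: lift_lift add.commute add.left_commute)

lemma inst_lc: "lc n s \<Longrightarrow> n \<le> d \<Longrightarrow> inst d rs s = s"
  by (induct s arbitrary: n d) (auto intro!: map_idI)

lemma inst_Nil [simp]: "inst d [] s = s"
  by (induct s arbitrary: d) (auto simp: map_idI)

text \<open>The bound on \<open>u\<close> leaves no dangling index beyond those filled by
  \<open>ss\<close>; such an index could be filled by \<open>rs\<close> on the left but would stay
  on the right.\<close>

lemma inst_inst: "lc (length ss + e) u \<Longrightarrow> inst (d + e) rs (inst e ss u) = inst e (map (inst d rs) ss) u"
proof (induct u arbitrary: e)
  case (Bd i)
  then show ?case using inst_lift[of 0 e d rs] by (auto simp: rev_map add.commute)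
next
  case (Lam \<sigma> s)
  then show ?case using Lam(1)[of "Suc e"] by simp
qed auto

lemma lift_inst: "lc (length ss + e) u \<Longrightarrow> lift (d + e) n (inst e ss u) = inst e (map (lift d n) ss) u"
proof (induct u arbitrary: e)
  case (Bd i)
  then show ?case using lift_lift_comm[of 0 e d n] by (auto simp: rev_map add.commute)
next
  case (Lam \<sigma> s)
  then show ?case using Lam(1)[of "Suc e"] by simp
qed auto

lemma lc_inst: "lc (d + length ss) u \<Longrightarrow> \<forall>s\<in>set ss. lc 0 s \<Longrightarrow> lc d (inst d ss u)"
proof (induct u arbitrary: d)
  case (Bd i)
  have "lc d (lift 0 d (rev ss ! (i - d)))" if "i - d < length ss"
  proof -
    have "rev ss ! (i - d) \<in> set ss" using that by (metis length_rev nth_mem set_rev)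
    then have "lc 0 (rev ss ! (i - d))" using Bd by auto
    then show ?thesis using lift_lc[of 0 _ 0] lc_mono by fastforce
  qed
  then show ?case using Bd by auto
qed auto

text \<open>The closed terms \<open>rs\<close>, put in for the outer indices, are not touched when
  \<open>xs\<close> fills the inner ones, so both passes can be merged. From left to right this
  absorbs a \<beta>-contraction into a longer environment.\<close>

lemma inst_append:
  assumes "\<forall>r\<in>set rs. lc 0 r"
  shows "inst d xs (inst (d + length xs) rs b) = inst d (rs @ xs) b"
proof (induct b arbitrary: d)
  case (Bd i)
  show ?case
  proof (cases "i < d + length xs")
    case True
    then show ?thesis by (auto simp: nth_append)
  next
    case False
    show ?thesis
    proof (cases "i - d - length xs < length rs")
      case True
      let ?r = "rev rs ! (i - d - length xs)"
      have "?r \<in> set rs" using True by (metis length_rev nth_mem set_rev)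
      then have "lc 0 ?r" using assms by auto
      then show ?thesis using False True
        by (auto simp: nth_append lift_lc inst_lc)
    next
      case F: False
      then show ?thesis using False by (auto simp: nth_append)
    qed
  qed
next
  case (Lam \<sigma> s)
  then show ?case using Lam[of "Suc d"] by simp
qed auto

lemma subst_apps [simp]: "subst \<Sigma> \<gamma> (apps h ss) = apps (subst \<Sigma> \<gamma> h) (map (subst \<Sigma> \<gamma>) ss)"
  by (induct ss arbitrary: h) auto
lemma inst_apps [simp]: "inst d rs (apps h ss) = apps (inst d rs h) (map (inst d rs) ss)"
  by (induct ss arbitrary: h) auto
lemma lift_apps [simp]: "lift d n (apps h ss) = apps (lift d n h) (map (lift d n) ss)"
  by (induct ss arbitrary: h) auto
lemma lc_apps [simp]: "lc n (apps h ss) \<longleftrightarrow> lc n h \<and> (\<forall>s\<in>set ss. lc n s)"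
  by (induct ss arbitrary: h) auto
lemma FV_apps [simp]: "FV (apps h ss) = FV h \<union> (\<Union>s\<in>set ss. FV s)"
  by (induct ss arbitrary: h) auto
lemma FMV_apps [simp]: "FMV (apps h ss) = FMV h \<union> (\<Union>s\<in>set ss. FMV s)"
  by (induct ss arbitrary: h) auto

lemma finite_FV [simp]: "finite (FV s)" by (induct s) auto
lemma finite_FMV [simp]: "finite (FMV s)" by (induct s) auto

section \<open>Instances of meta-variables and commutation of substitution with
  instantiation\<close>

lemma strip_lams_lc: "strip_lams k t = (n, u) \<Longrightarrow> lc c t \<Longrightarrow> lc (n + c) u \<and> n \<le> k"
  by (induct k t arbitrary: n u c rule: strip_lams.induct)
     (auto split: prod.splits, metis add_Suc add_Suc_right)

text \<open>A closed value has indices only for the abstractions stripped from it, so an outer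
  instantiation reaches nothing but the arguments.\<close>

lemma inst_meta_inst: "lc 0 t \<Longrightarrow> inst d rs (meta_inst t ss) = meta_inst t (map (inst d rs) ss)"
proof -
  assume a: "lc 0 t"
  obtain n u where s: "strip_lams (length ss) t = (n, u)" by fastforce
  from strip_lams_lc[OF this a] have "lc (length (take n ss)) u" "n \<le> length ss" by auto
  then show ?thesis using s inst_inst[of "take n ss" 0 u d rs]
    by (simp add: meta_inst_def take_map drop_map)
qed

lemma lift_meta_inst: "lc 0 t \<Longrightarrow> lift d k (meta_inst t ss) = meta_inst t (map (lift d k) ss)"
proof -
  assume a: "lc 0 t"
  obtain n u where s: "strip_lams (length ss) t = (n, u)" by fastforce
  from strip_lams_lc[OF this a] have "lc (length (take n ss)) u" "n \<le> length ss" by auto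
  then show ?thesis using s lift_inst[of "take n ss" 0 u d k]
    by (simp add: meta_inst_def take_map drop_map)
qed

text \<open>Meta-variables are constrained on the domain only: elsewhere \<open>subst\<close> keeps
  them in place, and \<open>id_meta\<close> itself has dangling indices if the arity exceeds the
  number of argument types.\<close>

definition lc_subst :: "('f, 'v, 'm, 's) afsm_sig \<Rightarrow> ('f, 'v, 'm, 's) subst \<Rightarrow> bool" where
  "lc_subst \<Sigma> \<gamma> \<longleftrightarrow> (\<forall>x. lc 0 (\<gamma> (Inl x))) \<and> (\<forall>Z. Inr Z \<in> sdom \<Sigma> \<gamma> \<longrightarrow> lc 0 (\<gamma> (Inr Z)))"

lemma subst_lift: "lc_subst \<Sigma> \<gamma> \<Longrightarrow> subst \<Sigma> \<gamma> (lift c n s) = lift c n (subst \<Sigma> \<gamma> s)"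
proof (induct s arbitrary: c)
  case (Fv x)
  then show ?case using lift_lc[of 0 "\<gamma> (Inl x)" c n] by (simp add: lc_subst_def)
next
  case (Meta Z ss)
  then show ?case by (auto simp: lc_subst_def lift_meta_inst comp_def cong: map_cong)
qed auto

lemma subst_inst:
  "lc_subst \<Sigma> \<gamma> \<Longrightarrow> subst \<Sigma> \<gamma> (inst d rs s) = inst d (map (subst \<Sigma> \<gamma>) rs) (subst \<Sigma> \<gamma> s)"
proof (induct s arbitrary: d)
  case (Bd i)
  then show ?case by (auto simp: subst_lift rev_map)
next
  case (Fv x)
  then show ?case using inst_lc[of 0 "\<gamma> (Inl x)" d] by (simp add: lc_subst_def)
next
  case (Meta Z ss)
  then show ?case by (auto simp: lc_subst_def inst_meta_inst comp_def cong: map_cong)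
qed auto

lemma subst_cong:
  assumes "\<And>x. x \<in> FV s \<Longrightarrow> \<gamma> (Inl x) = \<gamma>' (Inl x)"
    and "\<And>Z. Z \<in> FMV s \<Longrightarrow> \<gamma> (Inr Z) = \<gamma>' (Inr Z)"
  shows "subst \<Sigma> \<gamma> s = subst \<Sigma> \<gamma>' s"
  using assms
proof (induct s)
  case (Meta Z ss)
  have "map (subst \<Sigma> \<gamma>) ss = map (subst \<Sigma> \<gamma>') ss"
    by (intro map_cong refl Meta(1)) (auto intro!: Meta(2,3))
  moreover have "\<gamma> (Inr Z) = \<gamma>' (Inr Z)" using Meta by auto
  ultimately show ?case by (simp only: subst.simps sdom_def mem_Collect_eq)
qed auto

section \<open>Closing and opening binders\<close>

lemma lc_close: "lc d s \<Longrightarrow> lc (Suc d) (close x d s)"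
  by (induct s arbitrary: d) auto

lemma inst_close: "lc d s \<Longrightarrow> inst d [Fv x] (close x d s) = s"
  by (induct s arbitrary: d) (auto simp: map_idI)

lemma close_inst: "lc (Suc d) b \<Longrightarrow> x \<notin> FV b \<Longrightarrow> close x d (inst d [Fv x] b) = b"
  by (induct b arbitrary: d) (auto simp: map_idI)

lemma FV_close [simp]: "FV (close x d s) = FV s - {x}"
  by (induct s arbitrary: d) auto
lemma FMV_close [simp]: "FMV (close x d s) = FMV s"
  by (induct s arbitrary: d) auto
lemma FV_lift [simp]: "FV (lift d n s) = FV s"
  by (induct s arbitrary: d) auto
lemma FMV_lift [simp]: "FMV (lift d n s) = FMV s"
  by (induct s arbitrary: d) auto

lemma list_all2_in_set1: "list_all2 P xs ys \<Longrightarrow> x \<in> set xs \<Longrightarrow> \<exists>y\<in>set ys. P x y"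
  by (induct rule: list_all2_induct) auto

lemma rev_nth_mem: "i < length ss \<Longrightarrow> rev ss ! i \<in> set ss"
  by (metis length_rev nth_mem set_rev)

lemma FV_inst: "FV (inst d rs s) \<subseteq> FV s \<union> (\<Union>r\<in>set rs. FV r)"
  by (induct s arbitrary: d) (auto dest!: rev_nth_mem)
lemma FMV_inst: "FMV (inst d rs s) \<subseteq> FMV s \<union> (\<Union>r\<in>set rs. FMV r)"
  by (induct s arbitrary: d) (auto dest!: rev_nth_mem)
lemma FMV_strip_lams: "strip_lams k t = (n, u) \<Longrightarrow> FMV u = FMV t"
  by (induct k t arbitrary: n u rule: strip_lams.induct) (auto split: prod.splits)

lemma FMV_meta_inst: "FMV (meta_inst t ss) \<subseteq> FMV t \<union> (\<Union>s\<in>set ss. FMV s)"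
proof -
  obtain n u where s: "strip_lams (length ss) t = (n, u)" by fastforce
  show ?thesis using FMV_inst[of 0 "take n ss" u] FMV_strip_lams[OF s] s
    by (auto simp: meta_inst_def dest!: in_set_dropD) (blast dest: in_set_takeD)
qed

lemma FMV_subst:
  assumes "\<forall>x\<in>FV s. FMV (\<gamma> (Inl x)) = {}" "\<forall>Z\<in>FMV s. Inr Z \<in> sdom \<Sigma> \<gamma> \<and> FMV (\<gamma> (Inr Z)) = {}"
  shows "FMV (subst \<Sigma> \<gamma> s) = {}"
  using assms
proof (induct s)
  case (Meta Z ss)
  then show ?case using FMV_meta_inst[of "\<gamma> (Inr Z)" "map (subst \<Sigma> \<gamma>) ss"] by fastforce
qed auto

lemma sdom_upd_Inl [simp]: "Inr Z \<in> sdom \<Sigma> (\<gamma>(Inl x := a)) \<longleftrightarrow> Inr Z \<in> sdom \<Sigma> \<gamma>"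
  by (simp add: sdom_def)

lemma sdom_id [simp]: "Inr Z \<notin> sdom \<Sigma> (id_subst \<Sigma>)"
  by (simp add: sdom_def)

lemma id_subst_Inl [simp]: "id_subst \<Sigma> (Inl x) = Fv x"
  by (simp add: id_subst_def)

lemma subst_id [simp]: "subst \<Sigma> (id_subst \<Sigma>) s = s"
  by (induct s) (auto simp: map_idI)

text \<open>Bridge between named and nameless substitution: closing removes \<open>x\<close>, so
  \<gamma> may be changed at \<open>x\<close> first, and opening the index with \<open>a\<close>
  then amounts to the new value at \<open>x\<close>.\<close>

lemma inst_subst_close:
  assumes "lc_subst \<Sigma> \<gamma>" "lc 0 a" "lc d s"
  shows "inst d [a] (subst \<Sigma> \<gamma> (close x d s)) = subst \<Sigma> (\<gamma>(Inl x := a)) s"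
proof -
  let ?g = "\<gamma>(Inl x := a)"
  have lg: "lc_subst \<Sigma> ?g" using assms by (auto simp: lc_subst_def)
  have "subst \<Sigma> \<gamma> (close x d s) = subst \<Sigma> ?g (close x d s)"
    by (rule subst_cong) auto
  then have "inst d [a] (subst \<Sigma> \<gamma> (close x d s)) = subst \<Sigma> ?g (inst d [Fv x] (close x d s))"
    using subst_inst[OF lg] by simp
  then show ?thesis using assms by (simp add: inst_close)
qed

lemma lc_subst_id: "lc_subst \<Sigma> (id_subst \<Sigma>)" by (simp add: lc_subst_def)

lemma subst1_inst: "lc 0 a \<Longrightarrow> lc 0 s \<Longrightarrow> subst1 \<Sigma> x a s = inst 0 [a] (close x 0 s)"
  using inst_subst_close[OF lc_subst_id, of a 0 s \<Sigma> x] by (simp add: subst1_def)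

lemma subst_inst_fresh:
  assumes "lc_subst \<Sigma> \<gamma>" "lc 0 a" "x \<notin> FV b"
  shows "inst d [a] (subst \<Sigma> \<gamma> b) = subst \<Sigma> (\<gamma>(Inl x := a)) (inst d [Fv x] b)"
proof -
  let ?g = "\<gamma>(Inl x := a)"
  have lg: "lc_subst \<Sigma> ?g" using assms by (auto simp: lc_subst_def)
  have "subst \<Sigma> \<gamma> b = subst \<Sigma> ?g b"
    using assms(3) by (intro subst_cong) auto
  then show ?thesis using subst_inst[OF lg] by simp
qed

section \<open>Typing\<close>

text \<open>
  Typing with a context for the dangling indices. In contrast to \<open>has_type\<close>, inductions on it
  need no renaming of bound variables.
\<close>

primrec wt :: "('f, 'v, 'm, 's) afsm_sig \<Rightarrow> 's ty list \<Rightarrow> ('f, 'v, 'm, 's) mt \<Rightarrow> 's ty \<Rightarrow> bool" where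
  "wt \<Sigma> \<Gamma> (Bd i) = (\<lambda>\<tau>. i < length \<Gamma> \<and> \<Gamma> ! i = \<tau>)"
| "wt \<Sigma> \<Gamma> (Fv x) = (\<lambda>\<tau>. vtype \<Sigma> x = \<tau>)"
| "wt \<Sigma> \<Gamma> (Fn f) = (\<lambda>\<tau>. f \<in> funs \<Sigma> \<and> ftype \<Sigma> f = \<tau>)"
| "wt \<Sigma> \<Gamma> (App s t) = (\<lambda>\<tau>. \<exists>\<sigma>. wt \<Sigma> \<Gamma> s (\<sigma> \<rightarrow> \<tau>) \<and> wt \<Sigma> \<Gamma> t \<sigma>)"
| "wt \<Sigma> \<Gamma> (Lam \<sigma> s) = (\<lambda>\<tau>. \<exists>\<tau>'. \<tau> = \<sigma> \<rightarrow> \<tau>' \<and> wt \<Sigma> (\<sigma> # \<Gamma>) s \<tau>')"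
| "wt \<Sigma> \<Gamma> (Meta Z ss) = (\<lambda>\<tau>. \<exists>\<sigma>s. mtype \<Sigma> Z = arrows \<sigma>s \<tau> \<and> length \<sigma>s = arity \<Sigma> Z \<and>
     list_all2 (\<lambda>p \<sigma>. p \<sigma>) (map (wt \<Sigma> \<Gamma>) ss) \<sigma>s)"

text \<open>\<open>wt\<close> returns a predicate on types so that primitive recursion can pass
  through the argument list by \<open>map\<close>; this is the equation that is meant.\<close>

lemma wt_Meta [simp]: "wt \<Sigma> \<Gamma> (Meta Z ss) \<tau> \<longleftrightarrow>
  (\<exists>\<sigma>s. mtype \<Sigma> Z = arrows \<sigma>s \<tau> \<and> length \<sigma>s = arity \<Sigma> Z \<and> list_all2 (wt \<Sigma> \<Gamma>) ss \<sigma>s)"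
  by (simp add: list_all2_map1)
declare wt.simps(6) [simp del]

lemma arrows_inj: "arrows \<sigma>s \<tau> = arrows \<sigma>s' \<tau>' \<Longrightarrow> length \<sigma>s = length \<sigma>s' \<Longrightarrow> \<sigma>s = \<sigma>s' \<and> \<tau> = \<tau>'"
  by (induct \<sigma>s arbitrary: \<sigma>s') (auto simp: Suc_length_conv length_Suc_conv)

lemma wt_unique: "wt \<Sigma> \<Gamma> s \<tau> \<Longrightarrow> wt \<Sigma> \<Gamma> s \<tau>' \<Longrightarrow> \<tau> = \<tau>'"
proof (induct s arbitrary: \<Gamma> \<tau> \<tau>')
  case (Meta Z ss)
  then show ?case by (metis arrows_inj wt_Meta)
next
  case (App s1 s2)
  then show ?case by (metis ty.inject(2) wt.simps(4))
next
  case (Lam \<sigma> s)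
  then show ?case by (metis wt.simps(5))
qed auto

lemma wt_lc: "wt \<Sigma> \<Gamma> s \<tau> \<Longrightarrow> lc (length \<Gamma>) s"
proof (induct s arbitrary: \<Gamma> \<tau>)
  case (Meta Z ss)
  then obtain \<sigma>s where "list_all2 (wt \<Sigma> \<Gamma>) ss \<sigma>s" by auto
  then show ?case using Meta(1) by (auto simp: list_all2_conv_all_nth in_set_conv_nth) blast
next
  case (Lam \<sigma> s)
  then show ?case by force
qed auto

lemma wt_lift: "wt \<Sigma> (\<Gamma>1 @ \<Gamma>2) s \<tau> \<Longrightarrow> wt \<Sigma> (\<Gamma>1 @ \<Delta> @ \<Gamma>2) (lift (length \<Gamma>1) (length \<Delta>) s) \<tau>"
proof (induct s arbitrary: \<Gamma>1 \<tau>)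
  case (Meta Z ss)
  then show ?case by (fastforce simp: list_all2_map1 elim!: list.rel_mono_strong)
next
  case (Lam \<sigma> s)
  then show ?case using Lam(1)[of "\<sigma> # \<Gamma>1"] by auto
qed (auto simp: nth_append, blast)

lemma wt_weaken: "wt \<Sigma> [] s \<tau> \<Longrightarrow> wt \<Sigma> \<Gamma> s \<tau>"
  using wt_lift[of \<Sigma> "[]" "[]" s \<tau> \<Gamma>] wt_lc[of \<Sigma> "[]" s \<tau>] by (simp add: lift_lc)

lemma wt_inst:
  "wt \<Sigma> (\<Gamma>1 @ \<Delta> @ \<Gamma>2) u \<tau> \<Longrightarrow> list_all2 (wt \<Sigma> \<Gamma>2) (rev rs) \<Delta> \<Longrightarrow>
   wt \<Sigma> (\<Gamma>1 @ \<Gamma>2) (inst (length \<Gamma>1) rs u) \<tau>"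
proof (induct u arbitrary: \<Gamma>1 \<tau>)
  case (Bd i)
  have l: "length rs = length \<Delta>" using Bd(2) by (auto dest: list_all2_lengthD)
  have "wt \<Sigma> \<Gamma>2 (rev rs ! (i - length \<Gamma>1)) \<tau>" if "i \<ge> length \<Gamma>1" "i - length \<Gamma>1 < length rs"
    using that Bd l by (auto simp: nth_append list_all2_conv_all_nth)
  then have "wt \<Sigma> (\<Gamma>1 @ \<Gamma>2) (lift 0 (length \<Gamma>1) (rev rs ! (i - length \<Gamma>1))) \<tau>"
    if "i \<ge> length \<Gamma>1" "i - length \<Gamma>1 < length rs"
    using that wt_lift[of \<Sigma> "[]" \<Gamma>2 _ \<tau> \<Gamma>1] by simp
  then show ?case using Bd(1) l by (auto simp: nth_append add.commute split: if_splits)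
next
  case (Meta Z ss)
  then show ?case by (fastforce simp: list_all2_map1 elim!: list.rel_mono_strong)
next
  case (Lam \<sigma> s)
  then show ?case using Lam(1)[of "\<sigma> # \<Gamma>1"] by auto
qed (auto, blast)

lemma wt_inst0: "wt \<Sigma> (rev \<Delta>) u \<tau> \<Longrightarrow> list_all2 (wt \<Sigma> []) rs \<Delta> \<Longrightarrow> wt \<Sigma> [] (inst 0 rs u) \<tau>"
  using wt_inst[of \<Sigma> "[]" "rev \<Delta>" "[]" u \<tau> rs] by simp

lemma wt_apps: "wt \<Sigma> \<Gamma> (apps h ss) \<tau> \<longleftrightarrow> (\<exists>\<sigma>s. wt \<Sigma> \<Gamma> h (arrows \<sigma>s \<tau>) \<and> list_all2 (wt \<Sigma> \<Gamma>) ss \<sigma>s)"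
proof (induct ss arbitrary: h)
  case Nil
  then show ?case by simp
next
  case (Cons a ss)
  show ?case
  proof
    assume "wt \<Sigma> \<Gamma> (apps h (a # ss)) \<tau>"
    then obtain \<sigma>s \<sigma> where "list_all2 (wt \<Sigma> \<Gamma>) ss \<sigma>s" "wt \<Sigma> \<Gamma> h (\<sigma> \<rightarrow> arrows \<sigma>s \<tau>)" "wt \<Sigma> \<Gamma> a \<sigma>"
      using Cons by auto
    then show "\<exists>\<sigma>s. wt \<Sigma> \<Gamma> h (arrows \<sigma>s \<tau>) \<and> list_all2 (wt \<Sigma> \<Gamma>) (a # ss) \<sigma>s"
      by (intro exI[of _ "\<sigma> # \<sigma>s"]) auto
  next
    assume "\<exists>\<sigma>s. wt \<Sigma> \<Gamma> h (arrows \<sigma>s \<tau>) \<and> list_all2 (wt \<Sigma> \<Gamma>) (a # ss) \<sigma>s"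
    then show "wt \<Sigma> \<Gamma> (apps h (a # ss)) \<tau>" using Cons by (auto simp: list_all2_Cons1) blast
  qed
qed

text \<open>The value of a meta-variable may start with fewer abstractions than the arity; the types
  of the remaining arguments then stay in the arrow type of \<open>u\<close>. The context is
  reversed because the innermost binder has index 0.\<close>

lemma wt_strip_lams:
  "strip_lams (length \<sigma>s) t = (n, u) \<Longrightarrow> wt \<Sigma> \<Gamma> t (arrows \<sigma>s \<tau>) \<Longrightarrow>
   n \<le> length \<sigma>s \<and> wt \<Sigma> (rev (take n \<sigma>s) @ \<Gamma>) u (arrows (drop n \<sigma>s) \<tau>)"
proof (induct \<sigma>s arbitrary: t n u \<Gamma>)
  case (Cons \<sigma> \<sigma>s)
  show ?case
  proof (cases t)
    case (Lam \<sigma>' b)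
    then obtain m where "strip_lams (length \<sigma>s) b = (m, u)" "n = Suc m"
      using Cons(2) by (auto split: prod.splits)
    then show ?thesis using Cons Lam by fastforce
  qed (use Cons in auto)
qed auto

lemma wt_meta_inst:
  assumes "wt \<Sigma> [] t (arrows \<sigma>s \<tau>)" "list_all2 (wt \<Sigma> \<Gamma>) ss \<sigma>s"
  shows "wt \<Sigma> \<Gamma> (meta_inst t ss) \<tau>"
proof -
  obtain n u where s: "strip_lams (length ss) t = (n, u)" by fastforce
  have l: "length ss = length \<sigma>s" using assms by (auto dest: list_all2_lengthD)
  have u: "wt \<Sigma> (rev (take n \<sigma>s) @ \<Gamma>) u (arrows (drop n \<sigma>s) \<tau>)"
    using wt_strip_lams[of \<sigma>s t n u \<Sigma> \<Gamma> \<tau>] s l assms(1) wt_weaken by force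
  have "list_all2 (wt \<Sigma> \<Gamma>) (rev (take n ss)) (rev (take n \<sigma>s))"
    using assms(2) by (simp add: list_all2_takeI)
  from wt_inst[of \<Sigma> "[]", simplified, OF u this]
  show ?thesis using s assms(2) by (auto simp: meta_inst_def wt_apps intro: list_all2_dropI)
qed

lemma wt_subst:
  assumes "\<forall>x\<in>FV s. wt \<Sigma> [] (\<gamma> (Inl x)) (vtype \<Sigma> x)"
    and "\<forall>Z\<in>FMV s. Inr Z \<in> sdom \<Sigma> \<gamma> \<longrightarrow> wt \<Sigma> [] (\<gamma> (Inr Z)) (mtype \<Sigma> Z)"
  shows "wt \<Sigma> \<Gamma> s \<tau> \<Longrightarrow> wt \<Sigma> \<Gamma> (subst \<Sigma> \<gamma> s) \<tau>"
  using assms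
proof (induct s arbitrary: \<Gamma> \<tau>)
  case (Fv x)
  then show ?case by (auto intro: wt_weaken)
next
  case (Meta Z ss)
  then obtain \<sigma>s where s: "mtype \<Sigma> Z = arrows \<sigma>s \<tau>" "length \<sigma>s = arity \<Sigma> Z" "list_all2 (wt \<Sigma> \<Gamma>) ss \<sigma>s"
    by auto
  have "list_all2 (wt \<Sigma> \<Gamma>) (map (subst \<Sigma> \<gamma>) ss) \<sigma>s"
    unfolding list_all2_map1 using s(3) Meta(1,3,4) by (elim list.rel_mono_strong) fastforce
  then show ?case using s Meta(4) wt_meta_inst[of \<Sigma> "\<gamma> (Inr Z)" \<sigma>s \<tau>] by auto
qed (auto, blast)

lemma wt_close: "wt \<Sigma> \<Gamma> s \<tau> \<Longrightarrow> wt \<Sigma> (\<Gamma> @ [vtype \<Sigma> x]) (close x (length \<Gamma>) s) \<tau>"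
proof (induct s arbitrary: \<Gamma> \<tau>)
  case (Meta Z ss)
  then show ?case by (fastforce simp: list_all2_map1 elim!: list.rel_mono_strong)
next
  case (Lam \<sigma> s)
  then show ?case using Lam(1)[of "\<sigma> # \<Gamma>"] by auto
qed (auto simp: nth_append, blast)

lemma has_type_wt: "has_type \<Sigma> s \<tau> \<Longrightarrow> wt \<Sigma> [] s \<tau>"
proof (induct rule: has_type.induct)
  case (lam s \<tau> x)
  then show ?case using wt_close[of \<Sigma> "[]"] by (simp add: lam_def)
next
  case (meta Z \<sigma>s \<tau> ss)
  then show ?case using list_all2_mono by fastforce
qed auto

lemma ex_fresh: "wf_sig \<Sigma> \<Longrightarrow> finite S \<Longrightarrow> \<exists>x. vtype \<Sigma> x = \<sigma> \<and> x \<notin> S"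
  unfolding wf_sig_def using finite_subset[of "{x. vtype \<Sigma> x = \<sigma>}" S] by blast

text \<open>A derivation of \<open>has_type\<close> names every bound variable, so the induction
  runs over terms whose context has been opened with named variables. The list \<open>xs\<close> is
  reversed against the context since the last element fills index 0; below a binder a fresh variable
  is appended to it.\<close>

lemma wt_has_type_inst:
  assumes "wf_sig \<Sigma>"
  shows "wt \<Sigma> \<Gamma> s \<tau> \<Longrightarrow> map (vtype \<Sigma>) (rev xs) = \<Gamma> \<Longrightarrow> has_type \<Sigma> (inst 0 (map Fv xs) s) \<tau>"
proof (induct s arbitrary: \<Gamma> \<tau> xs)
  case (Bd i)
  then have "rev (map Fv xs) ! i = (Fv (rev xs ! i) :: ('a,'b,'c,'d) mt)" by (auto simp: rev_map)
  then show ?case using Bd has_type.var[of \<Sigma> "rev xs ! i"] by auto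
next
  case (Fv x)
  then show ?case using has_type.var[of \<Sigma> x] by auto
next
  case (Fn f)
  then show ?case using has_type.fn[of f \<Sigma>] by auto
next
  case (App s t)
  then show ?case using has_type.app[of \<Sigma>] by fastforce
next
  case (Lam \<sigma> s)
  obtain x where x: "vtype \<Sigma> x = \<sigma>" "x \<notin> FV s \<union> set xs" using ex_fresh[OF assms, of "FV s \<union> set xs"] by auto
  obtain \<tau>' where t: "\<tau> = \<sigma> \<rightarrow> \<tau>'" "wt \<Sigma> (\<sigma> # \<Gamma>) s \<tau>'" using Lam by auto
  have h: "has_type \<Sigma> (inst 0 (map Fv (xs @ [x])) s) \<tau>'" using Lam(1)[OF t(2), of "xs @ [x]"] Lam(3) x by simp
  let ?b = "inst 1 (map Fv xs) s"
  have e: "inst 0 [Fv x] ?b = inst 0 (map Fv (xs @ [x])) s"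
    using inst_append[of "map Fv xs" 0 "[Fv x]" s] by simp
  have "FV ?b \<subseteq> FV s \<union> set xs" using FV_inst[of 1 "map Fv xs" s] by auto
  moreover have "lc 1 ?b" using wt_lc[OF t(2)] Lam(3) lc_inst[of 1 "map Fv xs" s] by auto
  ultimately have "close x 0 (inst 0 [Fv x] ?b) = ?b" using x by (intro close_inst) auto
  then have "lam \<Sigma> x (inst 0 (map Fv (xs @ [x])) s) = Lam \<sigma> ?b" using e x by (simp add: lam_def)
  then show ?case using has_type.lam[OF h, of x] x t by simp
next
  case (Meta Z ss)
  then obtain \<sigma>s where s: "mtype \<Sigma> Z = arrows \<sigma>s \<tau>" "length \<sigma>s = arity \<Sigma> Z" "list_all2 (wt \<Sigma> \<Gamma>) ss \<sigma>s"
    by auto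
  have "list_all2 (has_type \<Sigma>) (map (inst 0 (map Fv xs)) ss) \<sigma>s"
    unfolding list_all2_map1 using s(3) Meta(1,3) by (elim list.rel_mono_strong) fastforce
  then show ?case using s has_type.meta by fastforce
qed

lemma has_type_iff: "wf_sig \<Sigma> \<Longrightarrow> has_type \<Sigma> s \<tau> \<longleftrightarrow> wt \<Sigma> [] s \<tau>"
  using has_type_wt wt_has_type_inst[of \<Sigma> "[]" s \<tau> "[]"] by fastforce

section \<open>Reduction\<close>

fun is_App where "is_App (App s t) \<longleftrightarrow> True" | "is_App _ \<longleftrightarrow> False"

lemma apps_eq_iff:
  "\<not> is_App h \<Longrightarrow> \<not> is_App h' \<Longrightarrow> apps h ss = apps h' ss' \<longleftrightarrow> h = h' \<and> ss = ss'"
proof (induct ss arbitrary: ss' rule: rev_induct)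
  case Nil
  then show ?case by (cases ss' rule: rev_cases) auto
next
  case (snoc a ss)
  then show ?case by (cases ss' rule: rev_cases) auto
qed

lemma ex_head: "\<exists>h ss. s = apps h ss \<and> \<not> is_App h"
proof (induct s)
  case (App s1 s2)
  then obtain h ss where "s1 = apps h ss" "\<not> is_App h" by auto
  then show ?case by (intro exI[of _ h] exI[of _ "ss @ [s2]"]) auto
qed (rule exI, rule exI[of _ "[]"], force)+

lemma strip_lams_foldr: "strip_lams (length \<sigma>s) (foldr Lam \<sigma>s u) = (length \<sigma>s, u)"
  by (induct \<sigma>s) auto

lemma meta_inst_foldr: "length ss = length \<sigma>s \<Longrightarrow> meta_inst (foldr Lam \<sigma>s u) ss = inst 0 ss u"
  using strip_lams_foldr[of \<sigma>s u] by (simp add: meta_inst_def)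

lemma map_inst_Bds: "length ss = k \<Longrightarrow> map (inst 0 ss \<circ> Bd) (rev [0..<k]) = ss"
  by (intro nth_equalityI) (auto simp: rev_nth)

lemma wt_foldr_Lam: "wt \<Sigma> (rev \<sigma>s @ \<Gamma>) u \<tau> \<Longrightarrow> wt \<Sigma> \<Gamma> (foldr Lam \<sigma>s u) (arrows \<sigma>s \<tau>)"
  by (induct \<sigma>s arbitrary: \<Gamma>) auto

lemma FMV_foldr_Lam [simp]: "FMV (foldr Lam \<sigma>s u) = FMV u"
  by (induct \<sigma>s) auto

lemma ty_args_arrows [simp]: "ty_args (arrows \<sigma>s \<tau>) = \<sigma>s @ ty_args \<tau>"
  by (induct \<sigma>s) auto
lemma ty_res_arrows [simp]: "ty_res (arrows \<sigma>s \<tau>) = ty_res \<tau>"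
  by (induct \<sigma>s) auto
lemma arrows_ty_args [simp]: "arrows (ty_args \<tau>) (Sort (ty_res \<tau>)) = \<tau>"
  by (induct \<tau>) auto

lemma wt_FMV: "wt \<Sigma> \<Gamma> s \<tau> \<Longrightarrow> Z \<in> FMV s \<Longrightarrow> \<exists>\<sigma>s \<tau>'. mtype \<Sigma> Z = arrows \<sigma>s \<tau>' \<and> length \<sigma>s = arity \<Sigma> Z"
proof (induct s arbitrary: \<Gamma> \<tau>)
  case (Meta Y ss)
  show ?case
  proof (cases "Z = Y")
    case True
    then show ?thesis using Meta by auto
  next
    case False
    then obtain s where "s \<in> set ss" "Z \<in> FMV s" using Meta by auto
    moreover then obtain \<sigma> where "wt \<Sigma> \<Gamma> s \<sigma>"
      using Meta(2) list_all2_in_set1[of "wt \<Sigma> \<Gamma>" ss] by auto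
    ultimately show ?thesis using Meta(1) by blast
  qed
qed auto

lemma list_all2_Bds: "list_all2 (wt \<Sigma> (rev \<sigma>s)) (map Bd (rev [0..<length \<sigma>s])) \<sigma>s"
  by (auto simp: list_all2_conv_all_nth rev_nth)

lemma id_subst_FMV: "FMV (id_subst \<Sigma> (Inr Z)) = {Z}"
  by (auto simp: id_subst_def id_meta_def)

locale afsm_system =
  fixes \<Sigma> :: "('f, 'v, 'm, 's) afsm_sig" and R :: "('f, 'v, 'm, 's) rule set"
  assumes afsm: "afsm \<Sigma> R"
begin

abbreviation rsteps where "rsteps \<equiv> (rstep \<Sigma> R)\<^sup>*\<^sup>*"

lemma wf: "wf_sig \<Sigma>" using afsm by (simp add: afsm_def)

definition tm where "tm s \<tau> \<longleftrightarrow> wt \<Sigma> [] s \<tau> \<and> FMV s = {}"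
definition trm where "trm s \<longleftrightarrow> (\<exists>\<tau>. tm s \<tau>)"

lemma is_mterm_iff: "is_mterm \<Sigma> s \<longleftrightarrow> (\<exists>\<tau>. wt \<Sigma> [] s \<tau>)"
  by (simp add: is_mterm_def has_type_iff[OF wf])

lemma is_term_iff: "is_term \<Sigma> s \<longleftrightarrow> trm s"
  by (auto simp: is_term_def is_mterm_iff trm_def tm_def)

lemma tm_unique: "tm s \<tau> \<Longrightarrow> tm s \<tau>' \<Longrightarrow> \<tau> = \<tau>'"
  by (auto simp: tm_def wt_unique)

lemma tm_lc: "tm s \<tau> \<Longrightarrow> lc 0 s"
  using wt_lc by (fastforce simp: tm_def)
lemma trm_lc: "trm s \<Longrightarrow> lc 0 s"
  using tm_lc by (auto simp: trm_def)

lemma tm_App: "tm (App s t) \<tau> \<longleftrightarrow> (\<exists>\<sigma>. tm s (\<sigma> \<rightarrow> \<tau>) \<and> tm t \<sigma>)"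
  by (auto simp: tm_def)
lemma tm_Fv [simp]: "tm (Fv x) \<tau> \<longleftrightarrow> vtype \<Sigma> x = \<tau>"
  by (auto simp: tm_def)

lemma tm_apps: "tm (apps h ss) \<tau> \<longleftrightarrow> (\<exists>\<sigma>s. tm h (arrows \<sigma>s \<tau>) \<and> list_all2 tm ss \<sigma>s)"
proof -
  have "list_all2 tm ss \<sigma>s \<longleftrightarrow> list_all2 (wt \<Sigma> []) ss \<sigma>s \<and> (\<forall>s\<in>set ss. FMV s = {})" for \<sigma>s
    unfolding tm_def by (auto elim: list.rel_mono_strong dest: list_all2_in_set1)
  then show ?thesis by (auto simp: tm_def wt_apps)
qed

lemma trm_apps_arg: "trm (apps h ss) \<Longrightarrow> s \<in> set ss \<Longrightarrow> trm s"
  by (auto simp: trm_def tm_apps list_all2_conv_all_nth in_set_conv_nth)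
lemma trm_apps_head: "trm (apps h ss) \<Longrightarrow> trm h"
  by (auto simp: trm_def tm_apps)

lemma fresh: "finite S \<Longrightarrow> \<exists>x. vtype \<Sigma> x = \<sigma> \<and> x \<notin> S"
  using ex_fresh[OF wf] .

definition tsubst where
  "tsubst \<gamma> \<longleftrightarrow> (\<forall>x. tm (\<gamma> (Inl x)) (vtype \<Sigma> x)) \<and> (\<forall>Z. Inr Z \<in> sdom \<Sigma> \<gamma> \<longrightarrow> tm (\<gamma> (Inr Z)) (mtype \<Sigma> Z))"

lemma is_subst_iff: "is_subst \<Sigma> \<gamma> \<longleftrightarrow> tsubst \<gamma>"
proof -
  have t: "(is_term \<Sigma> s \<and> has_type \<Sigma> s \<tau>) \<longleftrightarrow> tm s \<tau>" for s \<tau>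
    by (auto simp: is_term_def is_mterm_iff tm_def has_type_iff[OF wf])
  have x: "tm (\<gamma> (Inl x)) (vtype \<Sigma> x)" if "Inl x \<notin> sdom \<Sigma> \<gamma>" for x
    using that by (simp add: sdom_def)
  show ?thesis unfolding is_subst_def tsubst_def t
  proof (intro iffI conjI allI impI ballI)
    fix x assume "\<forall>a\<in>sdom \<Sigma> \<gamma>. tm (\<gamma> a) (case_sum (vtype \<Sigma>) (mtype \<Sigma>) a)"
    then show "tm (\<gamma> (Inl x)) (vtype \<Sigma> x)" using x[of x] by (cases "Inl x \<in> sdom \<Sigma> \<gamma>") auto
  next
    fix a assume "(\<forall>x. tm (\<gamma> (Inl x)) (vtype \<Sigma> x)) \<and> (\<forall>Z. Inr Z \<in> sdom \<Sigma> \<gamma> \<longrightarrow> tm (\<gamma> (Inr Z)) (mtype \<Sigma> Z))"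
      "a \<in> sdom \<Sigma> \<gamma>"
    then show "tm (\<gamma> a) (case_sum (vtype \<Sigma>) (mtype \<Sigma>) a)" by (cases a) auto
  qed force
qed

lemma tsubst_lc: "tsubst \<gamma> \<Longrightarrow> lc_subst \<Sigma> \<gamma>"
  using tm_lc by (fastforce simp: tsubst_def lc_subst_def)

lemma tsubst_upd: "tsubst \<gamma> \<Longrightarrow> tm a (vtype \<Sigma> x) \<Longrightarrow> tsubst (\<gamma>(Inl x := a))"
  by (simp add: tsubst_def)

lemma tsubst_id: "tsubst (id_subst \<Sigma>)"
  by (simp add: tsubst_def)

lemma wt_tsubst: "tsubst \<gamma> \<Longrightarrow> wt \<Sigma> \<Gamma> s \<tau> \<Longrightarrow> wt \<Sigma> \<Gamma> (subst \<Sigma> \<gamma> s) \<tau>"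
  by (rule wt_subst) (auto simp: tsubst_def tm_def)

lemma tm_subst: "tsubst \<gamma> \<Longrightarrow> wt \<Sigma> [] s \<tau> \<Longrightarrow> \<forall>Z\<in>FMV s. Inr Z \<in> sdom \<Sigma> \<gamma> \<Longrightarrow> tm (subst \<Sigma> \<gamma> s) \<tau>"
  unfolding tm_def using wt_tsubst FMV_subst[of s \<gamma> \<Sigma>] by (auto simp: tsubst_def tm_def)

lemma tm_inst1: "wt \<Sigma> [\<sigma>] b \<tau> \<Longrightarrow> FMV b = {} \<Longrightarrow> tm a \<sigma> \<Longrightarrow> tm (inst 0 [a] b) \<tau>"
  unfolding tm_def using wt_inst0[of \<Sigma> "[\<sigma>]" b \<tau> "[a]"] FMV_inst[of 0 "[a]" b] by auto

lemma tm_Lam: "tm (Lam \<sigma> b) \<tau> \<longleftrightarrow> (\<exists>\<tau>'. \<tau> = \<sigma> \<rightarrow> \<tau>' \<and> wt \<Sigma> [\<sigma>] b \<tau>' \<and> FMV b = {})"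
  by (auto simp: tm_def)

lemma lam_inst: "x \<notin> FV b \<Longrightarrow> lc 1 b \<Longrightarrow> lam \<Sigma> x (inst 0 [Fv x] b) = Lam (vtype \<Sigma> x) b"
  by (simp add: lam_def close_inst)

lemma tm_lam: "tm s \<tau> \<Longrightarrow> tm (lam \<Sigma> x s) (vtype \<Sigma> x \<rightarrow> \<tau>)"
  using wt_close[of \<Sigma> "[]" s \<tau> x] by (simp add: lam_def tm_def)

lemma ruleD:
  assumes "(l, r) \<in> R"
  obtains f ls \<tau> where "l = apps (Fn f) ls" "wt \<Sigma> [] l \<tau>" "wt \<Sigma> [] r \<tau>" "FV l = {}" "FV r = {}"
    "pattern \<Sigma> l" "FMV r \<subseteq> FMV l"
proof -
  have "is_rule \<Sigma> (l, r)" using assms afsm by (auto simp: afsm_def)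
  then show ?thesis unfolding is_rule_def prod.case has_type_iff[OF wf] using that by blast
qed

lemma subst1_tm: "tm a \<sigma> \<Longrightarrow> tm s \<tau> \<Longrightarrow> subst1 \<Sigma> x a s = inst 0 [a] (close x 0 s)"
  by (rule subst1_inst) (erule tm_lc)+

lemma beta_tm:
  assumes "is_term \<Sigma> s" "is_term \<Sigma> t" "has_type \<Sigma> t (vtype \<Sigma> x)"
  obtains \<tau> where "tm s \<tau>" "tm t (vtype \<Sigma> x)"
  using assms by (auto simp: is_term_def is_mterm_iff tm_def has_type_iff[OF wf])

lemma rstep_tm: "rstep \<Sigma> R s s' \<Longrightarrow> \<exists>\<tau>. tm s \<tau> \<and> tm s' \<tau>"
proof (induct rule: rstep.induct)
  case (rule l r \<delta>)
  obtain f ls \<tau> where l: "wt \<Sigma> [] l \<tau>" "wt \<Sigma> [] r \<tau>" "FMV r \<subseteq> FMV l"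
    using ruleD[OF rule(1)] by metis
  have "tm (subst \<Sigma> \<delta> l) \<tau>" using rule(2,3) l by (intro tm_subst) (auto simp: is_subst_iff)
  moreover have "tm (subst \<Sigma> \<delta> r) \<tau>" using rule(2,3) l by (intro tm_subst) (auto simp: is_subst_iff)
  ultimately show ?case by auto
next
  case (beta s t x)
  then obtain \<tau> where s: "tm s \<tau>" and t: "tm t (vtype \<Sigma> x)"
    using beta_tm by blast
  have "tm (App (lam \<Sigma> x s) t) \<tau>" using s t tm_lam by (auto simp: tm_App)
  moreover have "tm (subst1 \<Sigma> x t s) \<tau>"
    using tm_inst1[of "vtype \<Sigma> x" "close x 0 s" \<tau> t] s t wt_close[of \<Sigma> "[]" s \<tau> x]
    unfolding subst1_tm[OF t s] by (simp add: tm_def)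
  ultimately show ?case by blast
next
  case (appl s s' t)
  then obtain \<tau> \<sigma> \<tau>' where "tm s \<tau>'" "tm s' \<tau>'" "tm s (\<sigma> \<rightarrow> \<tau>)" "tm t \<sigma>" by (auto simp: is_term_iff trm_def tm_App)
  then show ?case using tm_unique[of s \<tau>' "\<sigma> \<rightarrow> \<tau>"] by (auto simp: tm_App)
next
  case (appr t t' s)
  then obtain \<tau> \<sigma> \<tau>' where "tm t \<tau>'" "tm t' \<tau>'" "tm s (\<sigma> \<rightarrow> \<tau>)" "tm t \<sigma>" by (auto simp: is_term_iff trm_def tm_App)
  then show ?case using tm_unique[of t \<tau>' \<sigma>] by (auto simp: tm_App)
next
  case (lam s s' x)
  then obtain \<tau> where "tm s \<tau>" "tm s' \<tau>" by auto
  then show ?case using tm_lam[of s \<tau> x] tm_lam[of s' \<tau> x] by auto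
qed

lemma rstep_tm': "rstep \<Sigma> R s s' \<Longrightarrow> tm s \<tau> \<Longrightarrow> tm s' \<tau>"
  using rstep_tm tm_unique by blast

lemma rsteps_tm: "rsteps s s' \<Longrightarrow> tm s \<tau> \<Longrightarrow> tm s' \<tau>"
  by (induct rule: rtranclp_induct) (auto intro: rstep_tm')

text \<open>The clause of \<open>rstep\<close> uses a named abstraction; a fresh variable of the
  binder's type presents any nameless redex in that form.\<close>

lemma rstep_beta: "tm (App (Lam \<sigma> b) a) \<tau> \<Longrightarrow> rstep \<Sigma> R (App (Lam \<sigma> b) a) (inst 0 [a] b)"
proof -
  assume t: "tm (App (Lam \<sigma> b) a) \<tau>"
  then have b: "wt \<Sigma> [\<sigma>] b \<tau>" "FMV b = {}" and a: "tm a \<sigma>" by (auto simp: tm_App tm_Lam)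
  obtain x where x: "vtype \<Sigma> x = \<sigma>" "x \<notin> FV b" using fresh[of "FV b"] by auto
  let ?s = "inst 0 [Fv x] b"
  have l: "lc 1 b" using wt_lc[OF b(1)] by simp
  have s: "tm ?s \<tau>" using tm_inst1[OF b, of "Fv x"] x by simp
  have "rstep \<Sigma> R (App (lam \<Sigma> x ?s) a) (subst1 \<Sigma> x a ?s)"
    using s a x by (intro rstep.beta) (auto simp: is_term_iff trm_def has_type_iff[OF wf] tm_def)
  moreover have "subst1 \<Sigma> x a ?s = inst 0 [a] b"
    unfolding subst1_tm[OF a s] using l x close_inst[of 0 b x] by simp
  ultimately show ?thesis using lam_inst[of x b] x l by simp
qed

lemma rstep_Lam:
  assumes "rstep \<Sigma> R (inst 0 [Fv x] b) (inst 0 [Fv x] b')" "x \<notin> FV b" "x \<notin> FV b'" "lc 1 b" "lc 1 b'"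
  shows "rstep \<Sigma> R (Lam (vtype \<Sigma> x) b) (Lam (vtype \<Sigma> x) b')"
  using rstep.lam[OF assms(1), of x] assms by (simp add: lam_inst)

lemma rsteps_lam: "rsteps s s' \<Longrightarrow> rsteps (lam \<Sigma> x s) (lam \<Sigma> x s')"
  by (induct rule: rtranclp_induct) (auto intro: rstep.lam rtranclp.rtrancl_into_rtrancl)

lemma rsteps_App:
  assumes "rsteps s s'" "rsteps t t'" "trm (App s t)"
  shows "rsteps (App s t) (App s' t')"
proof -
  have "rsteps (App s t) (App s' t) \<and> trm (App s' t)"
    using assms(1,3)
  proof (induct rule: rtranclp_induct)
    case (step y z)
    then have "rstep \<Sigma> R (App y t) (App z t)" by (intro rstep.appl) (auto simp: is_term_iff)
    then show ?case using step rstep_tm by (meson rtranclp.rtrancl_into_rtrancl trm_def)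
  qed auto
  moreover have "rsteps (App s' t) (App s' t') \<and> trm (App s' t')" if "trm (App s' t)"
    using assms(2) that
  proof (induct rule: rtranclp_induct)
    case (step y z)
    then have "rstep \<Sigma> R (App s' y) (App s' z)" by (intro rstep.appr) (auto simp: is_term_iff)
    then show ?case using step rstep_tm by (meson rtranclp.rtrancl_into_rtrancl trm_def)
  qed auto
  ultimately show ?thesis by auto
qed

text \<open>
  An instance \<open>Z\<langle>s\<rangle>\<delta>\<close> with \<open>\<delta>(Z) = y\<close> is \<open>y s\<close>, and substituting an abstraction for \<open>y\<close> then gives
  a redex, not a contracted instance. So \<open>\<delta>(Z)\<close> has to be \<open>\<eta>\<close>-expanded to the arity of \<open>Z\<close> first.
\<close>

definition compose where
  "compose \<gamma> \<delta> = case_sum Fv (\<lambda>Z. if Inr Z \<in> sdom \<Sigma> \<delta>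
     then foldr Lam (take (arity \<Sigma> Z) (ty_args (mtype \<Sigma> Z)))
       (subst \<Sigma> \<gamma> (meta_inst (\<delta> (Inr Z)) (map Bd (rev [0..<arity \<Sigma> Z]))))
     else id_subst \<Sigma> (Inr Z))"

lemma compose_tm:
  assumes "tsubst \<gamma>" "tsubst \<delta>" "Inr Z \<in> sdom \<Sigma> \<delta>" "mtype \<Sigma> Z = arrows \<sigma>s \<tau>" "length \<sigma>s = arity \<Sigma> Z"
  shows "tm (compose \<gamma> \<delta> (Inr Z)) (mtype \<Sigma> Z)"
proof -
  have z: "wt \<Sigma> [] (\<delta> (Inr Z)) (arrows \<sigma>s \<tau>)" "FMV (\<delta> (Inr Z)) = {}" using assms by (auto simp: tsubst_def tm_def)
  let ?u = "meta_inst (\<delta> (Inr Z)) (map Bd (rev [0..<arity \<Sigma> Z]))"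
  have "wt \<Sigma> (rev \<sigma>s) ?u \<tau>"
    using wt_meta_inst[OF z(1), of "rev \<sigma>s"] list_all2_Bds[of \<Sigma> \<sigma>s] assms by simp
  then have "wt \<Sigma> (rev \<sigma>s @ []) (subst \<Sigma> \<gamma> ?u) \<tau>" using wt_tsubst assms by simp
  from wt_foldr_Lam[OF this] have "wt \<Sigma> [] (compose \<gamma> \<delta> (Inr Z)) (mtype \<Sigma> Z)"
    using assms by (simp add: compose_def)
  moreover have "FMV ?u = {}" using FMV_meta_inst z(2) by fastforce
  then have "FMV (compose \<gamma> \<delta> (Inr Z)) = {}"
    using FMV_subst[of ?u \<gamma> \<Sigma>] assms by (auto simp: compose_def tsubst_def tm_def)
  ultimately show ?thesis by (simp add: tm_def)
qed

text \<open>A rule step asks for a substitution with exactly the right domain. The composed values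
  contain no meta-variable, whereas the identity value at \<open>Z\<close> contains
  \<open>Z\<close>, so nothing drops out of the domain.\<close>

lemma sdom_compose:
  assumes "tsubst \<gamma>" "tsubst \<delta>" "\<forall>Z. Inr Z \<in> sdom \<Sigma> \<delta> \<longrightarrow> (\<exists>\<sigma>s \<tau>. mtype \<Sigma> Z = arrows \<sigma>s \<tau> \<and> length \<sigma>s = arity \<Sigma> Z)"
  shows "sdom \<Sigma> (compose \<gamma> \<delta>) = Inr ` {Z. Inr Z \<in> sdom \<Sigma> \<delta>}"
proof -
  have "compose \<gamma> \<delta> (Inr Z) \<noteq> id_subst \<Sigma> (Inr Z)" if "Inr Z \<in> sdom \<Sigma> \<delta>" for Z
  proof -
    have "FMV (compose \<gamma> \<delta> (Inr Z)) = {}" using compose_tm[of \<gamma> \<delta> Z] assms that by (auto simp: tm_def)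
    then show ?thesis using id_subst_FMV[of \<Sigma> Z] by force
  qed
  moreover have "compose \<gamma> \<delta> (Inr Z) = id_subst \<Sigma> (Inr Z)" if "Inr Z \<notin> sdom \<Sigma> \<delta>" for Z
    using that by (simp add: compose_def)
  moreover have "compose \<gamma> \<delta> (Inl x) = id_subst \<Sigma> (Inl x)" for x by (simp add: compose_def)
  ultimately have "a \<in> sdom \<Sigma> (compose \<gamma> \<delta>) \<longleftrightarrow> a \<in> Inr ` {Z. Inr Z \<in> sdom \<Sigma> \<delta>}" for a
    by (cases a) (auto simp: sdom_def)
  then show ?thesis by blast
qed

text \<open>After expansion to the arity, \<open>meta_inst\<close> consumes all arguments by a plain
  \<open>inst\<close>, and \<open>inst\<close> commutes with \<open>subst\<close>. This is where the
  expanded form in \<open>compose\<close> pays off.\<close>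

lemma subst_compose:
  assumes "tsubst \<gamma>" "tsubst \<delta>"
    and "sdom \<Sigma> (compose \<gamma> \<delta>) = Inr ` {Z. Inr Z \<in> sdom \<Sigma> \<delta>}"
  shows "wt \<Sigma> \<Gamma> s \<tau> \<Longrightarrow> FV s = {} \<Longrightarrow> \<forall>Z\<in>FMV s. Inr Z \<in> sdom \<Sigma> \<delta> \<Longrightarrow>
     subst \<Sigma> \<gamma> (subst \<Sigma> \<delta> s) = subst \<Sigma> (compose \<gamma> \<delta>) s"
proof (induct s arbitrary: \<Gamma> \<tau>)
  case (Meta Z ss)
  then obtain \<sigma>s where m: "mtype \<Sigma> Z = arrows \<sigma>s \<tau>" "length \<sigma>s = arity \<Sigma> Z" "list_all2 (wt \<Sigma> \<Gamma>) ss \<sigma>s"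
    by auto
  have Z: "Inr Z \<in> sdom \<Sigma> \<delta>" using Meta by auto
  have l: "length ss = arity \<Sigma> Z" using m by (auto dest: list_all2_lengthD)
  have e: "map (subst \<Sigma> \<gamma>) (map (subst \<Sigma> \<delta>) ss) = map (subst \<Sigma> (compose \<gamma> \<delta>)) ss"
  proof -
    have "subst \<Sigma> \<gamma> (subst \<Sigma> \<delta> s) = subst \<Sigma> (compose \<gamma> \<delta>) s" if "s \<in> set ss" for s
    proof -
      from list_all2_in_set1[OF m(3) that] obtain \<sigma> where "wt \<Sigma> \<Gamma> s \<sigma>" by auto
      then show ?thesis using Meta(1)[OF that] Meta(3,4) that by auto
    qed
    then show ?thesis by simp
  qed
  let ?B = "map Bd (rev [0..<arity \<Sigma> Z])"
  let ?ss = "map (subst \<Sigma> \<delta>) ss"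
  have lz: "lc 0 (\<delta> (Inr Z))" using Z assms tm_lc by (auto simp: tsubst_def)
  \<comment> \<open>The instance at the generic indices \<open>?B\<close> is formed first; the
    actual arguments are filled in afterwards, on the far side of \<open>subst\<close>.\<close>
  have "meta_inst (\<delta> (Inr Z)) ?ss = inst 0 ?ss (meta_inst (\<delta> (Inr Z)) ?B)"
    using inst_meta_inst[OF lz] map_inst_Bds[of ?ss "arity \<Sigma> Z"] l by simp
  then have "subst \<Sigma> \<gamma> (subst \<Sigma> \<delta> (Meta Z ss)) =
     inst 0 (map (subst \<Sigma> \<gamma>) ?ss) (subst \<Sigma> \<gamma> (meta_inst (\<delta> (Inr Z)) ?B))"
    using subst_inst[OF tsubst_lc[OF assms(1)]] Z by simp
  also have "\<dots> = meta_inst (compose \<gamma> \<delta> (Inr Z)) (map (subst \<Sigma> \<gamma>) ?ss)"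
    using m l Z meta_inst_foldr[of "map (subst \<Sigma> \<gamma>) ?ss" \<sigma>s] by (simp add: compose_def)
  also have "\<dots> = subst \<Sigma> (compose \<gamma> \<delta>) (Meta Z ss)"
    unfolding e using Z assms(3) by auto
  finally show ?case .
next
  case (App s t)
  then obtain \<sigma> where "wt \<Sigma> \<Gamma> s (\<sigma> \<rightarrow> \<tau>)" "wt \<Sigma> \<Gamma> t \<sigma>" by auto
  from App(1)[OF this(1)] App(2)[OF this(2)] App(4,5) show ?case by simp
next
  case (Lam \<sigma> s)
  then obtain \<tau>' where "wt \<Sigma> (\<sigma> # \<Gamma>) s \<tau>'" by auto
  from Lam(1)[OF this] Lam(3,4) show ?case by simp
qed auto

text \<open>A rule step stays a step of the same rule under the composed substitution. In the case
  \<open>lam\<close> the induction hypothesis, available for every \<gamma>, is used with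
  \<open>x\<close> sent to a variable that is fresh for both bodies, which serves as the new bound
  name.\<close>

lemma rstep_subst: "rstep \<Sigma> R s s' \<Longrightarrow> tsubst \<gamma> \<Longrightarrow> rstep \<Sigma> R (subst \<Sigma> \<gamma> s) (subst \<Sigma> \<gamma> s')"
proof (induct arbitrary: \<gamma> rule: rstep.induct)
  case (rule l r \<delta>)
  obtain f ls \<tau> where l: "l = apps (Fn f) ls" "wt \<Sigma> [] l \<tau>" "wt \<Sigma> [] r \<tau>" "FV l = {}" "FV r = {}" "FMV r \<subseteq> FMV l"
    using ruleD[OF rule(1)] by metis
  have d: "tsubst \<delta>" using rule is_subst_iff by auto
  have Z: "Inr Z \<in> sdom \<Sigma> \<delta> \<Longrightarrow> \<exists>\<sigma>s \<tau>. mtype \<Sigma> Z = arrows \<sigma>s \<tau> \<and> length \<sigma>s = arity \<Sigma> Z" for Z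
    using wt_FMV[OF l(2)] rule(3) by auto
  then have sd: "sdom \<Sigma> (compose \<gamma> \<delta>) = Inr ` {Z. Inr Z \<in> sdom \<Sigma> \<delta>}"
    using sdom_compose rule(4) d by blast
  have "tsubst (compose \<gamma> \<delta>)" unfolding tsubst_def
  proof (intro conjI allI impI)
    fix x show "tm (compose \<gamma> \<delta> (Inl x)) (vtype \<Sigma> x)" by (simp add: compose_def)
  next
    fix Z assume "Inr Z \<in> sdom \<Sigma> (compose \<gamma> \<delta>)"
    then have "Inr Z \<in> sdom \<Sigma> \<delta>" using sd by auto
    then show "tm (compose \<gamma> \<delta> (Inr Z)) (mtype \<Sigma> Z)" using compose_tm[OF rule(4) d] Z by blast
  qed
  moreover have "sdom \<Sigma> (compose \<gamma> \<delta>) = Inr ` FMV l" using sd rule(3) by auto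
  ultimately have "rstep \<Sigma> R (subst \<Sigma> (compose \<gamma> \<delta>) l) (subst \<Sigma> (compose \<gamma> \<delta>) r)"
    using rule(1) is_subst_iff by (intro rstep.rule) auto
  moreover have "subst \<Sigma> \<gamma> (subst \<Sigma> \<delta> l) = subst \<Sigma> (compose \<gamma> \<delta>) l"
    using subst_compose[OF rule(4) d sd l(2,4)] rule(3) by simp
  moreover have "subst \<Sigma> \<gamma> (subst \<Sigma> \<delta> r) = subst \<Sigma> (compose \<gamma> \<delta>) r"
    using subst_compose[OF rule(4) d sd l(3,5)] rule(3) l(6) by auto
  ultimately show ?case by simp
next
  case (beta s t x)
  then obtain \<tau> where s: "tm s \<tau>" and t: "tm t (vtype \<Sigma> x)"
    using beta_tm by blast
  have "tm (App (lam \<Sigma> x s) t) \<tau>" using s t tm_lam by (auto simp: tm_App)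
  then have "tm (subst \<Sigma> \<gamma> (App (lam \<Sigma> x s) t)) \<tau>" using tm_subst[OF beta(4), of "App (lam \<Sigma> x s) t" \<tau>] unfolding tm_def by blast
  then have "rstep \<Sigma> R (subst \<Sigma> \<gamma> (App (lam \<Sigma> x s) t)) (inst 0 [subst \<Sigma> \<gamma> t] (subst \<Sigma> \<gamma> (close x 0 s)))"
    unfolding lam_def by (auto intro: rstep_beta)
  moreover have "subst \<Sigma> \<gamma> (subst1 \<Sigma> x t s) = inst 0 [subst \<Sigma> \<gamma> t] (subst \<Sigma> \<gamma> (close x 0 s))"
    unfolding subst1_tm[OF t s] using subst_inst[OF tsubst_lc[OF beta(4)]] by simp
  ultimately show ?case by simp
next
  case (appl s s' t)
  then show ?case using tm_subst[OF appl(4)]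
    by (auto intro!: rstep.appl simp: is_term_iff trm_def tm_App) (metis empty_iff tm_def)
next
  case (appr t t' s)
  then show ?case using tm_subst[OF appr(4)]
    by (auto intro!: rstep.appr simp: is_term_iff trm_def tm_App) (metis empty_iff tm_def)
next
  case (lam s s' x)
  let ?b = "subst \<Sigma> \<gamma> (close x 0 s)" let ?b' = "subst \<Sigma> \<gamma> (close x 0 s')"
  obtain y where y: "vtype \<Sigma> y = vtype \<Sigma> x" "y \<notin> FV ?b \<union> FV ?b'" using fresh[of "FV ?b \<union> FV ?b'"] by auto
  obtain \<tau> where t: "tm s \<tau>" "tm s' \<tau>" using rstep_tm[OF lam(1)] by auto
  have c: "lc 1 ?b" "lc 1 ?b'"
    using wt_tsubst[OF lam(3) wt_close[of \<Sigma> "[]" _ \<tau> x, simplified]] t wt_lc unfolding tm_def by fastforce+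
  have "rstep \<Sigma> R (subst \<Sigma> (\<gamma>(Inl x := Fv y)) s) (subst \<Sigma> (\<gamma>(Inl x := Fv y)) s')"
    using y by (intro lam(2) tsubst_upd lam(3)) simp
  then have "rstep \<Sigma> R (inst 0 [Fv y] ?b) (inst 0 [Fv y] ?b')"
    using inst_subst_close[OF tsubst_lc[OF lam(3)], of "Fv y" 0] t tm_lc by simp
  from rstep_Lam[OF this] show ?case using y c by (simp add: lam_def)
qed

text \<open>A step below a binder is a step of the body opened with one particular variable;
  stability under substitution replaces that variable by an arbitrary \<open>a\<close>.\<close>

lemma rstep_Lam_inv:
  assumes "rstep \<Sigma> R (Lam \<sigma> b) t"
  shows "\<exists>b'. t = Lam \<sigma> b' \<and> (\<forall>a. tm a \<sigma> \<longrightarrow> rstep \<Sigma> R (inst 0 [a] b) (inst 0 [a] b'))"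
  using assms
proof (cases rule: rstep.cases)
  case (rule l r \<delta>)
  obtain f ls where "l = apps (Fn f) ls" using ruleD[OF rule(3)] by metis
  then have "Lam \<sigma> b = apps (Fn f) (map (subst \<Sigma> \<delta>) ls)" using rule by simp
  then have "apps (Lam \<sigma> b) [] = apps (Fn f) (map (subst \<Sigma> \<delta>) ls)" by simp
  then show ?thesis by (subst (asm) apps_eq_iff) auto
next
  case (lam s s' x)
  obtain \<tau> where t: "tm s \<tau>" "tm s' \<tau>" using rstep_tm[OF lam(3)] by auto
  show ?thesis
  proof (intro exI conjI allI impI)
    show "t = Lam \<sigma> (close x 0 s')" using lam by (simp add: lam_def)
    fix a assume a: "tm a \<sigma>"
    have "rstep \<Sigma> R (subst1 \<Sigma> x a s) (subst1 \<Sigma> x a s')"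
      unfolding subst1_def using lam a by (intro rstep_subst tsubst_upd tsubst_id) (auto simp: lam_def)
    then show "rstep \<Sigma> R (inst 0 [a] b) (inst 0 [a] (close x 0 s'))"
      using lam unfolding subst1_tm[OF a t(1)] subst1_tm[OF a t(2)] by (simp add: lam_def)
  qed
qed

text \<open>A rule may match a proper prefix of the arguments, hence the split at \<open>n\<close>.
  This inversion drives all proofs that a term is computable because its reducts are.\<close>

lemma rstep_apps_cases:
  assumes "rstep \<Sigma> R (apps h ss) t" "\<not> is_App h"
  shows "(\<exists>i u. i < length ss \<and> rstep \<Sigma> R (ss ! i) u \<and> t = apps h (ss[i := u])) \<or>
    (\<exists>n l r \<delta>. n \<le> length ss \<and> (l, r) \<in> R \<and> is_subst \<Sigma> \<delta> \<and> sdom \<Sigma> \<delta> = Inr ` FMV l \<and>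
       subst \<Sigma> \<delta> l = apps h (take n ss) \<and> t = apps (subst \<Sigma> \<delta> r) (drop n ss)) \<or>
    (\<exists>\<sigma> b h'. h = Lam \<sigma> b \<and> rstep \<Sigma> R h h' \<and> t = apps h' ss) \<or>
    (\<exists>\<sigma> b a ss'. h = Lam \<sigma> b \<and> ss = a # ss' \<and> t = apps (inst 0 [a] b) ss')"
  using assms
proof (induct ss arbitrary: t rule: rev_induct)
  case Nil
  from Nil(1) show ?case
  proof (cases rule: rstep.cases)
    case (rule l r \<delta>)
    then show ?thesis by (intro disjI2 disjI1 exI[of _ 0]) auto
  qed (use Nil in \<open>auto simp: lam_def\<close>)
next
  case (snoc u ss)
  from snoc(2) have "rstep \<Sigma> R (App (apps h ss) u) t" by simp
  then show ?case
  proof (cases rule: rstep.cases)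
    case (rule l r \<delta>)
    then show ?thesis by (intro disjI2 disjI1 exI[of _ "Suc (length ss)"]) auto
  next
    case (beta s x)
    then have "apps h ss = apps (lam \<Sigma> x s) []" by simp
    then have "h = lam \<Sigma> x s" "ss = []"
      using apps_eq_iff[of h "lam \<Sigma> x s" ss "[]"] snoc(3) by (auto simp: lam_def)
    moreover have "subst1 \<Sigma> x u s = inst 0 [u] (close x 0 s)"
      using beta trm_lc by (intro subst1_inst) (auto simp: is_term_iff)
    ultimately show ?thesis using beta by (intro disjI2) (auto simp: lam_def)
  next
    case (appl s')
    from snoc(1)[OF appl(2) snoc(3)] show ?thesis
    proof (elim disjE exE conjE, goal_cases)
      case (1 i v)
      then show ?thesis using appl by (intro disjI1 exI[of _ i] exI[of _ v]) (auto simp: nth_append list_update_append)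
    next
      case (2 n l r \<delta>)
      then show ?thesis using appl
        by (intro disjI2 disjI1 exI[of _ n] exI[of _ l] exI[of _ r] exI[of _ \<delta>]) auto
    qed (use appl in auto)
  next
    case (appr t')
    then show ?thesis by (intro disjI1 exI[of _ "length ss"] exI[of _ t']) auto
  qed (auto simp: lam_def)
qed

text \<open>One step in an argument becomes several or none, since its index may occur repeatedly or
  not at all. Passing a \<open>Lam\<close> extends both environments by the same fresh variable,
  which is why environments appear instead of a single argument.\<close>

lemma rsteps_inst:
  "wt \<Sigma> \<Gamma> b \<tau> \<Longrightarrow> FMV b = {} \<Longrightarrow> list_all2 tm (rev rs) \<Gamma> \<Longrightarrow> list_all2 rsteps rs rs' \<Longrightarrow>
   rsteps (inst 0 rs b) (inst 0 rs' b) \<and> tm (inst 0 rs b) \<tau>"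
proof (induct b arbitrary: \<Gamma> \<tau> rs rs')
  case (Bd i)
  then show ?case by (auto simp: list_all2_conv_all_nth rev_nth)
next
  case (App s1 s2)
  then obtain \<sigma> where "wt \<Sigma> \<Gamma> s1 (\<sigma> \<rightarrow> \<tau>)" "wt \<Sigma> \<Gamma> s2 \<sigma>" by auto
  from App(1)[OF this(1) _ App(5,6)] App(2)[OF this(2) _ App(5,6)] App(4)
  show ?case using rsteps_App[of "inst 0 rs s1" "inst 0 rs' s1" "inst 0 rs s2" "inst 0 rs' s2"]
    by (auto simp: tm_App trm_def)
next
  case (Lam \<sigma> b)
  then obtain \<tau>' where t: "\<tau> = \<sigma> \<rightarrow> \<tau>'" "wt \<Sigma> (\<sigma> # \<Gamma>) b \<tau>'" by auto
  let ?S = "FV b \<union> (\<Union>r\<in>set rs. FV r) \<union> (\<Union>r\<in>set rs'. FV r)"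
  obtain x where x: "vtype \<Sigma> x = \<sigma>" "x \<notin> ?S" using fresh[of ?S \<sigma>] finite_FV by blast
  have IH: "rsteps (inst 0 (rs @ [Fv x]) b) (inst 0 (rs' @ [Fv x]) b)" "tm (inst 0 (rs @ [Fv x]) b) \<tau>'"
    using Lam(1)[OF t(2), of "rs @ [Fv x]" "rs' @ [Fv x]"] Lam(3-5) x by (auto simp: list_all2_appendI)
  have r: "\<forall>r\<in>set rs. lc 0 r" using list_all2_in_set1[OF Lam(4)] tm_lc by auto
  have ll: "length rs = length \<Gamma>" "length rs' = length rs" using Lam(4,5) by (auto dest: list_all2_lengthD)
  have r': "\<forall>r\<in>set rs'. lc 0 r"
  proof
    fix r assume "r \<in> set rs'"
    then obtain i where i: "i < length rs'" "r = rs' ! i" by (auto simp: in_set_conv_nth)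
    have "tm (rev rs ! (length rs - Suc i)) (\<Gamma> ! (length rs - Suc i))"
      using Lam(4) i ll by (auto simp: list_all2_conv_all_nth)
    then have "tm (rs ! i) (\<Gamma> ! (length rs - Suc i))" using i ll by (simp add: rev_nth)
    moreover have "rsteps (rs ! i) r" using Lam(5) i ll by (auto simp: list_all2_conv_all_nth)
    ultimately show "lc 0 r" using tm_lc[OF rsteps_tm] by simp
  qed
  have op: "lam \<Sigma> x (inst 0 (qs @ [Fv x]) b) = inst 0 qs (Lam \<sigma> b)"
    if "\<forall>r\<in>set qs. lc 0 r" "x \<notin> (\<Union>r\<in>set qs. FV r)" "length qs = length \<Gamma>" for qs
  proof -
    have "inst 0 (qs @ [Fv x]) b = inst 0 [Fv x] (inst 1 qs b)"
      using inst_append[OF that(1), of 0 "[Fv x]" b] by simp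
    moreover have "lc 1 (inst 1 qs b)" using wt_lc[OF t(2)] that by (intro lc_inst) auto
    moreover have "x \<notin> FV (inst 1 qs b)" using FV_inst[of 1 qs b] that x by auto
    ultimately show ?thesis using lam_inst x by simp
  qed
  show ?case using rsteps_lam[OF IH(1), of x] tm_lam[OF IH(2), of x] op[of rs] op[of rs'] r r' ll x t by auto
next
  case (Fv x)
  then show ?case by simp
next
  case (Fn f)
  then show ?case by (simp add: tm_def)
qed simp

end

section \<open>Computability\<close>

lemma not_App: "\<not> is_App (Fn f)" "\<not> is_App (Fv x)" "\<not> is_App (Lam \<sigma> b)" "\<not> is_App (Meta Z ss)"
  by auto

lemma listrel1_update: "i < length ss \<Longrightarrow> (u, ss ! i) \<in> r \<Longrightarrow> (ss[i := u], ss) \<in> listrel1 r"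
  unfolding listrel1_iff_update by (intro exI[of _ "ss ! i"] exI[of _ i]) auto

context afsm_system
begin

section \<open>Strong normalisation\<close>

definition red where "red = {(t, s). rstep \<Sigma> R s t}"
definition SN where "SN s \<longleftrightarrow> s \<in> Wellfounded.acc red"

lemma SN_I: "(\<And>t. rstep \<Sigma> R s t \<Longrightarrow> SN t) \<Longrightarrow> SN s"
  unfolding SN_def by (rule accI) (auto simp: red_def)
lemma SN_step: "SN s \<Longrightarrow> rstep \<Sigma> R s t \<Longrightarrow> SN t"
  unfolding SN_def by (erule acc_downward) (auto simp: red_def)
lemma SN_induct [consumes 1, case_names step]:
  assumes "SN s" "\<And>s. SN s \<Longrightarrow> (\<And>t. rstep \<Sigma> R s t \<Longrightarrow> P t) \<Longrightarrow> P s"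
  shows "P s"
  using assms(1) unfolding SN_def
proof (induct rule: acc.induct)
  case (accI x)
  show ?case by (rule assms(2)) (use accI in \<open>auto simp: SN_def red_def intro: acc.intros\<close>)
qed

lemma rstep_apps_head: "rstep \<Sigma> R h h' \<Longrightarrow> trm (apps h ss) \<Longrightarrow> rstep \<Sigma> R (apps h ss) (apps h' ss)"
proof (induct ss rule: rev_induct)
  case (snoc a ss)
  have "trm (apps h ss)" using snoc(3) by (auto simp: trm_def tm_App)
  then show ?case using snoc by (auto simp: is_term_iff intro: rstep.appl)
qed auto

lemma rsteps_trm: "rsteps s s' \<Longrightarrow> trm s \<Longrightarrow> trm s'"
  using rsteps_tm by (auto simp: trm_def)

lemma rsteps_apps_head: "rsteps h h' \<Longrightarrow> trm (apps h ss) \<Longrightarrow> rsteps (apps h ss) (apps h' ss)"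
proof (induct rule: rtranclp_induct)
  case (step y z)
  then have "trm (apps y ss)" using rsteps_trm by simp
  then have "rstep \<Sigma> R (apps y ss) (apps z ss)" using rstep_apps_head step by simp
  then show ?case using step by (meson rtranclp.rtrancl_into_rtrancl)
qed auto

lemma rstep_apps_arg:
  "i < length ss \<Longrightarrow> rstep \<Sigma> R (ss ! i) u \<Longrightarrow> trm (apps h ss) \<Longrightarrow> rstep \<Sigma> R (apps h ss) (apps h (ss[i := u]))"
proof (induct ss rule: rev_induct)
  case (snoc a ss)
  have t: "trm (apps h ss)" using snoc(4) by (auto simp: trm_def tm_App)
  show ?case
  proof (cases "i < length ss")
    case True
    then have "rstep \<Sigma> R (apps h ss) (apps h (ss[i := u]))" using snoc t by (simp add: nth_append)
    then show ?thesis using True snoc(4) by (auto simp: is_term_iff list_update_append intro: rstep.appl)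
  next
    case False
    then have "i = length ss" using snoc by simp
    then show ?thesis using snoc by (auto simp: is_term_iff intro: rstep.appr)
  qed
qed auto

lemma SN_App_left: "SN (App s t) \<Longrightarrow> trm (App s t) \<Longrightarrow> SN s"
proof (induct "App s t" arbitrary: s rule: SN_induct)
  case (step s)
  show ?case
  proof (rule SN_I)
    fix s' assume s: "rstep \<Sigma> R s s'"
    then have "rstep \<Sigma> R (App s t) (App s' t)" using step by (auto simp: is_term_iff intro: rstep.appl)
    then show "SN s'" using step rstep_tm by (meson trm_def)
  qed
qed

lemma SN_App_right: "SN (App s t) \<Longrightarrow> trm (App s t) \<Longrightarrow> SN t"
proof (induct "App s t" arbitrary: t rule: SN_induct)
  case (step t)
  show ?case
  proof (rule SN_I)
    fix t' assume t: "rstep \<Sigma> R t t'"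
    then have "rstep \<Sigma> R (App s t) (App s t')" using step by (auto simp: is_term_iff intro: rstep.appr)
    then show "SN t'" using step rstep_tm by (meson trm_def)
  qed
qed

lemma SN_apps_arg: "SN (apps h ss) \<Longrightarrow> trm (apps h ss) \<Longrightarrow> s \<in> set ss \<Longrightarrow> SN s"
proof (induct ss rule: rev_induct)
  case (snoc a ss)
  have "trm (apps h ss)" using snoc(3) by (auto simp: trm_def tm_App)
  then show ?case using snoc SN_App_left[of "apps h ss" a] SN_App_right[of "apps h ss" a] by auto
qed simp

section \<open>The computability predicate as a fixpoint\<close>

text \<open>The base-type interpretation is a parameter so that it can be iterated. Typing is
  explicit at arrow types because for an arbitrary interpretation the quantifier over arguments may
  be vacuous.\<close>

primrec comp_wrt :: "('s \<Rightarrow> ('f, 'v, 'm, 's) mt set) \<Rightarrow> 's ty \<Rightarrow> ('f, 'v, 'm, 's) mt \<Rightarrow> bool" where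
  "comp_wrt I (Sort \<iota>) = (\<lambda>s. s \<in> I \<iota>)"
| "comp_wrt I (\<sigma> \<rightarrow> \<tau>) = (\<lambda>s. tm s (\<sigma> \<rightarrow> \<tau>) \<and> (\<forall>t. comp_wrt I \<sigma> t \<longrightarrow> comp_wrt I \<tau> (App s t)))"

text \<open>
  The condition on \<open>w u\<close> is needed for accessible positions below a variable: there a variable is
  instantiated by \<open>\<lambda>y\<^sub>1\<dots>y\<^sub>m. w (y\<^sub>i t\<^sub>1 \<dots> t\<^sub>n)\<close>, where \<open>w\<close> adjusts the sort.
\<close>

definition comp_op :: "('s \<Rightarrow> 's \<Rightarrow> bool) \<Rightarrow> ('s \<Rightarrow> ('f, 'v, 'm, 's) mt set) \<Rightarrow> 's \<Rightarrow> ('f, 'v, 'm, 's) mt set" where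
  "comp_op ge I \<iota> = {s. tm s (Sort \<iota>) \<and> SN s \<and>
     (\<forall>f ss i. rsteps s (apps (Fn f) ss) \<and> i < length ss \<and> ge_pos ge \<iota> (ty_args (ftype \<Sigma> f) ! i) \<longrightarrow>
        comp_wrt I (ty_args (ftype \<Sigma> f) ! i) (ss ! i)) \<and>
     (\<forall>w \<kappa> u. rsteps s (App (Fv w) u) \<and> vtype \<Sigma> w = Sort \<kappa> \<rightarrow> Sort \<iota> \<and> ge \<iota> \<kappa> \<longrightarrow> u \<in> I \<kappa>)}"

text \<open>Both halves are proved together since the left of an arrow exchanges them. Sorts at
  which the interpretation may grow occur only positively in a type accepted by
  \<open>ge_pos\<close>; sorts in negative position are strictly smaller, and there \<open>X\<close>
  and \<open>Y\<close> agree.\<close>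

lemma comp_wrt_mono:
  assumes "\<And>\<kappa>. ge \<iota> \<kappa> \<Longrightarrow> X \<kappa> \<subseteq> Y \<kappa>" "\<And>\<kappa>. ge \<iota> \<kappa> \<Longrightarrow> \<not> ge \<kappa> \<iota> \<Longrightarrow> X \<kappa> = Y \<kappa>"
  shows "(ge_pos ge \<iota> \<sigma> \<longrightarrow> comp_wrt X \<sigma> s \<longrightarrow> comp_wrt Y \<sigma> s) \<and> (gt_neg ge \<iota> \<sigma> \<longrightarrow> comp_wrt Y \<sigma> s \<longrightarrow> comp_wrt X \<sigma> s)"
proof (induct \<sigma> arbitrary: s)
  case (Sort \<kappa>)
  then show ?case using assms by auto
next
  case (Arrow \<sigma> \<tau>)
  then show ?case by auto
qed

lemma comp_op_mono:
  assumes "\<And>\<kappa>. ge \<iota> \<kappa> \<Longrightarrow> X \<kappa> \<subseteq> Y \<kappa>" "\<And>\<kappa>. ge \<iota> \<kappa> \<Longrightarrow> \<not> ge \<kappa> \<iota> \<Longrightarrow> X \<kappa> = Y \<kappa>"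
  shows "comp_op ge X \<iota> \<subseteq> comp_op ge Y \<iota>"
proof
  fix s assume s: "s \<in> comp_op ge X \<iota>"
  then have "comp_wrt Y (ty_args (ftype \<Sigma> f) ! i) (ss ! i)"
    if "rsteps s (apps (Fn f) ss)" "i < length ss" "ge_pos ge \<iota> (ty_args (ftype \<Sigma> f) ! i)" for f ss i
    using that comp_wrt_mono[of ge \<iota> X Y, OF assms] unfolding comp_op_def by blast
  moreover have "u \<in> Y \<kappa>" if "rsteps s (App (Fv w) u)" "vtype \<Sigma> w = Sort \<kappa> \<rightarrow> Sort \<iota>" "ge \<iota> \<kappa>" for w u \<kappa>
    using s that assms(1)[of \<kappa>] unfolding comp_op_def by blast
  ultimately show "s \<in> comp_op ge Y \<iota>" using s unfolding comp_op_def by blast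
qed

text \<open>\<open>comp_op\<close> is monotone only while the strictly smaller sorts are held fixed.
  So these are supplied by well-founded recursion, each class of equivalent sorts takes a least
  fixpoint relative to them, and it remains to see that the pieces form one solution.\<close>

lemma ex_computability_fixpoint:
  assumes so: "sort_order ge"
  shows "\<exists>I. \<forall>\<iota>. I \<iota> = comp_op ge I \<iota>"
proof -
  define r where "r = {(\<kappa>, \<iota>). ge \<iota> \<kappa> \<and> \<not> ge \<kappa> \<iota>}"
  have wfr: "wf r" and tr: "\<And>a b c. ge a b \<Longrightarrow> ge b c \<Longrightarrow> ge a c" and rf: "\<And>a. ge a a"
    using so unfolding sort_order_def r_def by (auto dest: transpD reflpD)
  \<comment> \<open>\<open>J\<close> holds the finished interpretations below \<iota> and
    \<open>X\<close> the class of \<iota> under iteration. The class is iterated as a whole because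
    its sorts may refer to each other.\<close>
  define G where "G J \<iota> X \<kappa> = (if ge \<kappa> \<iota> \<and> ge \<iota> \<kappa>
      then comp_op ge (\<lambda>\<kappa>'. if (\<kappa>', \<iota>) \<in> r then J \<kappa>' else X \<kappa>') \<kappa> else {})" for J \<iota> X \<kappa>
  have mono: "mono (G J \<iota>)" for J \<iota>
  proof (rule monoI)
    fix X Y :: "'s \<Rightarrow> ('f, 'v, 'm, 's) mt set" assume le: "X \<le> Y"
    have "G J \<iota> X \<kappa> \<subseteq> G J \<iota> Y \<kappa>" for \<kappa>
    proof (cases "ge \<kappa> \<iota> \<and> ge \<iota> \<kappa>")
      case True
      have "comp_op ge (\<lambda>\<kappa>'. if (\<kappa>', \<iota>) \<in> r then J \<kappa>' else X \<kappa>') \<kappa>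
          \<subseteq> comp_op ge (\<lambda>\<kappa>'. if (\<kappa>', \<iota>) \<in> r then J \<kappa>' else Y \<kappa>') \<kappa>"
      proof (rule comp_op_mono)
        fix \<kappa>' assume "ge \<kappa> \<kappa>'" "\<not> ge \<kappa>' \<kappa>"
        then have "(\<kappa>', \<iota>) \<in> r" using True tr[of \<iota> \<kappa> \<kappa>'] tr[of \<kappa>' \<iota> \<kappa>] by (auto simp: r_def)
        then show "(if (\<kappa>', \<iota>) \<in> r then J \<kappa>' else X \<kappa>') = (if (\<kappa>', \<iota>) \<in> r then J \<kappa>' else Y \<kappa>')" by simp
      qed (use le in \<open>auto simp: le_fun_def\<close>)
      then show ?thesis by (simp add: G_def True)
    next
      case False
      then have "G J \<iota> X \<kappa> = {}" unfolding G_def by (rule if_not_P)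
      then show ?thesis by simp
    qed
    then show "G J \<iota> X \<le> G J \<iota> Y" by (simp add: le_fun_def)
  qed
  define I where "I = wfrec r (\<lambda>J \<iota>. lfp (G J \<iota>) \<iota>)"
  \<comment> \<open>\<open>G\<close> consults its first argument only at sorts strictly below
    \<iota>, where the cut made by \<open>wfrec\<close> changes nothing.\<close>
  have "G (cut I r \<iota>) \<iota> = G I \<iota>" for \<iota>
  proof (intro ext)
    fix X \<kappa>
    have "(\<lambda>\<kappa>'. if (\<kappa>', \<iota>) \<in> r then cut I r \<iota> \<kappa>' else X \<kappa>') = (\<lambda>\<kappa>'. if (\<kappa>', \<iota>) \<in> r then I \<kappa>' else X \<kappa>')"
      by (rule ext) (simp add: cut_def)
    then show "G (cut I r \<iota>) \<iota> X \<kappa> = G I \<iota> X \<kappa>" by (simp add: G_def)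
  qed
  then have I: "I \<iota> = lfp (G I \<iota>) \<iota>" for \<iota>
    using wfrec[OF wfr, of "\<lambda>J \<iota>. lfp (G J \<iota>) \<iota>" \<iota>] unfolding I_def by simp
  have "I \<iota> = comp_op ge I \<iota>" for \<iota>
  proof -
    let ?X = "lfp (G I \<iota>)"
    let ?J = "\<lambda>\<kappa>'. if (\<kappa>', \<iota>) \<in> r then I \<kappa>' else ?X \<kappa>'"
    have "?X = G I \<iota> ?X" by (rule lfp_unfold[OF mono])
    then have "?X \<iota> = G I \<iota> ?X \<iota>" by (rule fun_cong)
    also have "\<dots> = comp_op ge ?J \<iota>" using rf by (simp add: G_def)
    finally have 1: "I \<iota> = comp_op ge ?J \<iota>" using I[of \<iota>] by simp
    have J: "?J \<kappa> = I \<kappa>" if "ge \<iota> \<kappa>" for \<kappa>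
    proof (cases "ge \<kappa> \<iota>")
      case True
      \<comment> \<open>Equivalent sorts have the same smaller sorts and the same class, hence the
        same operator, so their separately chosen least fixpoints coincide.\<close>
      have "G I \<kappa> = G I \<iota>"
      proof (intro ext)
        fix X \<kappa>'
        have "((\<kappa>'', \<kappa>) \<in> r) = ((\<kappa>'', \<iota>) \<in> r)" for \<kappa>''
          using that True tr unfolding r_def by blast
        moreover have "(ge \<kappa>' \<kappa> \<and> ge \<kappa> \<kappa>') = (ge \<kappa>' \<iota> \<and> ge \<iota> \<kappa>')" using that True tr by blast
        ultimately show "G I \<kappa> X \<kappa>' = G I \<iota> X \<kappa>'" by (simp add: G_def)
      qed
      then have "I \<kappa> = ?X \<kappa>" using I[of \<kappa>] by simp
      then show ?thesis by simp
    qed (use that in \<open>simp add: r_def\<close>)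
    have "comp_op ge ?J \<iota> = comp_op ge I \<iota>"
      by (intro equalityI comp_op_mono) (use J in auto)
    then show ?thesis using 1 by simp
  qed
  then show ?thesis by blast
qed

end

locale computability = afsm_system +
  fixes ge :: "'d \<Rightarrow> 'd \<Rightarrow> bool" and C :: "'d \<Rightarrow> ('a, 'b, 'c, 'd) mt set"
  assumes so: "sort_order ge" and C_fix: "\<And>\<iota>. C \<iota> = comp_op ge C \<iota>"
begin

abbreviation "comp_at \<equiv> comp_wrt C"

lemma C_tm: "s \<in> C \<iota> \<Longrightarrow> tm s (Sort \<iota>)" using C_fix[of \<iota>] by (auto simp: comp_op_def)
lemma C_SN: "s \<in> C \<iota> \<Longrightarrow> SN s" using C_fix[of \<iota>] by (auto simp: comp_op_def)
lemma C_Fn: "s \<in> C \<iota> \<Longrightarrow> rsteps s (apps (Fn f) ss) \<Longrightarrow> i < length ss \<Longrightarrow>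
    ge_pos ge \<iota> (ty_args (ftype \<Sigma> f) ! i) \<Longrightarrow> comp_at (ty_args (ftype \<Sigma> f) ! i) (ss ! i)"
  using C_fix[of \<iota>] unfolding comp_op_def by blast
lemma C_Fv: "s \<in> C \<iota> \<Longrightarrow> rsteps s (App (Fv w) u) \<Longrightarrow> vtype \<Sigma> w = Sort \<kappa> \<rightarrow> Sort \<iota> \<Longrightarrow> ge \<iota> \<kappa> \<Longrightarrow> u \<in> C \<kappa>"
  using C_fix[of \<iota>] unfolding comp_op_def by blast

section \<open>Closure properties of computable terms\<close>

lemma C_step: assumes "s \<in> C \<iota>" "rstep \<Sigma> R s s'" shows "s' \<in> C \<iota>"
proof -
  have *: "rsteps s t" if "rsteps s' t" for t using that assms(2) by (rule converse_rtranclp_into_rtranclp[rotated])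
  have "s' \<in> comp_op ge C \<iota>"
    unfolding comp_op_def mem_Collect_eq
    using rstep_tm'[OF assms(2) C_tm[OF assms(1)]] SN_step[OF C_SN[OF assms(1)] assms(2)]
      C_Fn[OF assms(1)] C_Fv[OF assms(1)] * by blast
  then show ?thesis using C_fix by simp
qed

lemma C_rsteps: "rsteps s s' \<Longrightarrow> s \<in> C \<iota> \<Longrightarrow> s' \<in> C \<iota>"
  by (induct rule: rtranclp_induct) (auto intro: C_step)

text \<open>Every clause of \<open>comp_op\<close> speaks about all reducts. Those reached by at
  least one step are covered by the first step, so \<open>f\<close> and \<open>v\<close> have to
  treat only \<open>s\<close> itself.\<close>

lemma C_expand:
  assumes "tm s (Sort \<iota>)" "\<And>t. rstep \<Sigma> R s t \<Longrightarrow> t \<in> C \<iota>"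
    and f: "\<And>f ss i. s = apps (Fn f) ss \<Longrightarrow> i < length ss \<Longrightarrow> ge_pos ge \<iota> (ty_args (ftype \<Sigma> f) ! i) \<Longrightarrow>
      comp_at (ty_args (ftype \<Sigma> f) ! i) (ss ! i)"
    and v: "\<And>w \<kappa> u. s = App (Fv w) u \<Longrightarrow> vtype \<Sigma> w = Sort \<kappa> \<rightarrow> Sort \<iota> \<Longrightarrow> u \<in> C \<kappa>"
  shows "s \<in> C \<iota>"
proof -
  have "SN s" by (rule SN_I) (use assms(2) C_SN in blast)
  moreover have "comp_at (ty_args (ftype \<Sigma> f) ! i) (ss ! i)"
    if "rsteps s (apps (Fn f) ss)" "i < length ss" "ge_pos ge \<iota> (ty_args (ftype \<Sigma> f) ! i)" for f ss i
    using that(1)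
  proof (cases rule: converse_rtranclpE)
    case base
    then show ?thesis using f that by blast
  next
    case (step y)
    then show ?thesis using C_Fn assms(2) that by blast
  qed
  moreover have "u \<in> C \<kappa>" if "rsteps s (App (Fv w) u)" "vtype \<Sigma> w = Sort \<kappa> \<rightarrow> Sort \<iota>" "ge \<iota> \<kappa>" for w u \<kappa>
    using that(1)
  proof (cases rule: converse_rtranclpE)
    case base
    then show ?thesis using v that by blast
  next
    case (step y)
    then show ?thesis using C_Fv assms(2) that by blast
  qed
  ultimately have "s \<in> comp_op ge C \<iota>" unfolding comp_op_def using assms(1) by blast
  then show ?thesis using C_fix by simp
qed

lemma comp_at_tm: "comp_at \<tau> s \<Longrightarrow> tm s \<tau>" by (cases \<tau>) (auto intro: C_tm)

lemma comp_at_step: "comp_at \<tau> s \<Longrightarrow> rstep \<Sigma> R s s' \<Longrightarrow> comp_at \<tau> s'"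
proof (induct \<tau> arbitrary: s s')
  case (Sort \<iota>)
  then show ?case using C_step by simp
next
  case (Arrow \<sigma> \<tau>)
  have "comp_at \<tau> (App s' t)" if "comp_at \<sigma> t" for t
  proof -
    have c: "comp_at \<tau> (App s t)" using Arrow that by simp
    then have "rstep \<Sigma> R (App s t) (App s' t)" using Arrow(4) comp_at_tm
      by (intro rstep.appl) (auto simp: is_term_iff trm_def)
    then show ?thesis using Arrow(2) c by blast
  qed
  then show ?case using Arrow rstep_tm' by auto
qed

lemma comp_at_rsteps: "rsteps s s' \<Longrightarrow> comp_at \<tau> s \<Longrightarrow> comp_at \<tau> s'"
  by (induct rule: rtranclp_induct) (auto intro: comp_at_step)

text \<open>Below a variable only arguments can reduce, so the induction is on their joint
  termination, one of them stepping at a time.\<close>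

lemma C_apps_Fv:
  assumes "ss \<in> Wellfounded.acc (listrel1 red)"
  shows "vtype \<Sigma> x = arrows \<sigma>s (Sort \<iota>) \<Longrightarrow> list_all2 (\<lambda>s \<sigma>. comp_at \<sigma> s) ss \<sigma>s \<Longrightarrow> apps (Fv x) ss \<in> C \<iota>"
  using assms
proof (induct rule: acc.induct)
  case (accI ss)
  have t: "tm (apps (Fv x) ss) (Sort \<iota>)"
    unfolding tm_apps using accI(3,4) by (intro exI[of _ \<sigma>s]) (auto elim: list.rel_mono_strong intro: comp_at_tm)
  show ?case
  proof (rule C_expand[OF t])
    fix t assume "rstep \<Sigma> R (apps (Fv x) ss) t"
    from rstep_apps_cases[OF this not_App(2)] show "t \<in> C \<iota>"
    proof (elim disjE exE conjE, goal_cases)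
      case (1 i u)
      have "list_all2 (\<lambda>s \<sigma>. comp_at \<sigma> s) (ss[i := u]) \<sigma>s"
        using accI(4) 1 comp_at_step unfolding list_all2_conv_all_nth by (auto simp: nth_list_update)
      then show ?case using accI(2)[of "ss[i := u]"] accI(3) 1 listrel1_update[of i ss u red] by (auto simp: red_def)
    next
      case (2 n l r \<delta>)
      obtain f ls where "l = apps (Fn f) ls" using ruleD[OF 2(2)] by metis
      then have "apps (Fn f) (map (subst \<Sigma> \<delta>) ls) = apps (Fv x) (take n ss)" using 2 by simp
      then show ?case by (subst (asm) apps_eq_iff) auto
    qed auto
  next
    fix f us i assume "apps (Fv x) ss = apps (Fn f) us"
    then show "comp_at (ty_args (ftype \<Sigma> f) ! i) (us ! i)" by (subst (asm) apps_eq_iff) auto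
  next
    fix w \<kappa> u assume "apps (Fv x) ss = App (Fv w) u" and w: "vtype \<Sigma> w = Sort \<kappa> \<rightarrow> Sort \<iota>"
    then have "apps (Fv x) ss = apps (Fv w) [u]" by simp
    then have "x = w" "ss = [u]" by (subst (asm) apps_eq_iff, auto)+
    then show "u \<in> C \<kappa>" using accI(3,4) w by (auto simp: list_all2_Cons1)
  qed
qed

lemma SN_list: "\<forall>s\<in>set ss. SN s \<Longrightarrow> ss \<in> Wellfounded.acc (listrel1 red)"
  by (rule lists_accD) (auto simp: SN_def)

text \<open>Girard's simultaneous induction: termination at an arrow type applies the term to a
  variable, which must be computable at the argument type. The second part demands \<open>SN\<close>
  of the arguments separately because their types are not subtypes of \<tau>, so no induction
  hypothesis speaks about them.\<close>

lemma comp_at_SN_and_Fv: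
  "(\<forall>s. comp_at \<tau> s \<longrightarrow> SN s) \<and>
   (\<forall>x ss \<sigma>s. vtype \<Sigma> x = arrows \<sigma>s \<tau> \<longrightarrow> list_all2 (\<lambda>s \<sigma>. comp_at \<sigma> s \<and> SN s) ss \<sigma>s \<longrightarrow> comp_at \<tau> (apps (Fv x) ss))"
proof (induct \<tau>)
  case (Sort \<iota>)
  have "apps (Fv x) ss \<in> C \<iota>" if "vtype \<Sigma> x = arrows \<sigma>s (Sort \<iota>)" "list_all2 (\<lambda>s \<sigma>. comp_at \<sigma> s \<and> SN s) ss \<sigma>s" for x ss \<sigma>s
  proof (rule C_apps_Fv[OF _ that(1)])
    show "ss \<in> Wellfounded.acc (listrel1 red)" using list_all2_in_set1[OF that(2)] by (intro SN_list) auto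
    show "list_all2 (\<lambda>s \<sigma>. comp_at \<sigma> s) ss \<sigma>s" using that(2) by (rule list_all2_mono) auto
  qed
  then show ?case using C_SN by auto
next
  case (Arrow \<sigma> \<tau>)
  have "SN s" if s: "comp_at (\<sigma> \<rightarrow> \<tau>) s" for s
  proof -
    obtain x where "vtype \<Sigma> x = \<sigma>" using fresh[of "{}" \<sigma>] by auto
    then have "vtype \<Sigma> x = arrows [] \<sigma>" by simp
    then have "comp_at \<sigma> (apps (Fv x) [])" using Arrow(1) by blast
    then have "comp_at \<tau> (App s (Fv x))" using s by simp
    then show ?thesis using SN_App_left[of s "Fv x"] Arrow(2) comp_at_tm by (auto simp: trm_def)
  qed
  moreover have "comp_at (\<sigma> \<rightarrow> \<tau>) (apps (Fv x) ss)"
    if x: "vtype \<Sigma> x = arrows \<sigma>s (\<sigma> \<rightarrow> \<tau>)" "list_all2 (\<lambda>s \<sigma>. comp_at \<sigma> s \<and> SN s) ss \<sigma>s" for x ss \<sigma>s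
  proof -
    have "tm (apps (Fv x) ss) (\<sigma> \<rightarrow> \<tau>)"
      unfolding tm_apps using x by (intro exI[of _ \<sigma>s]) (auto elim: list.rel_mono_strong intro: comp_at_tm)
    moreover have "comp_at \<tau> (App (apps (Fv x) ss) t)" if "comp_at \<sigma> t" for t
    proof -
      have "list_all2 (\<lambda>s \<sigma>. comp_at \<sigma> s \<and> SN s) (ss @ [t]) (\<sigma>s @ [\<sigma>])"
        using x(2) that Arrow(1) by (intro list_all2_appendI) auto
      moreover have "vtype \<Sigma> x = arrows (\<sigma>s @ [\<sigma>]) \<tau>" using x by simp
      ultimately have "comp_at \<tau> (apps (Fv x) (ss @ [t]))" using Arrow(2) by blast
      then show ?thesis by simp
    qed
    ultimately show ?thesis by simp
  qed
  ultimately show ?case by blast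
qed

lemma comp_at_SN: "comp_at \<tau> s \<Longrightarrow> SN s" using comp_at_SN_and_Fv by blast

lemma comp_at_Fv: "comp_at (vtype \<Sigma> x) (Fv x)"
  using comp_at_SN_and_Fv[of "vtype \<Sigma> x", THEN conjunct2, rule_format, of x "[]" "[]"] by simp

text \<open>Types are unique, so hiding the type loses nothing and terms of varying types can be
  treated uniformly.\<close>

definition computable where "computable s \<longleftrightarrow> (\<exists>\<tau>. comp_at \<tau> s)"

lemma computable_trm: "computable s \<Longrightarrow> trm s" using comp_at_tm by (auto simp: computable_def trm_def)
lemma computable_comp_at: "computable s \<Longrightarrow> tm s \<tau> \<Longrightarrow> comp_at \<tau> s"
proof -
  assume a: "computable s" "tm s \<tau>"
  then obtain \<tau>' where t: "comp_at \<tau>' s" by (auto simp: computable_def)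
  then show ?thesis using tm_unique[OF comp_at_tm[OF t] a(2)] by simp
qed
lemma comp_at_computable: "comp_at \<tau> s \<Longrightarrow> computable s" by (auto simp: computable_def)
lemma computable_SN: "computable s \<Longrightarrow> SN s" using comp_at_SN by (auto simp: computable_def)
lemma computable_step: "computable s \<Longrightarrow> rstep \<Sigma> R s t \<Longrightarrow> computable t" using comp_at_step by (auto simp: computable_def)
lemma computable_rsteps: "rsteps s t \<Longrightarrow> computable s \<Longrightarrow> computable t" using comp_at_rsteps by (auto simp: computable_def)
lemma computable_Fv [simp]: "computable (Fv x)" using comp_at_Fv by (auto simp: computable_def)
lemma computable_App: "computable s \<Longrightarrow> computable t \<Longrightarrow> trm (App s t) \<Longrightarrow> computable (App s t)"
proof -
  assume a: "computable s" "computable t" "trm (App s t)"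
  then obtain \<sigma> \<tau> where "tm s (\<sigma> \<rightarrow> \<tau>)" "tm t \<sigma>" by (auto simp: trm_def tm_App)
  then have "comp_at (\<sigma> \<rightarrow> \<tau>) s" "comp_at \<sigma> t" using a computable_comp_at by blast+
  then show ?thesis by (auto simp: computable_def)
qed
lemma computable_apps: "computable h \<Longrightarrow> \<forall>s\<in>set ss. computable s \<Longrightarrow> trm (apps h ss) \<Longrightarrow> computable (apps h ss)"
proof (induct ss rule: rev_induct)
  case (snoc a ss)
  have "trm (apps h ss)" using snoc(4) by (auto simp: trm_def tm_App)
  then show ?case using snoc computable_App by simp
qed simp

text \<open>Failure at an arrow type has a computable argument as witness; collecting these
  witnesses leads to base type, where computability can be analysed by reduction steps.\<close>

lemma not_comp_at_expand:
  "tm s \<tau> \<Longrightarrow> \<not> comp_at \<tau> s \<Longrightarrow> \<exists>ss. (\<forall>s\<in>set ss. computable s) \<and> tm (apps s ss) (Sort (ty_res \<tau>)) \<and> apps s ss \<notin> C (ty_res \<tau>)"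
proof (induct \<tau> arbitrary: s)
  case (Sort \<iota>)
  then show ?case by (intro exI[of _ "[]"]) auto
next
  case (Arrow \<sigma> \<tau>)
  then obtain t where t: "comp_at \<sigma> t" "\<not> comp_at \<tau> (App s t)" by auto
  then have "tm (App s t) \<tau>" using Arrow(3) comp_at_tm[OF t(1)] by (auto simp: tm_App)
  from Arrow(2)[OF this t(2)] obtain ss where "\<forall>s\<in>set ss. computable s"
    "tm (apps (App s t) ss) (Sort (ty_res \<tau>))" "apps (App s t) ss \<notin> C (ty_res \<tau>)" by auto
  then show ?case using t by (intro exI[of _ "t # ss"]) (auto intro: comp_at_computable)
qed

text \<open>Two nested inductions. A step in \<open>a\<close> may leave the contractum unchanged, so
  it is paid for by the termination of \<open>a\<close>; steps in \<open>b\<close> or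
  \<open>ss\<close> are steps of the contractum and are paid for by its termination.\<close>

lemma C_beta:
  assumes "SN a"
  shows "tm (apps (Lam \<sigma> b) (a # ss)) (Sort \<iota>) \<Longrightarrow> apps (inst 0 [a] b) ss \<in> C \<iota> \<Longrightarrow> apps (Lam \<sigma> b) (a # ss) \<in> C \<iota>"
  using assms
proof (induct a arbitrary: b ss rule: SN_induct)
  case (step a)
  note outer = step
  have "SN (apps (inst 0 [a] b) ss)" using step(4) C_SN by blast
  then show ?case using step(3,4)
  proof (induct "apps (inst 0 [a] b) ss" arbitrary: b ss rule: SN_induct)
    case (step b ss)
    let ?N = "apps (Lam \<sigma> b) (a # ss)"
    have ta: "tm a \<sigma>" and tb: "wt \<Sigma> [\<sigma>] b \<tau>'" "FMV b = {}" if "tm (Lam \<sigma> b) (\<sigma> \<rightarrow> \<tau>')" for \<tau>'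
      using step(3) that by (auto simp: tm_apps tm_Lam list_all2_Cons1 tm_App)
    obtain \<tau>' where l: "tm (Lam \<sigma> b) (\<sigma> \<rightarrow> \<tau>')" using step(3) by (auto simp: tm_apps tm_Lam list_all2_Cons1 tm_App)
    have tM: "trm (apps (inst 0 [a] b) ss)" using C_tm[OF step(4)] by (auto simp: trm_def)
    show ?case
    proof (rule C_expand[OF step(3)])
      fix t assume st: "rstep \<Sigma> R ?N t"
      then have tt: "tm t (Sort \<iota>)" using rstep_tm' step(3) by blast
      from rstep_apps_cases[OF st not_App(3)] show "t \<in> C \<iota>"
      proof (elim disjE exE conjE, goal_cases)
        case (1 i u)
        show ?case
        proof (cases i)
          case 0
          then have u: "rstep \<Sigma> R a u" "t = apps (Lam \<sigma> b) (u # ss)" using 1 by auto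
          have "rsteps (inst 0 [a] b) (inst 0 [u] b)"
            using rsteps_inst[OF tb[OF l], of "[a]" "[u]"] ta[OF l] u by auto
          then have "apps (inst 0 [u] b) ss \<in> C \<iota>"
            using C_rsteps[OF rsteps_apps_head] tM step(4) by blast
          then show ?thesis using outer(2)[OF u(1), of b ss] u tt by simp
        next
          case (Suc j)
          then have u: "rstep \<Sigma> R (ss ! j) u" "t = apps (Lam \<sigma> b) (a # ss[j := u])" "j < length ss" using 1 by auto
          have s: "rstep \<Sigma> R (apps (inst 0 [a] b) ss) (apps (inst 0 [a] b) (ss[j := u]))"
            using rstep_apps_arg u tM by blast
          then show ?thesis using step(2)[OF s] C_step[OF step(4) s] u tt by simp
        qed
      next
        case (2 n l r \<delta>)
        obtain f ls where "l = apps (Fn f) ls" using ruleD[OF 2(2)] by metis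
        then have "apps (Fn f) (map (subst \<Sigma> \<delta>) ls) = apps (Lam \<sigma> b) (take n (a # ss))" using 2 by simp
        then show ?case by (subst (asm) apps_eq_iff) auto
      next
        case (3 \<sigma>' b' h')
        then obtain b2 where b2: "h' = Lam \<sigma> b2" "rstep \<Sigma> R (inst 0 [a] b) (inst 0 [a] b2)"
          using rstep_Lam_inv[of \<sigma> b h'] ta[OF l] by auto
        have s: "rstep \<Sigma> R (apps (inst 0 [a] b) ss) (apps (inst 0 [a] b2) ss)"
          using rstep_apps_head b2 tM by blast
        then show ?case using step(2)[OF s] C_step[OF step(4) s] b2 3 tt by simp
      next
        case 4
        then show ?case using step(4) by auto
      qed
    next
      fix f us i assume "?N = apps (Fn f) us"
      then show "comp_at (ty_args (ftype \<Sigma> f) ! i) (us ! i)" by (subst (asm) apps_eq_iff) auto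
    next
      fix w \<kappa> u assume "?N = App (Fv w) u"
      then have "?N = apps (Fv w) [u]" by simp
      then show "u \<in> C \<kappa>" by (subst (asm) apps_eq_iff) auto
    qed
  qed
qed

lemma comp_at_beta:
  "SN a \<Longrightarrow> tm (apps (Lam \<sigma> b) (a # ss)) \<tau> \<Longrightarrow> comp_at \<tau> (apps (inst 0 [a] b) ss) \<Longrightarrow> comp_at \<tau> (apps (Lam \<sigma> b) (a # ss))"
proof (induct \<tau> arbitrary: ss)
  case (Sort \<iota>)
  then show ?case using C_beta by simp
next
  case (Arrow \<sigma>' \<tau>)
  have "comp_at \<tau> (App (apps (Lam \<sigma> b) (a # ss)) t)" if "comp_at \<sigma>' t" for t
  proof -
    have "tm (apps (Lam \<sigma> b) (a # (ss @ [t]))) \<tau>" using Arrow(4) comp_at_tm[OF that] by (auto simp: tm_App)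
    moreover have "comp_at \<tau> (apps (inst 0 [a] b) (ss @ [t]))" using Arrow(5) that by simp
    ultimately have "comp_at \<tau> (apps (Lam \<sigma> b) (a # (ss @ [t])))" using Arrow(2)[OF Arrow(3)] by blast
    then show ?thesis by simp
  qed
  then show ?case using Arrow(4) by simp
qed

lemma comp_at_Lam:
  assumes "tm (Lam \<sigma> b) (\<sigma> \<rightarrow> \<tau>)" "\<And>a. comp_at \<sigma> a \<Longrightarrow> comp_at \<tau> (inst 0 [a] b)"
  shows "comp_at (\<sigma> \<rightarrow> \<tau>) (Lam \<sigma> b)"
proof -
  have "comp_at \<tau> (App (Lam \<sigma> b) a)" if "comp_at \<sigma> a" for a
    using comp_at_beta[of a \<sigma> b "[]" \<tau>] assms(2)[OF that] comp_at_SN[OF that] comp_at_tm[OF that] assms(1) by (auto simp: tm_App)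
  then show ?thesis using assms(1) by simp
qed

section \<open>Head contraction and instances of meta-variables\<close>

text \<open>Contraction may discard \<open>a\<close> together with its infinite reductions;
  \<open>SN a\<close> excludes this and makes computability invariant in both directions.\<close>

definition head_beta where
  "head_beta s s' \<longleftrightarrow> (\<exists>\<sigma> b a ss. s = apps (Lam \<sigma> b) (a # ss) \<and> s' = apps (inst 0 [a] b) ss \<and> SN a)"

lemma head_beta_rstep: "head_beta s s' \<Longrightarrow> trm s \<Longrightarrow> rstep \<Sigma> R s s'"
proof -
  assume h: "head_beta s s'" "trm s"
  then obtain \<sigma> b a ss where s: "s = apps (App (Lam \<sigma> b) a) ss" "s' = apps (inst 0 [a] b) ss"
    by (auto simp: head_beta_def)
  then have "trm (App (Lam \<sigma> b) a)" using trm_apps_head h by blast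
  then have "rstep \<Sigma> R (App (Lam \<sigma> b) a) (inst 0 [a] b)" using rstep_beta unfolding trm_def by blast
  from rstep_apps_head[OF this, of ss] show ?thesis using s h by simp
qed

text \<open>\<open>as\<close> are the arguments consumed so far. Each contraction moves one more
  into the simultaneous instantiation, so that successive contractions end in the single
  \<open>inst\<close> of \<open>meta_inst\<close>.\<close>

lemma head_beta_meta_inst_gen:
  "strip_lams (length ss) t = (n, u) \<Longrightarrow> \<forall>s\<in>set as. lc 0 s \<Longrightarrow> \<forall>s\<in>set ss. lc 0 s \<and> SN s \<Longrightarrow>
   head_beta\<^sup>*\<^sup>* (apps (inst 0 as t) ss) (apps (inst 0 (as @ take n ss) u) (drop n ss))"
proof (induct ss arbitrary: t as n u)
  case Nil
  then show ?case by auto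
next
  case (Cons s ss)
  show ?case
  proof (cases "\<exists>\<sigma> b. t = Lam \<sigma> b")
    case True
    then obtain \<sigma> b where t: "t = Lam \<sigma> b" by auto
    then obtain m where m: "strip_lams (length ss) b = (m, u)" "n = Suc m" using Cons(2) by (auto split: prod.splits)
    have "head_beta (apps (inst 0 as t) (s # ss)) (apps (inst 0 [s] (inst 1 as b)) ss)"
      unfolding head_beta_def using t Cons(4) by auto
    also have "inst 0 [s] (inst 1 as b) = inst 0 (as @ [s]) b"
      using inst_append[OF Cons(3), of 0 "[s]" b] by simp
    also have "head_beta\<^sup>*\<^sup>* (apps (inst 0 (as @ [s]) b) ss) (apps (inst 0 ((as @ [s]) @ take m ss) u) (drop m ss))"
      using Cons(3,4) by (intro Cons(1) m) auto
    finally show ?thesis using m by simp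
  next
    case False
    then have "n = 0" "u = t" using Cons(2) by (cases t; simp)+
    then show ?thesis by simp
  qed
qed

lemma head_beta_meta_inst: "\<forall>s\<in>set ss. lc 0 s \<and> SN s \<Longrightarrow> head_beta\<^sup>*\<^sup>* (apps t ss) (meta_inst t ss)"
proof -
  assume a: "\<forall>s\<in>set ss. lc 0 s \<and> SN s"
  obtain n u where s: "strip_lams (length ss) t = (n, u)" by fastforce
  show ?thesis using head_beta_meta_inst_gen[OF s, of "[]"] a s by (simp add: meta_inst_def)
qed

lemma computable_head_beta: "head_beta\<^sup>*\<^sup>* s s' \<Longrightarrow> trm s \<Longrightarrow> computable s \<longleftrightarrow> computable s'"
proof (induct rule: converse_rtranclp_induct)
  case (step y z)
  have st: "rstep \<Sigma> R y z" using head_beta_rstep step by blast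
  then have z: "trm z" using rstep_tm by (auto simp: trm_def)
  have "computable y" if "computable z"
  proof -
    obtain \<tau> where t: "tm y \<tau>" using step by (auto simp: trm_def)
    then have "comp_at \<tau> z" using rstep_tm'[OF st] computable_comp_at that by blast
    then have "comp_at \<tau> y" using t step(1) comp_at_beta unfolding head_beta_def by blast
    then show ?thesis by (rule comp_at_computable)
  qed
  then show ?case using step(3) z computable_step st by blast
qed simp

lemma computable_meta_inst: "trm (apps t ss) \<Longrightarrow> \<forall>s\<in>set ss. SN s \<Longrightarrow> computable (apps t ss) \<longleftrightarrow> computable (meta_inst t ss)"
  by (rule computable_head_beta[OF head_beta_meta_inst]) (auto dest!: trm_apps_arg intro: trm_lc)

text \<open>Used contrapositively, it extracts a root step to a non-computable term. The premise
  ranges over all reducts \<open>ws\<close> of the arguments and therefore survives an argument step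
  in the induction; arguments beyond the matched prefix are computable and are applied again
  afterwards.\<close>

lemma C_Fn_apps:
  assumes "ss \<in> Wellfounded.acc (listrel1 red)"
  shows "tm (apps (Fn f) ss) (Sort \<iota>) \<Longrightarrow> \<forall>s\<in>set ss. computable s \<Longrightarrow>
    (\<And>ws n l r \<delta>. list_all2 rsteps ss ws \<Longrightarrow> n \<le> length ws \<Longrightarrow> (l, r) \<in> R \<Longrightarrow> is_subst \<Sigma> \<delta> \<Longrightarrow>
       sdom \<Sigma> \<delta> = Inr ` FMV l \<Longrightarrow> subst \<Sigma> \<delta> l = apps (Fn f) (take n ws) \<Longrightarrow> computable (subst \<Sigma> \<delta> r)) \<Longrightarrow>
    apps (Fn f) ss \<in> C \<iota>"
  using assms
proof (induct rule: acc.induct)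
  case (accI ss)
  show ?case
  proof (rule C_expand[OF accI(3)])
    fix t assume st: "rstep \<Sigma> R (apps (Fn f) ss) t"
    then have tt: "tm t (Sort \<iota>)" using rstep_tm' accI(3) by blast
    from rstep_apps_cases[OF st not_App(1)] show "t \<in> C \<iota>"
    proof (elim disjE exE conjE, goal_cases)
      case (1 i u)
      have r: "list_all2 rsteps ss (ss[i := u])"
        using 1 by (auto simp: list_all2_conv_all_nth nth_list_update)
      show ?case unfolding 1
      proof (rule accI(2))
        show "(ss[i := u], ss) \<in> listrel1 red" using listrel1_update[of i ss u red] 1 by (auto simp: red_def)
        show "tm (apps (Fn f) (ss[i := u])) (Sort \<iota>)" using tt 1 by simp
        show "\<forall>s\<in>set (ss[i := u]). computable s"
          using accI(4) computable_step[of "ss ! i" u] 1 set_update_subset_insert[of ss i u] by auto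
        fix ws n l r \<delta> assume w: "list_all2 rsteps (ss[i := u]) ws" and h: "n \<le> length ws" "(l, r) \<in> R" "is_subst \<Sigma> \<delta>"
           "sdom \<Sigma> \<delta> = Inr ` FMV l" "subst \<Sigma> \<delta> l = apps (Fn f) (take n ws)"
        have "list_all2 rsteps ss ws" using list_all2_trans[OF _ r w] by (meson rtranclp_trans)
        then show "computable (subst \<Sigma> \<delta> r)" using accI(5) h by blast
      qed
    next
      case (2 n l r \<delta>)
      have "computable (subst \<Sigma> \<delta> r)"
      proof (rule accI(5))
        show "list_all2 rsteps ss ss" by (simp add: list.rel_refl)
      qed (use 2 in auto)
      moreover have "\<forall>s\<in>set (drop n ss). computable s" using accI(4) in_set_dropD by fastforce
      ultimately have "computable t" using computable_apps tt 2 by (auto simp: trm_def)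
      then show ?case using computable_comp_at[OF _ tt] by simp
    qed auto
  next
    fix g us i assume e: "apps (Fn f) ss = apps (Fn g) us" and i: "i < length us"
    then have gu: "g = f" "us = ss" by (subst (asm) apps_eq_iff, auto)+
    obtain \<sigma>s where s: "tm (Fn f) (arrows \<sigma>s (Sort \<iota>))" "list_all2 tm ss \<sigma>s" using accI(3) by (auto simp: tm_apps)
    then have "ftype \<Sigma> f = arrows \<sigma>s (Sort \<iota>)" by (simp add: tm_def)
    then have "tm (ss ! i) (ty_args (ftype \<Sigma> f) ! i)" using s(2) i gu by (simp add: list_all2_conv_all_nth)
    then show "comp_at (ty_args (ftype \<Sigma> g) ! i) (us ! i)" using gu computable_comp_at accI(4) i by simp
  next
    fix w \<kappa> u assume "apps (Fn f) ss = App (Fv w) u"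
    then have "apps (Fn f) ss = apps (Fv w) [u]" by simp
    then show "u \<in> C \<kappa>" by (subst (asm) apps_eq_iff) auto
  qed
qed

end

section \<open>Accessibility and meta-variable conditions\<close>

fun is_atom where "is_atom (Bd i) \<longleftrightarrow> True" | "is_atom (Fv x) \<longleftrightarrow> True" | "is_atom _ \<longleftrightarrow> False"

text \<open>The distinctness condition of patterns in a form that survives closing a binder, where
  the arguments of a meta-variable may be indices as well as variables. It is inherited by
  accessible subterms and there yields distinct \<open>xs\<close>.\<close>

fun meta_linear :: "('f, 'v, 'm, 's) mt \<Rightarrow> bool" where
  "meta_linear (App s t) \<longleftrightarrow> meta_linear s \<and> meta_linear t"
| "meta_linear (Lam \<sigma> s) \<longleftrightarrow> meta_linear s"
| "meta_linear (Meta Z ss) \<longleftrightarrow> distinct ss \<and> (\<forall>s\<in>set ss. is_atom s)"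
| "meta_linear _ \<longleftrightarrow> True"

lemma meta_linear_apps [simp]: "meta_linear (apps h ss) \<longleftrightarrow> meta_linear h \<and> (\<forall>s\<in>set ss. meta_linear s)"
  by (induct ss arbitrary: h) auto

lemma is_atom_close [simp]: "is_atom (close x d s) \<longleftrightarrow> is_atom s"
  by (cases s) auto

lemma close_atom_inj: "is_atom s \<Longrightarrow> is_atom t \<Longrightarrow> lc d s \<Longrightarrow> lc d t \<Longrightarrow> close x d s = close x d t \<Longrightarrow> s = t"
  by (cases s; cases t) (auto split: if_splits)

text \<open>With all indices below \<open>d\<close>, the index that replaces \<open>x\<close> is
  new, so closing neither identifies nor separates arguments.\<close>

lemma meta_linear_close: "lc d s \<Longrightarrow> meta_linear (close x d s) \<longleftrightarrow> meta_linear s"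
proof (induct s arbitrary: d)
  case (Meta Z ss)
  have "inj_on (close x d) (set ss)" if "\<forall>s\<in>set ss. is_atom s"
  proof (rule inj_onI)
    fix s t assume s: "s \<in> set ss" "t \<in> set ss" "close x d s = close x d t"
    show "s = t" by (rule close_atom_inj[OF _ _ _ _ s(3)]) (use that Meta(2) s in auto)
  qed
  then show ?case using distinct_map[of "close x d" ss] by auto
qed auto

lemma pattern_lc_linear: "pattern \<Sigma> l \<Longrightarrow> lc 0 l \<and> meta_linear l"
proof (induct rule: pattern.induct)
  case (1 xs Z)
  then show ?case by (auto simp: distinct_map inj_on_def)
next
  case (2 l x)
  then show ?case using lc_close[of 0 l x] meta_linear_close[of 0 l x] by (simp add: lam_def)
qed auto

lemma acc_subterm_linear: "acc_subterm \<Sigma> ge s t \<Longrightarrow> meta_linear s \<Longrightarrow> meta_linear t"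
proof (induct rule: acc_subterm.induct)
  case (2 s t x)
  have "lc 0 s" using 2(1) has_type_wt wt_lc unfolding is_mterm_def by fastforce
  then show ?case using 2 meta_linear_close[of 0 s x] by (simp add: lam_def)
next
  case (3 i f ss t)
  then have "ss ! (i - 1) \<in> set ss" by (auto simp: Acc_fun_def Let_def)
  then show ?case using 3 by auto
next
  case (4 i x ss t)
  then have "ss ! (i - 1) \<in> set ss" by (auto simp: Acc_var_def Let_def)
  then show ?case using 4 by auto
qed simp

section \<open>Arguments on which an instance depends\<close>

fun occurs :: "nat \<Rightarrow> ('f, 'v, 'm, 's) mt \<Rightarrow> bool" where
  "occurs k (Bd i) \<longleftrightarrow> i = k"
| "occurs k (App s t) \<longleftrightarrow> occurs k s \<or> occurs k t"
| "occurs k (Lam \<sigma> s) \<longleftrightarrow> occurs (Suc k) s"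
| "occurs k (Meta Z ss) \<longleftrightarrow> (\<exists>s\<in>set ss. occurs k s)"
| "occurs k _ \<longleftrightarrow> False"

text \<open>\<open>needs j t\<close> is the condition \<open>Z : j + 1\<close> for \<open>\<gamma>(Z) = t\<close>.\<close>

fun needs :: "nat \<Rightarrow> ('f, 'v, 'm, 's) mt \<Rightarrow> bool" where
  "needs 0 (Lam \<sigma> b) \<longleftrightarrow> occurs 0 b"
| "needs (Suc j) (Lam \<sigma> b) \<longleftrightarrow> needs j b"
| "needs _ _ \<longleftrightarrow> True"

lemma strip_lams_occurs: "strip_lams k t = (n, u) \<Longrightarrow> occurs (d + n) u \<longleftrightarrow> occurs d t"
proof (induct k t arbitrary: n u d rule: strip_lams.induct)
  case (1 k \<sigma> t)
  then obtain m where m: "strip_lams k t = (m, u)" "n = Suc m" by (auto split: prod.splits)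
  then show ?case using 1(1)[OF m(1), of "Suc d"] by simp
qed auto

text \<open>Arguments are counted from the outermost abstraction and indices from the innermost, so
  argument \<open>j\<close> has index \<open>n - 1 - j\<close>. An argument beyond the stripped
  abstractions always satisfies \<open>needs\<close>, whence \<open>j < n\<close>.\<close>

lemma strip_lams_needs:
  "strip_lams k t = (n, u) \<Longrightarrow> j < k \<Longrightarrow> \<not> needs j t \<Longrightarrow> j < n \<and> \<not> occurs (n - 1 - j) u"
proof (induct k t arbitrary: n u j rule: strip_lams.induct)
  case (1 k \<sigma> t)
  then obtain m where m: "strip_lams k t = (m, u)" "n = Suc m" by (auto split: prod.splits)
  show ?case
  proof (cases j)
    case 0
    then show ?thesis using m 1 strip_lams_occurs[OF m(1), of 0] by auto
  next
    case (Suc i)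
    then show ?thesis using m 1(1)[OF m(1), of i] 1(3,4) by auto
  qed
qed auto

lemma inst_cong:
  "length ss = length ss' \<Longrightarrow> \<forall>i<length ss. occurs (d + i) s \<longrightarrow> rev ss ! i = rev ss' ! i \<Longrightarrow> inst d ss s = inst d ss' s"
proof (induct s arbitrary: d)
  case (Bd i)
  show ?case
  proof (cases "d \<le> i \<and> i - d < length ss")
    case True
    then have "rev ss ! (i - d) = rev ss' ! (i - d)" using Bd(2) by auto
    then show ?thesis using True Bd(1) by auto
  next
    case False
    then show ?thesis using Bd(1) by auto
  qed
qed auto

text \<open>An argument whose index does not occur in the stripped body disappears from the instance
  and may be exchanged freely.\<close>

lemma meta_inst_cong:
  assumes "length ss = length ss'" "\<forall>j<length ss. needs j t \<longrightarrow> ss ! j = ss' ! j"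
  shows "meta_inst t ss = meta_inst t ss'"
proof -
  obtain n u where s: "strip_lams (length ss) t = (n, u)" by fastforce
  then have n: "n \<le> length ss"
  proof (induct "length ss" t arbitrary: ss n u rule: strip_lams.induct)
    case (1 k \<sigma> t)
    then obtain m where m: "strip_lams k t = (m, u)" "n = Suc m" by (auto split: prod.splits simp flip: 1(2))
    then show ?case using 1(1)[of "tl ss"] 1(2) by (cases ss) auto
  qed auto
  have "inst 0 (take n ss) u = inst 0 (take n ss') u"
  proof (rule inst_cong)
    show "length (take n ss) = length (take n ss')" using assms by simp
    show "\<forall>i<length (take n ss). occurs (0 + i) u \<longrightarrow> rev (take n ss) ! i = rev (take n ss') ! i"
    proof (intro allI impI)
      fix i assume i: "i < length (take n ss)" "occurs (0 + i) u"
      let ?j = "n - 1 - i"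
      have "n - 1 - ?j = i" "?j < length ss" using i n by auto
      then have "needs ?j t" using strip_lams_needs[OF s, of ?j] i by auto
      then have "ss ! ?j = ss' ! ?j" using assms \<open>?j < length ss\<close> by blast
      then show "rev (take n ss) ! i = rev (take n ss') ! i" using i n assms(1) by (simp add: rev_nth)
    qed
  qed
  moreover have "drop n ss = drop n ss'"
  proof (rule nth_equalityI)
    fix i assume i: "i < length (drop n ss)"
    then have "n + i < length ss" by simp
    \<comment> \<open>No abstraction takes these arguments; they remain applied to the instance and
      so must agree.\<close>
    then have "needs (n + i) t" using strip_lams_needs[OF s, of "n + i"] by linarith
    then show "drop n ss ! i = drop n ss' ! i" using assms i by auto
  qed (use assms in auto)
  ultimately show ?thesis using s assms(1) by (simp add: meta_inst_def)
qed

text \<open>Induction measure for naming binders: the opened body is not a subterm, but it keeps its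
  number of leading abstractions.\<close>

fun lead_lams where "lead_lams (Lam \<sigma> b) = Suc (lead_lams b)" | "lead_lams _ = 0"

lemma lead_lams_inst [simp]: "lead_lams (inst d [Fv x] b) = lead_lams b"
  by (induct b arbitrary: d) auto

lemma occurs_inst: "e < d \<Longrightarrow> occurs e (inst d [Fv x] b) \<longleftrightarrow> occurs e b"
  by (induct b arbitrary: d e) auto

lemma needs_inst: "needs j (inst d [Fv x] b) \<longleftrightarrow> needs j b"
proof (induct b arbitrary: d j)
  case (Lam \<sigma> b)
  then show ?case by (cases j) (auto simp: occurs_inst)
qed auto

lemma occurs_FV: "occurs d b \<Longrightarrow> x \<in> FV (inst d [Fv x] b)"
  by (induct b arbitrary: d) auto

lemma FV_foldr_lam: "FV (foldr (lam \<Sigma>) xs u) = FV u - set xs"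
  by (induct xs) (auto simp: lam_def)

text \<open>
  \<open>min_args k n s\<close>: applied to \<open>n\<close> further arguments, \<open>s\<close> has every symbol \<open>f\<close> applied to at least
  \<open>k f\<close> arguments.
\<close>

fun min_args :: "('f \<Rightarrow> nat) \<Rightarrow> nat \<Rightarrow> ('f, 'v, 'm, 's) mt \<Rightarrow> bool" where
  "min_args k n (Fn f) \<longleftrightarrow> k f \<le> n"
| "min_args k n (App s t) \<longleftrightarrow> min_args k (Suc n) s \<and> min_args k 0 t"
| "min_args k n (Lam \<sigma> s) \<longleftrightarrow> min_args k 0 s"
| "min_args k n (Meta Z ss) \<longleftrightarrow> (\<forall>s\<in>set ss. min_args k 0 s)"
| "min_args k n _ \<longleftrightarrow> True"

lemma min_args_close [simp]: "min_args k n (close x d s) \<longleftrightarrow> min_args k n s"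
  by (induct s arbitrary: n d) auto

lemma min_args_0: "min_args (\<lambda>_. 0) n s"
  by (induct s arbitrary: n) auto

text \<open>Heads of applications are not fully applied subterms, so the spine that ends in
  \<open>s\<close> has a premise of its own, with \<open>n\<close> counting the arguments supplied
  from outside.\<close>

lemma min_argsI:
  "has_type \<Sigma> s \<tau> \<Longrightarrow> \<forall>f rs. s = apps (Fn f) rs \<longrightarrow> k f \<le> n + length rs \<Longrightarrow>
   \<forall>f rs. fully_applied_subterm \<Sigma> s (apps (Fn f) rs) \<longrightarrow> k f \<le> length rs \<Longrightarrow> min_args k n s"
proof (induct arbitrary: n rule: has_type.induct)
  case (fn f)
  from fn(2)[rule_format, of f "[]"] show ?case by simp
next
  case (app s \<sigma> \<tau> t)
  have "min_args k (Suc n) s"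
  proof (rule app(2))
    show "\<forall>f rs. s = apps (Fn f) rs \<longrightarrow> k f \<le> Suc n + length rs"
    proof (intro allI impI)
      fix f rs assume "s = apps (Fn f) rs"
      then have "App s t = apps (Fn f) (rs @ [t])" by simp
      then show "k f \<le> Suc n + length rs" using app(5) by fastforce
    qed
  qed (use app(6) fully_applied_subterm.intros(3) in blast)
  moreover have "min_args k 0 t"
  proof (rule app(4))
    show "\<forall>f rs. t = apps (Fn f) rs \<longrightarrow> k f \<le> 0 + length rs"
      using app(6) fully_applied_subterm.intros(2)[of t _ \<Sigma> s] by auto
  qed (use app(6) fully_applied_subterm.intros(2) in blast)
  ultimately show ?case by simp
next
  case (lam s \<tau> x)
  have m: "is_mterm \<Sigma> s" using lam(1) by (auto simp: is_mterm_def)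
  have "min_args k 0 s"
  proof (rule lam(2))
    show "\<forall>f rs. s = apps (Fn f) rs \<longrightarrow> k f \<le> 0 + length rs"
      using lam(4) fully_applied_subterm.intros(1)[OF m, of _ x] by auto
  qed (use lam(4) fully_applied_subterm.intros(1)[OF m] in blast)
  then show ?case by (simp add: lam_def)
next
  case (meta Z \<sigma>s \<tau> ss)
  have "min_args k 0 s" if s: "s \<in> set ss" for s
  proof -
    have f: "\<And>t. s = t \<or> fully_applied_subterm \<Sigma> s t \<Longrightarrow> fully_applied_subterm \<Sigma> (Meta Z ss) t"
      using fully_applied_subterm.intros(4)[OF s] by blast
    from list_all2_in_set1[OF meta(3) s] obtain \<sigma> where
      IH: "\<And>n. \<forall>f rs. s = apps (Fn f) rs \<longrightarrow> k f \<le> n + length rs \<Longrightarrow>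
        \<forall>f rs. fully_applied_subterm \<Sigma> s (apps (Fn f) rs) \<longrightarrow> k f \<le> length rs \<Longrightarrow> min_args k n s" by auto
    show ?thesis by (rule IH) (use f meta(5) in auto)
  qed
  then show ?case by simp
qed auto

context afsm_system
begin

text \<open>Produces the named form in which \<open>respects_conds\<close> reads a value. Names
  already chosen are collected in \<open>S\<close>; this keeps \<open>xs\<close> distinct and
  prevents a later name from capturing an occurrence of an earlier one.\<close>

lemma ex_lam_form:
  "wt \<Sigma> [] t \<tau> \<Longrightarrow> finite S \<Longrightarrow> \<exists>xs u. t = foldr (lam \<Sigma>) xs u \<and> distinct xs \<and> set xs \<inter> S = {} \<and> is_mterm \<Sigma> u \<and>
     (\<nexists>\<sigma> b. u = Lam \<sigma> b) \<and> (\<forall>j. needs j t \<longrightarrow> j \<ge> length xs \<or> xs ! j \<in> FV u)"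
proof (induct "lead_lams t" arbitrary: t \<tau> S)
  case 0
  then have "\<nexists>\<sigma> b. t = Lam \<sigma> b" by (cases t) auto
  then show ?case using 0 by (intro exI[of _ "[]"] exI[of _ t]) (auto simp: is_mterm_iff)
next
  case (Suc n)
  then obtain \<sigma> b where t: "t = Lam \<sigma> b" "n = lead_lams b" by (cases t) auto
  then obtain \<tau>' where b: "wt \<Sigma> [\<sigma>] b \<tau>'" using Suc(3) by auto
  obtain x where x: "vtype \<Sigma> x = \<sigma>" "x \<notin> S \<union> FV b" using fresh[of "S \<union> FV b" \<sigma>] Suc(4) by auto
  let ?b = "inst 0 [Fv x] b"
  have "wt \<Sigma> [] ?b \<tau>'" using wt_inst0[of \<Sigma> "[\<sigma>]" b \<tau>' "[Fv x]"] b x by simp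
  moreover have "n = lead_lams ?b" using t by simp
  moreover have "finite (insert x S)" using Suc(4) by simp
  ultimately obtain xs u where u: "?b = foldr (lam \<Sigma>) xs u" "distinct xs" "set xs \<inter> insert x S = {}"
    "is_mterm \<Sigma> u" "\<nexists>\<sigma> b. u = Lam \<sigma> b" "\<forall>j. needs j ?b \<longrightarrow> j \<ge> length xs \<or> xs ! j \<in> FV u"
    using Suc(1)[of ?b \<tau>' "insert x S"] by blast
  have l: "lam \<Sigma> x ?b = t" using lam_inst[of x b] x t wt_lc[OF b] by simp
  have "j \<ge> length (x # xs) \<or> (x # xs) ! j \<in> FV u" if j: "needs j t" for j
  proof (cases j)
    case 0
    then have "occurs 0 b" using j t by simp
    then have "x \<in> FV u - set xs" using occurs_FV[of 0 b x] u(1) FV_foldr_lam[of \<Sigma> xs u] by simp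
    then show ?thesis using 0 by simp
  next
    case (Suc i)
    then have "needs i ?b" using j t by (simp add: needs_inst)
    then show ?thesis using u(6) Suc by auto
  qed
  then show ?case using u l x by (intro exI[of _ "x # xs"] exI[of _ u]) auto
qed

text \<open>The clauses of \<open>beta_subterm\<close> present abstractions with a named variable.
  This and the next two lemmas provide the same descents for nameless abstractions.\<close>

lemma beta_subterm_arg:
  assumes "a \<in> set as" "beta_subterm \<Sigma> A a t" "is_mterm \<Sigma> h" "\<not> is_App h"
  shows "beta_subterm \<Sigma> A (apps h as) t"
proof (cases h)
  case (Lam \<sigma> b)
  then obtain \<tau> where b: "wt \<Sigma> [\<sigma>] b \<tau>" using assms(3) by (auto simp: is_mterm_iff)
  obtain x where x: "vtype \<Sigma> x = \<sigma>" "x \<notin> FV b" using fresh[of "FV b" \<sigma>] by auto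
  have "is_mterm \<Sigma> (inst 0 [Fv x] b)"
    using wt_inst0[of \<Sigma> "[\<sigma>]" b \<tau> "[Fv x]"] b x by (auto simp: is_mterm_iff)
  from beta_subterm.intros(3)[OF this assms(1,2), of x]
  show ?thesis using lam_inst[of x b] x wt_lc[OF b] Lam by simp
next
  case (Bd i)
  then show ?thesis using assms(3) by (simp add: is_mterm_iff)
qed (use assms beta_subterm.intros in auto)

lemma beta_subterm_contract:
  assumes "is_mterm \<Sigma> (Lam \<sigma> b)" "lc 0 u" "beta_subterm \<Sigma> A (apps (inst 0 [u] b) us) t"
  shows "beta_subterm \<Sigma> A (apps (Lam \<sigma> b) (u # us)) t"
proof -
  obtain \<tau> where b: "wt \<Sigma> [\<sigma>] b \<tau>" using assms(1) by (auto simp: is_mterm_iff)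
  obtain x where x: "vtype \<Sigma> x = \<sigma>" "x \<notin> FV b" using fresh[of "FV b" \<sigma>] by auto
  let ?b = "inst 0 [Fv x] b"
  have w: "wt \<Sigma> [] ?b \<tau>" using wt_inst0[of \<Sigma> "[\<sigma>]" b \<tau> "[Fv x]"] b x by simp
  have "subst1 \<Sigma> x u ?b = inst 0 [u] b"
    using subst1_inst[OF assms(2), of ?b \<Sigma> x] wt_lc[OF w] close_inst[of 0 b x] wt_lc[OF b] x by simp
  then have "beta_subterm \<Sigma> A (apps (subst1 \<Sigma> x u ?b) us) t" using assms(3) by simp
  moreover have "is_mterm \<Sigma> ?b" using w by (auto simp: is_mterm_iff)
  ultimately have "beta_subterm \<Sigma> A (apps (lam \<Sigma> x ?b) (u # us)) t" by (intro beta_subterm.intros(4))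
  then show ?thesis using lam_inst[of x b] x wt_lc[OF b] by simp
qed

lemma beta_subterm_Lam:
  assumes "is_mterm \<Sigma> (Lam \<sigma> b)" "vtype \<Sigma> x = \<sigma>" "x \<notin> FV b" "beta_subterm \<Sigma> A (inst 0 [Fv x] b) t"
  shows "beta_subterm \<Sigma> A (Lam \<sigma> b) t"
proof -
  obtain \<tau> where b: "wt \<Sigma> [\<sigma>] b \<tau>" using assms(1) by (auto simp: is_mterm_iff)
  have "is_mterm \<Sigma> (inst 0 [Fv x] b)"
    using wt_inst0[of \<Sigma> "[\<sigma>]" b \<tau> "[Fv x]"] b assms by (auto simp: is_mterm_iff)
  from beta_subterm.intros(2)[OF this assms(4), of x]
  show ?thesis using lam_inst[of x b] assms wt_lc[OF b] by simp
qed

text \<open>Variables are computable, so a computable term reaches base type in this way without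
  losing computability, and the clauses of \<open>comp_op\<close> become applicable.\<close>

lemma ex_var_args: "tm s \<tau> \<Longrightarrow> \<exists>xs. tm (apps s (map Fv xs)) (Sort (ty_res \<tau>))"
proof (induct \<tau> arbitrary: s)
  case (Sort \<iota>)
  then show ?case by (intro exI[of _ "[]"]) auto
next
  case (Arrow \<sigma> \<tau>)
  obtain x where "vtype \<Sigma> x = \<sigma>" using fresh[of "{}" \<sigma>] by auto
  then have "tm (App s (Fv x)) \<tau>" using Arrow(3) by (auto simp: tm_App)
  from Arrow(2)[OF this] obtain xs where "tm (apps (App s (Fv x)) (map Fv xs)) (Sort (ty_res \<tau>))" by auto
  then show ?case by (intro exI[of _ "x # xs"]) auto
qed

lemma tm_apps_args:
  assumes "tm (apps h ss) \<tau>" "tm h \<tau>'"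
  shows "length ss \<le> length (ty_args \<tau>') \<and> \<tau>' = arrows (take (length ss) (ty_args \<tau>')) \<tau> \<and>
    list_all2 tm ss (take (length ss) (ty_args \<tau>'))"
proof -
  obtain \<sigma>s where s: "tm h (arrows \<sigma>s \<tau>)" "list_all2 tm ss \<sigma>s" using assms(1) by (auto simp: tm_apps)
  then have "\<tau>' = arrows \<sigma>s \<tau>" using tm_unique assms(2) by blast
  moreover have "length ss = length \<sigma>s" using s(2) by (rule list_all2_lengthD)
  ultimately show ?thesis using s by simp
qed

end

section \<open>Minimal non-computable terms\<close>

locale static_dp = computability +
  assumes pa: "properly_applied \<Sigma> R"
    and afp: "\<And>f ls r Z. (apps (Fn f) ls, r) \<in> R \<Longrightarrow> Z \<in> FMV r \<Longrightarrow> \<exists>l\<in>set ls. \<exists>xs. acc_subterm \<Sigma> ge l (Meta Z (map Fv xs))"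
begin

lemma min_appliedD:
  "min_applied \<Sigma> R f k \<Longrightarrow> (apps (Fn f) ls, r) \<in> R \<Longrightarrow> length ls = k"
  "min_applied \<Sigma> R f k \<Longrightarrow> (l, r) \<in> R \<Longrightarrow> r = apps (Fn f) rs \<or> fully_applied_subterm \<Sigma> r (apps (Fn f) rs) \<Longrightarrow> k \<le> length rs"
  unfolding min_applied_def by (drule (1) bspec, auto)+

text \<open>A defined symbol heads a rule, whose left-hand side determines the number; this
  justifies the definite description in \<open>minar\<close>.\<close>

lemma minar_applied: "f \<in> defined R \<Longrightarrow> min_applied \<Sigma> R f (minar \<Sigma> R f)"
proof -
  assume f: "f \<in> defined R"
  then obtain k where k: "min_applied \<Sigma> R f k" using pa by (auto simp: properly_applied_def)
  obtain ls r where l: "(apps (Fn f) ls, r) \<in> R" using f by (auto simp: defined_def)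
  have "j = length ls" if "min_applied \<Sigma> R f j" for j using min_appliedD(1)[OF that l] by simp
  from this[OF k] this have "j = k" if "min_applied \<Sigma> R f j" for j using that by simp
  then show ?thesis unfolding minar_def using k by (intro theI[of "min_applied \<Sigma> R f" k]) blast+
qed

lemma rule_minar: "(apps (Fn f) ls, r) \<in> R \<Longrightarrow> f \<in> defined R \<and> length ls = minar \<Sigma> R f"
proof -
  assume l: "(apps (Fn f) ls, r) \<in> R"
  then have f: "f \<in> defined R" by (auto simp: defined_def)
  then show ?thesis using min_appliedD(1)[OF minar_applied[OF f] l] by simp
qed

lemma rule_min_args:
  assumes "(l, r) \<in> R"
  shows "min_args (\<lambda>f. if f \<in> defined R then minar \<Sigma> R f else 0) 0 r"
proof -
  obtain \<tau> where "wt \<Sigma> [] r \<tau>" using ruleD[OF assms] by metis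
  then have "has_type \<Sigma> r \<tau>" using has_type_iff[OF wf] by blast
  then show ?thesis
  proof (rule min_argsI)
    show "\<forall>f rs. r = apps (Fn f) rs \<longrightarrow> (if f \<in> defined R then minar \<Sigma> R f else 0) \<le> 0 + length rs"
      using min_appliedD(2)[OF minar_applied assms] by auto
    show "\<forall>f rs. fully_applied_subterm \<Sigma> r (apps (Fn f) rs) \<longrightarrow> (if f \<in> defined R then minar \<Sigma> R f else 0) \<le> length rs"
      using min_appliedD(2)[OF minar_applied assms] by auto
  qed
qed

definition min_noncomp where
  "min_noncomp f us \<longleftrightarrow> f \<in> defined R \<and> length us = minar \<Sigma> R f \<and> trm (apps (Fn f) us) \<and>
     (\<forall>u\<in>set us. computable u) \<and> \<not> computable (apps (Fn f) us)"

text \<open>\<open>f us\<close> may have an arrow type or too few arguments for a rule. The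
  witnesses \<open>ts\<close> bring it to base type, where failure must come from a root
  step.\<close>

lemma Fn_noncomputable:
  assumes "trm (apps (Fn f) us)" "\<forall>u\<in>set us. computable u" "\<not> computable (apps (Fn f) us)"
  obtains ts ws ls r \<delta> where "\<forall>t\<in>set ts. computable t" "trm (apps (Fn f) (us @ ts))" "\<not> computable (apps (Fn f) (us @ ts))"
    "list_all2 rsteps (us @ ts) ws" "minar \<Sigma> R f \<le> length ws" "(apps (Fn f) ls, r) \<in> R" "is_subst \<Sigma> \<delta>"
    "sdom \<Sigma> \<delta> = Inr ` FMV (apps (Fn f) ls)"
    "subst \<Sigma> \<delta> (apps (Fn f) ls) = apps (Fn f) (take (minar \<Sigma> R f) ws)" "\<not> computable (subst \<Sigma> \<delta> r)"
proof -
  obtain \<tau> where t: "tm (apps (Fn f) us) \<tau>" using assms by (auto simp: trm_def)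
  moreover have "\<not> comp_at \<tau> (apps (Fn f) us)" using assms(3) comp_at_computable by blast
  ultimately obtain ts where ts: "\<forall>t\<in>set ts. computable t" "tm (apps (Fn f) (us @ ts)) (Sort (ty_res \<tau>))"
    "apps (Fn f) (us @ ts) \<notin> C (ty_res \<tau>)" using not_comp_at_expand[of "apps (Fn f) us" \<tau>] by auto
  have n: "\<not> computable (apps (Fn f) (us @ ts))" using computable_comp_at[OF _ ts(2)] ts(3) by auto
  have c: "\<forall>u\<in>set (us @ ts). computable u" using assms ts by auto
  then have "us @ ts \<in> Wellfounded.acc (listrel1 red)" using computable_SN by (intro SN_list) blast
  from C_Fn_apps[OF this ts(2) c] ts(3) obtain ws n l r \<delta> where r: "list_all2 rsteps (us @ ts) ws" "n \<le> length ws"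
    "(l, r) \<in> R" "is_subst \<Sigma> \<delta>" "sdom \<Sigma> \<delta> = Inr ` FMV l" "subst \<Sigma> \<delta> l = apps (Fn f) (take n ws)" "\<not> computable (subst \<Sigma> \<delta> r)"
    by blast
  obtain g ls where l: "l = apps (Fn g) ls" using ruleD[OF r(3)] by metis
  have "apps (Fn g) (map (subst \<Sigma> \<delta>) ls) = apps (Fn f) (take n ws)" using r(6) l by simp
  then have g: "g = f" "map (subst \<Sigma> \<delta>) ls = take n ws" by (subst (asm) apps_eq_iff, auto)+
  have "length ls = minar \<Sigma> R f" using rule_minar r(3) l g by blast
  moreover have "length ls = n" using arg_cong[OF g(2), of length] r(2) by simp
  ultimately have k: "n = minar \<Sigma> R f" by simp
  have "trm (apps (Fn f) (us @ ts))" using ts(2) by (auto simp: trm_def)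
  from that[OF ts(1) this n r(1)] r(2-7) show thesis unfolding k l g(1) by blast
qed

text \<open>Cutting off arguments keeps non-computability, since a computable prefix applied to
  computable arguments would be computable. If \<open>us\<close> is too short, the witnesses
  \<open>ts\<close> fill it up and still give some minimal term, though none that is part of
  \<open>f us\<close>.\<close>

lemma Fn_min_noncomp:
  assumes "trm (apps (Fn f) us)" "\<forall>u\<in>set us. computable u" "\<not> computable (apps (Fn f) us)"
  shows "f \<in> defined R \<and> (\<exists>vs. min_noncomp f vs) \<and> (minar \<Sigma> R f \<le> length us \<longrightarrow> min_noncomp f (take (minar \<Sigma> R f) us))"
proof -
  let ?k = "minar \<Sigma> R f"
  from Fn_noncomputable[OF assms] obtain ts ws ls r where w: "\<forall>t\<in>set ts. computable t" "trm (apps (Fn f) (us @ ts))"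
    "\<not> computable (apps (Fn f) (us @ ts))" "list_all2 rsteps (us @ ts) ws" "?k \<le> length ws" "(apps (Fn f) ls, r) \<in> R" by metis
  have f: "f \<in> defined R" using rule_minar w by blast
  have *: "min_noncomp f (take ?k vs)" if "?k \<le> length vs" "trm (apps (Fn f) vs)" "\<forall>v\<in>set vs. computable v" "\<not> computable (apps (Fn f) vs)" for vs
  proof -
    have e: "apps (Fn f) vs = apps (apps (Fn f) (take ?k vs)) (drop ?k vs)"
      using append_take_drop_id[of ?k vs] by (metis foldl_append)
    then have "trm (apps (Fn f) (take ?k vs))" using that(2) trm_apps_head by metis
    moreover have "\<not> computable (apps (Fn f) (take ?k vs))"
      using computable_apps[of "apps (Fn f) (take ?k vs)" "drop ?k vs"] e that in_set_dropD by metis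
    moreover have "\<forall>u\<in>set (take ?k vs). computable u" using that(3) in_set_takeD by fast
    ultimately show ?thesis using f that(1) by (simp add: min_noncomp_def)
  qed
  have "length ws = length (us @ ts)" using w(4) list_all2_lengthD by metis
  then have "min_noncomp f (take ?k (us @ ts))" using w assms(2) by (intro *) auto
  then show ?thesis using f * assms by blast
qed

lemma min_noncomp_step:
  assumes "min_noncomp f us"
  obtains ws ls r \<delta> where "list_all2 rsteps us ws" "(apps (Fn f) ls, r) \<in> R" "is_subst \<Sigma> \<delta>"
    "sdom \<Sigma> \<delta> = Inr ` FMV (apps (Fn f) ls)" "subst \<Sigma> \<delta> (apps (Fn f) ls) = apps (Fn f) ws" "\<not> computable (subst \<Sigma> \<delta> r)"
proof -
  have u: "trm (apps (Fn f) us)" "\<forall>u\<in>set us. computable u" "\<not> computable (apps (Fn f) us)" and l: "length us = minar \<Sigma> R f"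
    using assms by (auto simp: min_noncomp_def)
  from Fn_noncomputable[OF u] obtain ts ws ls r \<delta> where w: "list_all2 rsteps (us @ ts) ws" "(apps (Fn f) ls, r) \<in> R"
    "is_subst \<Sigma> \<delta>" "sdom \<Sigma> \<delta> = Inr ` FMV (apps (Fn f) ls)"
    "subst \<Sigma> \<delta> (apps (Fn f) ls) = apps (Fn f) (take (minar \<Sigma> R f) ws)" "\<not> computable (subst \<Sigma> \<delta> r)" by metis
  \<comment> \<open>The rule takes exactly \<open>minar\<close> arguments, as many as
    \<open>us\<close> has, so the added \<open>ts\<close> lie outside the matched part.\<close>
  have "list_all2 rsteps us (take (minar \<Sigma> R f) ws)"
    using list_all2_takeI[OF w(1), of "length us"] l by simp
  then show thesis using that w by blast
qed

section \<open>Computability of the matching substitution\<close>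

text \<open>Meta-variables keep the values given by the rule, while variables met below binders may
  take any computable value. With both arguments equal it only says that the substitution is well
  typed and computable on variables.\<close>

definition comp_subst where
  "comp_subst \<delta> \<gamma> \<longleftrightarrow> tsubst \<gamma> \<and> (\<forall>x. computable (\<gamma> (Inl x))) \<and> (\<forall>Z. \<gamma> (Inr Z) = \<delta> (Inr Z))"

lemma comp_subst_sdom: "comp_subst \<delta> \<gamma> \<Longrightarrow> Inr Z \<in> sdom \<Sigma> \<gamma> \<longleftrightarrow> Inr Z \<in> sdom \<Sigma> \<delta>"
  by (simp add: comp_subst_def sdom_def)

lemma comp_subst_upd: "comp_subst \<delta> \<gamma> \<Longrightarrow> tm a (vtype \<Sigma> x) \<Longrightarrow> computable a \<Longrightarrow> comp_subst \<delta> (\<gamma>(Inl x := a))"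
  by (auto simp: comp_subst_def tsubst_upd)

text \<open>\<open>K\<close> exposes its argument \<open>i\<close>, applied to \<open>ts\<close>,
  below the variable \<open>w\<close>. It is computable because on computable arguments the result
  is a variable applied to a computable term.\<close>

lemma ex_projection:
  assumes i: "i < length \<sigma>s" and ts: "\<forall>t\<in>set ts. computable t" "list_all2 tm ts \<tau>s" and s: "\<sigma>s ! i = arrows \<tau>s (Sort \<kappa>)"
    and w: "vtype \<Sigma> w = Sort \<kappa> \<rightarrow> Sort \<iota>"
  obtains K where "tm K (arrows \<sigma>s (Sort \<iota>))" "computable K"
    "\<And>as. length as = length \<sigma>s \<Longrightarrow> meta_inst K as = App (Fv w) (apps (as ! i) ts)"
proof -
  let ?m = "length \<sigma>s"
  \<comment> \<open>The index is \<open>?m - 1 - i\<close> because argument 0 belongs to the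
    outermost binder.\<close>
  let ?u = "App (Fv w) (apps (Bd (?m - 1 - i)) ts)"
  let ?K = "foldr Lam \<sigma>s ?u"
  have lts: "\<forall>t\<in>set ts. lc 0 t" using ts computable_trm trm_lc by blast
  have "list_all2 (wt \<Sigma> (rev \<sigma>s @ [])) ts \<tau>s"
    using ts(2) by (rule list_all2_mono) (auto simp: tm_def intro: wt_weaken)
  moreover have "rev \<sigma>s ! (?m - 1 - i) = arrows \<tau>s (Sort \<kappa>)" using i s by (simp add: rev_nth)
  ultimately have "wt \<Sigma> (rev \<sigma>s @ []) ?u (Sort \<iota>)" using i w by (auto simp: wt_apps)
  from wt_foldr_Lam[OF this] have K: "tm ?K (arrows \<sigma>s (Sort \<iota>))"
    using list_all2_in_set1[OF ts(2)] by (auto simp: tm_def)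
  have m: "meta_inst ?K as = App (Fv w) (apps (as ! i) ts)" if "length as = ?m" for as
  proof -
    have "map (inst 0 as) ts = ts" using lts inst_lc[of 0] by (intro map_idI) auto
    moreover have "?m - 1 - i < length as" "rev as ! (?m - 1 - i) = as ! i" using that i by (auto simp: rev_nth)
    ultimately show ?thesis using meta_inst_foldr[OF that, of ?u] by simp
  qed
  have "computable ?K"
  proof (rule ccontr)
    assume "\<not> computable ?K"
    then have "\<not> comp_at (arrows \<sigma>s (Sort \<iota>)) ?K" using comp_at_computable by blast
    from not_comp_at_expand[OF K this] obtain as where as: "\<forall>a\<in>set as. computable a" "tm (apps ?K as) (Sort \<iota>)" "apps ?K as \<notin> C \<iota>" by auto
    have a: "length as \<le> ?m" "arrows \<sigma>s (Sort \<iota>) = arrows (take (length as) \<sigma>s) (Sort \<iota>)" "list_all2 tm as (take (length as) \<sigma>s)"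
      using tm_apps_args[OF as(2) K] by auto
    have l: "length as = ?m" using arg_cong[OF a(2), of "\<lambda>t. length (ty_args t)"] a(1) by simp
    then have ai: "tm (as ! i) (arrows \<tau>s (Sort \<kappa>))" using a(3) i s by (auto simp: list_all2_conv_all_nth)
    have t1: "tm (apps (as ! i) ts) (Sort \<kappa>)" using ai ts(2) by (auto simp: tm_apps)
    then have "tm (App (Fv w) (apps (as ! i) ts)) (Sort \<iota>)" using w by (auto simp: tm_App)
    moreover have "computable (apps (as ! i) ts)" using as(1) ts(1) l i t1 by (intro computable_apps) (auto simp: trm_def)
    ultimately have "computable (App (Fv w) (apps (as ! i) ts))" using computable_App[OF computable_Fv] by (auto simp: trm_def)
    then have "computable (apps ?K as)"
      using computable_meta_inst[of ?K as] m[OF l] as computable_SN by (auto simp: trm_def)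
    then show False using computable_comp_at[OF _ as(2)] as(3) by simp
  qed
  then show thesis using that[OF K _ m] by blast
qed

text \<open>The hypothesis is kept for all computable values of the variables: below a binder the
  bound variable becomes free, and below a variable the head itself has to be instantiated.\<close>

lemma acc_subterm_computable:
  "acc_subterm \<Sigma> ge s t \<Longrightarrow> wt \<Sigma> [] s \<tau> \<Longrightarrow> \<forall>Z\<in>FMV s. Inr Z \<in> sdom \<Sigma> \<delta> \<Longrightarrow>
   (\<And>\<gamma>. comp_subst \<delta> \<gamma> \<Longrightarrow> computable (subst \<Sigma> \<gamma> s)) \<Longrightarrow>
   (\<exists>\<tau>'. wt \<Sigma> [] t \<tau>') \<and> (\<forall>\<gamma>. comp_subst \<delta> \<gamma> \<longrightarrow> computable (subst \<Sigma> \<gamma> t))"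
proof (induct arbitrary: \<tau> rule: acc_subterm.induct)
  case (1 s)
  then show ?case by blast
next
  case (2 s t x)
  obtain \<tau>' where w: "wt \<Sigma> [] s \<tau>'" using 2(1) by (auto simp: is_mterm_iff)
  have F: "\<forall>Z\<in>FMV s. Inr Z \<in> sdom \<Sigma> \<delta>" using 2(5) by (simp add: lam_def)
  have "computable (subst \<Sigma> \<gamma> s)" if g: "comp_subst \<delta> \<gamma>" for \<gamma>
  proof -
    have ts: "tsubst \<gamma>" and gx: "tm (\<gamma> (Inl x)) (vtype \<Sigma> x)" "computable (\<gamma> (Inl x))" using g by (auto simp: comp_subst_def tsubst_def)
    have c: "computable (subst \<Sigma> \<gamma> (lam \<Sigma> x s))" using 2(6) g .
    let ?b = "subst \<Sigma> \<gamma> (close x 0 s)"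
    have "wt \<Sigma> [vtype \<Sigma> x] ?b \<tau>'" using wt_tsubst[OF ts wt_close[OF w, of x]] by simp
    moreover have "FMV (Lam (vtype \<Sigma> x) ?b) = {}" using computable_trm[OF c] by (auto simp: trm_def tm_def lam_def)
    ultimately have t: "tm (App (Lam (vtype \<Sigma> x) ?b) (\<gamma> (Inl x))) \<tau>'" using gx by (auto simp: tm_def)
    then have "computable (App (Lam (vtype \<Sigma> x) ?b) (\<gamma> (Inl x)))" using c gx by (intro computable_App) (auto simp: lam_def trm_def)
    then have "computable (inst 0 [\<gamma> (Inl x)] ?b)" using computable_step[OF _ rstep_beta[OF t]] by blast
    moreover have "inst 0 [\<gamma> (Inl x)] ?b = subst \<Sigma> \<gamma> s"
      using inst_subst_close[OF tsubst_lc[OF ts] tm_lc[OF gx(1)], of 0 s x] wt_lc[OF w] by simp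
    ultimately show ?thesis by simp
  qed
  then show ?case using 2(3)[OF w F] by blast
next
  case (3 i f ss t)
  have i: "1 \<le> i" "i - 1 < length ss" "ge_pos ge (ty_res (ftype \<Sigma> f)) (ty_args (ftype \<Sigma> f) ! (i - 1))"
    using 3(1,2) by (auto simp: Acc_fun_def Let_def)
  let ?s = "ss ! (i - 1)"
  obtain \<sigma>s where s: "ftype \<Sigma> f = arrows \<sigma>s \<tau>" "list_all2 (wt \<Sigma> []) ss \<sigma>s" using 3(5) by (auto simp: wt_apps)
  have w: "wt \<Sigma> [] ?s (\<sigma>s ! (i - 1))" using s(2) i by (auto simp: list_all2_conv_all_nth)
  have F: "\<forall>Z\<in>FMV ?s. Inr Z \<in> sdom \<Sigma> \<delta>" using 3(6) i by auto
  have "computable (subst \<Sigma> \<gamma> ?s)" if g: "comp_subst \<delta> \<gamma>" for \<gamma>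
  proof -
    let ?ss = "map (subst \<Sigma> \<gamma>) ss"
    have c: "computable (apps (Fn f) ?ss)" using 3(7)[OF g] by simp
    have "wt \<Sigma> [] (subst \<Sigma> \<gamma> (apps (Fn f) ss)) \<tau>" using wt_tsubst 3(5) g unfolding comp_subst_def by blast
    then have t: "tm (apps (Fn f) ?ss) \<tau>" using computable_trm[OF c] by (auto simp: trm_def tm_def)
    \<comment> \<open>Accessible arguments are guaranteed to be computable by base-type terms only,
      so missing arguments are supplied as variables.\<close>
    from ex_var_args[OF t] obtain xs where x: "tm (apps (Fn f) (?ss @ map Fv xs)) (Sort (ty_res \<tau>))" by auto
    then have "computable (apps (apps (Fn f) ?ss) (map Fv xs))" using computable_apps[OF c, of "map Fv xs"] by (auto simp: trm_def)
    then have "apps (Fn f) (?ss @ map Fv xs) \<in> C (ty_res \<tau>)" using computable_comp_at[OF _ x] by simp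
    from C_Fn[OF this rtranclp.rtrancl_refl, of "i - 1"] i s(1)
    show ?thesis by (auto simp: nth_append intro: comp_at_computable)
  qed
  then show ?case using 3(4)[OF w F] by blast
next
  case (4 i x ss t)
  let ?i = "i - 1" let ?\<sigma>s = "ty_args (vtype \<Sigma> x)" let ?\<iota> = "ty_res (vtype \<Sigma> x)"
  let ?\<tau>s = "ty_args (?\<sigma>s ! ?i)" let ?\<kappa> = "ty_res (?\<sigma>s ! ?i)"
  have i: "1 \<le> i" "?i < length ss" "?i < length ?\<sigma>s" "ge ?\<iota> ?\<kappa>"
    using 4(1,2) by (auto simp: Acc_var_def Let_def)
  let ?s = "ss ! ?i"
  obtain \<sigma>s where s: "vtype \<Sigma> x = arrows \<sigma>s \<tau>" "list_all2 (wt \<Sigma> []) ss \<sigma>s" using 4(6) by (auto simp: wt_apps)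
  have l: "length ss = length \<sigma>s" using s(2) by (rule list_all2_lengthD)
  have w: "wt \<Sigma> [] ?s (?\<sigma>s ! ?i)" using s i l by (auto simp: list_all2_conv_all_nth nth_append)
  have F: "\<forall>Z\<in>FMV ?s. Inr Z \<in> sdom \<Sigma> \<delta>" using 4(7) i by auto
  have "computable (subst \<Sigma> \<gamma> ?s)" if g: "comp_subst \<delta> \<gamma>" for \<gamma>
  proof (rule ccontr)
    assume n: "\<not> computable (subst \<Sigma> \<gamma> ?s)"
    have ts: "tsubst \<gamma>" using g by (simp add: comp_subst_def)
    have tm: "tm (subst \<Sigma> \<gamma> ?s) (?\<sigma>s ! ?i)" using F comp_subst_sdom[OF g] by (intro tm_subst[OF ts w]) auto
    have "\<not> comp_at (?\<sigma>s ! ?i) (subst \<Sigma> \<gamma> ?s)" using n comp_at_computable by blast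
    from not_comp_at_expand[OF tm this] obtain ts where t: "\<forall>t\<in>set ts. computable t" "tm (apps (subst \<Sigma> \<gamma> ?s) ts) (Sort ?\<kappa>)"
      "apps (subst \<Sigma> \<gamma> ?s) ts \<notin> C ?\<kappa>" by auto
    let ?ts = "take (length ts) ?\<tau>s"
    have tt: "list_all2 tm ts ?ts" "?\<sigma>s ! ?i = arrows ?ts (Sort ?\<kappa>)" using tm_apps_args[OF t(2) tm] by auto
    obtain w where w: "vtype \<Sigma> w = Sort ?\<kappa> \<rightarrow> Sort ?\<iota>" using fresh[of "{}"] by auto
    obtain K where K: "tm K (arrows ?\<sigma>s (Sort ?\<iota>))" "computable K"
      "\<And>as. length as = length ?\<sigma>s \<Longrightarrow> meta_inst K as = App (Fv w) (apps (as ! ?i) ts)"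
      using ex_projection[OF i(3) t(1) tt w] by blast
    \<comment> \<open>The head variable receives the projection onto the accessible argument,
      already applied to the arguments \<open>ts\<close> that refute its computability.\<close>
    define \<gamma>' where "\<gamma>' = \<gamma>(Inl x := K)"
    have gx: "\<gamma>' (Inl x) = K" by (simp add: \<gamma>'_def)
    have g': "comp_subst \<delta> \<gamma>'" using comp_subst_upd[OF g] K by (simp add: \<gamma>'_def)
    have c: "computable (apps K (map (subst \<Sigma> \<gamma>') ss))" using 4(8)[OF g'] gx by simp
    have "wt \<Sigma> [] (subst \<Sigma> \<gamma>' (apps (Fv x) ss)) \<tau>" using wt_tsubst 4(6) g' unfolding comp_subst_def by blast
    then have tK: "tm (apps K (map (subst \<Sigma> \<gamma>') ss)) \<tau>" using computable_trm[OF c] gx by (auto simp: trm_def tm_def)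
    from ex_var_args[OF tK] obtain xs where x: "tm (apps K (map (subst \<Sigma> \<gamma>') ss @ map Fv xs)) (Sort (ty_res \<tau>))" by auto
    let ?as = "map (subst \<Sigma> \<gamma>') ss @ map Fv xs"
    have r: "ty_res \<tau> = ?\<iota>" using s(1) by simp
    have cK: "computable (apps K ?as)" using computable_apps[OF c, of "map Fv xs"] x by (auto simp: trm_def)
    have la: "length ?as = length ?\<sigma>s"
    proof -
      have *: "length ?as \<le> length ?\<sigma>s" "arrows ?\<sigma>s (Sort ?\<iota>) = arrows (take (length ?as) ?\<sigma>s) (Sort ?\<iota>)"
        using tm_apps_args[OF x K(1)] r by auto
      show ?thesis using arg_cong[OF *(2), of "\<lambda>t. length (ty_args t)"] *(1) by simp
    qed
    \<comment> \<open>The arguments of \<open>ss\<close> are not known to be computable, but as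
      arguments within a computable term they terminate, which suffices for contracting
      \<open>K\<close>.\<close>
    have sn: "SN a" if "a \<in> set ?as" for a
    proof (cases "a \<in> set (map Fv xs)")
      case True
      then show ?thesis using computable_SN by auto
    next
      case False
      then have "a \<in> set (map (subst \<Sigma> \<gamma>') ss)" using that by simp
      then show ?thesis using SN_apps_arg[OF computable_SN[OF c] computable_trm[OF c]] by blast
    qed
    have "computable (meta_inst K ?as)" using computable_meta_inst[OF computable_trm[OF cK]] cK sn by blast
    \<comment> \<open>Accessibility requires that \<open>x\<close> is not free in the argument, so
      the changed value at \<open>x\<close> does not affect it.\<close>
    moreover have "?as ! ?i = subst \<Sigma> \<gamma> ?s"
      using i 4(3) by (auto simp: nth_append \<gamma>'_def intro!: subst_cong)
    ultimately have d: "computable (App (Fv w) (apps (subst \<Sigma> \<gamma> ?s) ts))" using K(3)[OF la] by simp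
    then have "tm (App (Fv w) (apps (subst \<Sigma> \<gamma> ?s) ts)) (Sort ?\<iota>)"
      using computable_trm[OF d] w by (auto simp: trm_def tm_App)
    then have "App (Fv w) (apps (subst \<Sigma> \<gamma> ?s) ts) \<in> C ?\<iota>" using computable_comp_at[OF d] by fastforce
    from C_Fv[OF this rtranclp.rtrancl_refl w i(4)] t(3) show False by simp
  qed
  then show ?case using 4(5)[OF w F] by blast
qed

text \<open>Computability of \<open>Z<xs>\<close> under all computable values of \<open>xs\<close>
  is computability of the value of \<open>Z\<close> on all computable arguments. A refuting argument
  list for that value is therefore turned into values of \<open>xs\<close>.\<close>

lemma rule_subst_computable:
  assumes r: "(apps (Fn f) ls, r) \<in> R" and d: "is_subst \<Sigma> \<delta>" "sdom \<Sigma> \<delta> = Inr ` FMV (apps (Fn f) ls)"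
    and c: "\<forall>l\<in>set ls. computable (subst \<Sigma> \<delta> l)" and Z: "Z \<in> FMV r"
  shows "computable (\<delta> (Inr Z))"
proof -
  obtain l xs where l: "l \<in> set ls" "acc_subterm \<Sigma> ge l (Meta Z (map Fv xs))" using afp[OF r Z] by blast
  obtain \<tau> where rl: "wt \<Sigma> [] (apps (Fn f) ls) \<tau>" "FV (apps (Fn f) ls) = {}" "pattern \<Sigma> (apps (Fn f) ls)" "FMV r \<subseteq> FMV (apps (Fn f) ls)"
    using ruleD[OF r] by metis
  obtain \<sigma>s where "list_all2 (wt \<Sigma> []) ls \<sigma>s" using rl(1) by (auto simp: wt_apps)
  from list_all2_in_set1[OF this l(1)] obtain \<sigma> where wl: "wt \<Sigma> [] l \<sigma>" by auto
  have td: "tsubst \<delta>" using d is_subst_iff by simp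
  have F: "\<forall>Y\<in>FMV l. Inr Y \<in> sdom \<Sigma> \<delta>" using d(2) l(1) by auto
  have "computable (subst \<Sigma> \<gamma> l)" if "comp_subst \<delta> \<gamma>" for \<gamma>
  proof -
    have "subst \<Sigma> \<gamma> l = subst \<Sigma> \<delta> l" using that rl(2) l(1) by (intro subst_cong) (auto simp: comp_subst_def)
    then show ?thesis using c l(1) by simp
  qed
  from acc_subterm_computable[OF l(2) wl F this] obtain \<tau>' where
    m: "wt \<Sigma> [] (Meta Z (map Fv xs)) \<tau>'" "\<And>\<gamma>. comp_subst \<delta> \<gamma> \<Longrightarrow> computable (subst \<Sigma> \<gamma> (Meta Z (map Fv xs)))" by blast
  have "meta_linear l" using pattern_lc_linear[OF rl(3)] l(1) by simp
  then have dx: "distinct xs" using acc_subterm_linear[OF l(2)] by (auto simp: distinct_map)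
  have Zd: "Inr Z \<in> sdom \<Sigma> \<delta>" using Z rl(4) d(2) by auto
  then have tZ: "tm (\<delta> (Inr Z)) (mtype \<Sigma> Z)" using td by (simp add: tsubst_def)
  obtain \<rho>s where p: "mtype \<Sigma> Z = arrows \<rho>s \<tau>'" "list_all2 (wt \<Sigma> []) (map Fv xs) \<rho>s" using m(1) by auto
  show ?thesis
  proof (rule ccontr)
    assume "\<not> computable (\<delta> (Inr Z))"
    then have "\<not> comp_at (mtype \<Sigma> Z) (\<delta> (Inr Z))" using comp_at_computable by blast
    from not_comp_at_expand[OF tZ this] obtain as where as: "\<forall>a\<in>set as. computable a"
      "tm (apps (\<delta> (Inr Z)) as) (Sort (ty_res (mtype \<Sigma> Z)))" "apps (\<delta> (Inr Z)) as \<notin> C (ty_res (mtype \<Sigma> Z))" by auto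
    have t: "length as \<le> length (ty_args (mtype \<Sigma> Z))"
       "mtype \<Sigma> Z = arrows (take (length as) (ty_args (mtype \<Sigma> Z))) (Sort (ty_res (mtype \<Sigma> Z)))"
       "list_all2 tm as (take (length as) (ty_args (mtype \<Sigma> Z)))"
      using tm_apps_args[OF as(2) tZ] by auto
    have la: "length as = length (ty_args (mtype \<Sigma> Z))"
      using arg_cong[OF t(2), of "\<lambda>t. length (ty_args t)"] t(1) by simp
    have lx: "length xs = length \<rho>s" using list_all2_lengthD[OF p(2)] by simp
    then have le: "length xs \<le> length as" using la p(1) by simp
    let ?as = "take (length xs) as"
    \<comment> \<open>Distinctness of \<open>xs\<close> makes this assignment of refuting arguments
      to variables well defined.\<close>
    define \<gamma> where "\<gamma> = (\<lambda>a. case a of Inl x \<Rightarrow> (case map_of (zip xs ?as) x of None \<Rightarrow> Fv x | Some a \<Rightarrow> a) | Inr Y \<Rightarrow> \<delta> (Inr Y))"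
    have gi: "\<gamma> (Inl (xs ! i)) = as ! i" if "i < length xs" for i
    proof -
      have "map_of (zip xs ?as) (xs ! i) = Some (?as ! i)" using that le by (intro map_of_zip_nth dx) auto
      then show ?thesis using that by (simp add: \<gamma>_def)
    qed
    have gm: "computable (\<gamma> (Inl x)) \<and> tm (\<gamma> (Inl x)) (vtype \<Sigma> x)" for x
    proof (cases "x \<in> set xs")
      case True
      then obtain i where i: "i < length xs" "x = xs ! i" by (auto simp: in_set_conv_nth)
      have "tm (as ! i) (ty_args (mtype \<Sigma> Z) ! i)" using t(3) i le la by (auto simp: list_all2_conv_all_nth)
      moreover have "ty_args (mtype \<Sigma> Z) ! i = \<rho>s ! i" using p(1) i lx by (simp add: nth_append)
      moreover have "vtype \<Sigma> x = \<rho>s ! i" using p(2) i by (auto simp: list_all2_conv_all_nth)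
      moreover have "computable (as ! i)" using as(1) i le by simp
      ultimately show ?thesis using gi[OF i(1)] i(2) by simp
    next
      case False
      then have "map_of (zip xs ?as) x = None" using le by (simp add: map_of_zip_is_None)
      then show ?thesis by (simp add: \<gamma>_def)
    qed
    have sd: "Inr Y \<in> sdom \<Sigma> \<gamma> \<longleftrightarrow> Inr Y \<in> sdom \<Sigma> \<delta>" for Y by (simp add: sdom_def \<gamma>_def)
    have gZ: "\<gamma> (Inr Y) = \<delta> (Inr Y)" for Y by (simp add: \<gamma>_def)
    have "comp_subst \<delta> \<gamma>" unfolding comp_subst_def tsubst_def using gm td sd gZ by (auto simp: tsubst_def)
    from m(2)[OF this] have "computable (meta_inst (\<delta> (Inr Z)) (map (\<lambda>x. \<gamma> (Inl x)) xs))"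
      using sd Zd gZ by (simp add: o_def)
    moreover have "map (\<lambda>x. \<gamma> (Inl x)) xs = ?as" using gi le by (intro nth_equalityI) auto
    ultimately have "computable (meta_inst (\<delta> (Inr Z)) ?as)" by simp
    \<comment> \<open>The list \<open>as\<close> goes on to base type and may be longer than
      \<open>xs\<close>; the surplus is applied after the instance.\<close>
    moreover have e: "apps (\<delta> (Inr Z)) as = apps (apps (\<delta> (Inr Z)) ?as) (drop (length xs) as)"
      by (metis append_take_drop_id foldl_append)
    moreover have "trm (apps (\<delta> (Inr Z)) as)" using as(2) by (auto simp: trm_def)
    moreover from this have "trm (apps (\<delta> (Inr Z)) ?as)" unfolding e by (rule trm_apps_head)
    moreover have "\<forall>a\<in>set ?as. SN a" using as(1) computable_SN by (auto dest: in_set_takeD)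
    ultimately have "computable (apps (\<delta> (Inr Z)) ?as)" using computable_meta_inst by blast
    moreover have "\<forall>a\<in>set (drop (length xs) as). computable a" using as(1) by (auto dest: in_set_dropD)
    ultimately have "computable (apps (\<delta> (Inr Z)) as)" using computable_apps e \<open>trm (apps (\<delta> (Inr Z)) as)\<close> by metis
    then show False using computable_comp_at[OF _ as(2)] as(3) by simp
  qed
qed

end

context static_dp
begin

section \<open>Descent to a candidate\<close>

text \<open>All conditions within the arities that \<gamma> satisfies. The descent works with this
  whole set and it is reduced to a minimal one afterwards; the bound by the arity makes it finite
  for a finite domain.\<close>

definition conds where
  "conds \<gamma> = {(Z, i). Inr Z \<in> sdom \<Sigma> \<gamma> \<and> 1 \<le> i \<and> i \<le> arity \<Sigma> Z \<and> needs (i - 1) (\<gamma> (Inr Z))}"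

lemma conds_comp_subst: "comp_subst \<delta> \<gamma> \<Longrightarrow> conds \<gamma> = conds \<delta>"
  using comp_subst_sdom[of \<delta> \<gamma>] by (auto simp: conds_def comp_subst_def)

lemma comp_subst_trans: "comp_subst \<delta> \<gamma> \<Longrightarrow> comp_subst \<gamma> \<gamma>' \<Longrightarrow> comp_subst \<delta> \<gamma>'"
  by (simp add: comp_subst_def)

text \<open>If every non-computable argument were irrelevant to the instance, replacing these
  arguments by variables would give the same instance from computable arguments only.\<close>

lemma Meta_noncomputable:
  assumes t: "tm t (arrows \<sigma>s \<tau>)" "computable t" "list_all2 tm ss \<sigma>s" "\<not> computable (meta_inst t ss)"
  shows "\<exists>j<length ss. needs j t \<and> \<not> computable (ss ! j)"
proof (rule ccontr)
  assume a: "\<not> ?thesis"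
  have l: "length ss = length \<sigma>s" using t(3) by (rule list_all2_lengthD)
  define x where "x \<sigma> = (SOME x. vtype \<Sigma> x = \<sigma>)" for \<sigma>
  have x: "vtype \<Sigma> (x \<sigma>) = \<sigma>" for \<sigma>
    unfolding x_def using fresh[of "{}" \<sigma>] by (auto intro: someI_ex)
  define ss' where "ss' = map (\<lambda>j. if computable (ss ! j) then ss ! j else Fv (x (\<sigma>s ! j))) [0..<length ss]"
  have e: "meta_inst t ss = meta_inst t ss'"
    using a by (intro meta_inst_cong) (auto simp: ss'_def)
  have "list_all2 tm ss' \<sigma>s"
    using t(3) x l by (auto simp: list_all2_conv_all_nth ss'_def)
  then have T: "trm (apps t ss')" using t(1) by (auto simp: trm_def tm_apps)
  have c: "\<forall>s\<in>set ss'. computable s" by (auto simp: ss'_def)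
  then have "computable (apps t ss')" using computable_apps[OF t(2) _ T] by blast
  moreover have "\<forall>s\<in>set ss'. SN s" using c computable_SN by blast
  ultimately have "computable (meta_inst t ss')" using computable_meta_inst[OF T] by blast
  then show False using e t(4) by simp
qed

text \<open>
  The environment \<open>rs\<close> interprets the dangling indices of \<open>s\<close>. Contracting a \<open>\<beta>\<close>-redex just extends
  \<open>rs\<close>, so the induction is structural and termination of \<open>\<beta>\<close> on meta-terms is not needed. The second
  alternative for \<open>k\<close> serves to find a first minimal non-computable term in a term that need not be
  properly applied.
\<close>

lemma noncomputable_candidate:
  fixes k :: "'a \<Rightarrow> nat"
  assumes k: "(\<forall>f\<in>defined R. minar \<Sigma> R f \<le> k f) \<or> (\<nexists>f us. min_noncomp f us)"
  shows "comp_subst \<gamma> \<gamma> \<Longrightarrow> wt \<Sigma> [] (apps (inst 0 rs s) us) \<tau> \<Longrightarrow> min_args k n s \<Longrightarrow> n \<le> length us \<Longrightarrow>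
    \<forall>r\<in>set rs. lc 0 r \<and> computable (subst \<Sigma> \<gamma> r) \<Longrightarrow> \<forall>u\<in>set us. computable (subst \<Sigma> \<gamma> u) \<Longrightarrow>
    \<forall>Z\<in>FMV (apps (inst 0 rs s) us). Inr Z \<in> sdom \<Sigma> \<gamma> \<and> computable (\<gamma> (Inr Z)) \<Longrightarrow>
    \<not> computable (subst \<Sigma> \<gamma> (apps (inst 0 rs s) us)) \<Longrightarrow>
    \<exists>\<gamma>' f ts vs. comp_subst \<gamma> \<gamma>' \<and> beta_subterm \<Sigma> (conds \<gamma>) (apps (inst 0 rs s) us) (apps (Fn f) (ts @ vs)) \<and>
      min_noncomp f (map (subst \<Sigma> \<gamma>') ts)"
proof (induct s arbitrary: \<gamma> rs us \<tau> n)
  case (Bd i)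
  have g: "tsubst \<gamma>" using Bd(1) by (simp add: comp_subst_def)
  obtain \<tau>' where "wt \<Sigma> [] (inst 0 rs (Bd i)) \<tau>'" using Bd(2) by (auto simp: wt_apps)
  then have "i < length rs" by (auto split: if_splits)
  then have "rev rs ! i \<in> set rs" "inst 0 rs (Bd i) = rev rs ! i" by (auto simp: rev_nth_mem)
  then have "computable (subst \<Sigma> \<gamma> (inst 0 rs (Bd i)))" using Bd(5) by simp
  moreover have "trm (subst \<Sigma> \<gamma> (apps (inst 0 rs (Bd i)) us))" using tm_subst[OF g Bd(2)] Bd(7) by (auto simp: trm_def)
  ultimately have False using computable_apps[of "subst \<Sigma> \<gamma> (inst 0 rs (Bd i))" "map (subst \<Sigma> \<gamma>) us"] Bd(6,8) by auto
  then show ?case ..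
next
  case (Fv x)
  have g: "tsubst \<gamma>" "computable (\<gamma> (Inl x))" using Fv(1) by (auto simp: comp_subst_def)
  moreover have "trm (subst \<Sigma> \<gamma> (apps (inst 0 rs (Fv x)) us))" using tm_subst[OF g(1) Fv(2)] Fv(7) by (auto simp: trm_def)
  ultimately have False using computable_apps[of "\<gamma> (Inl x)" "map (subst \<Sigma> \<gamma>) us"] Fv(6,8) by auto
  then show ?case ..
next
  case (Fn f)
  have g: "tsubst \<gamma>" using Fn(1) by (auto simp: comp_subst_def)
  let ?us = "map (subst \<Sigma> \<gamma>) us" let ?k = "minar \<Sigma> R f"
  have "trm (apps (Fn f) ?us)" using tm_subst[OF g(1) Fn(2)] Fn(7) by (auto simp: trm_def)
  from Fn_min_noncomp[OF this] have f: "f \<in> defined R" "\<exists>vs. min_noncomp f vs" "?k \<le> length us \<Longrightarrow> min_noncomp f (take ?k ?us)"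
    using Fn(6,8) by auto
  \<comment> \<open>The second alternative for \<open>k\<close> contradicts the minimal term just
    obtained, so the bound holds in either case.\<close>
  then have "?k \<le> k f" using k by blast
  then have "?k \<le> length us" using Fn(3,4) by simp
  then have "min_noncomp f (map (subst \<Sigma> \<gamma>) (take ?k us))" using f(3) by (simp add: take_map)
  moreover have "beta_subterm \<Sigma> (conds \<gamma>) (apps (inst 0 rs (Fn f)) us) (apps (Fn f) (take ?k us @ drop ?k us))"
    using beta_subterm.intros(1) by simp
  ultimately show ?case using Fn(1) by blast
next
  case (App s t)
  let ?t = "inst 0 rs t"
  have g: "tsubst \<gamma>" using App(3) by (auto simp: comp_subst_def)
  have e: "apps (inst 0 rs (App s t)) us = apps (inst 0 rs s) (?t # us)" by simp
  show ?case
  proof (cases "computable (subst \<Sigma> \<gamma> ?t)")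
    \<comment> \<open>A computable argument joins \<open>us\<close>, and the head then has one more
      argument in view, hence \<open>Suc n\<close>.\<close>
    case True
    show ?thesis unfolding e
    proof (rule App(1))
      show "wt \<Sigma> [] (apps (inst 0 rs s) (?t # us)) \<tau>" using App(4) by simp
      show "min_args k (Suc n) s" using App(5) by simp
    qed (use App True in auto)
  next
    case False
    obtain \<sigma> where t: "wt \<Sigma> [] ?t \<sigma>" using App(4) unfolding e wt_apps by (auto simp: list_all2_Cons1)
    have "\<exists>\<gamma>' f ts vs. comp_subst \<gamma> \<gamma>' \<and> beta_subterm \<Sigma> (conds \<gamma>) (apps ?t []) (apps (Fn f) (ts @ vs)) \<and>
      min_noncomp f (map (subst \<Sigma> \<gamma>') ts)"
    proof (rule App(2))
      show "wt \<Sigma> [] (apps ?t []) \<sigma>" using t by simp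
      show "min_args k 0 t" using App(5) by simp
    qed (use App(3,7,9) False in auto)
    then obtain \<gamma>' f ts vs where r: "comp_subst \<gamma> \<gamma>'" "beta_subterm \<Sigma> (conds \<gamma>) ?t (apps (Fn f) (ts @ vs))"
      "min_noncomp f (map (subst \<Sigma> \<gamma>') ts)" by auto
    \<comment> \<open>The environment may have put an application in the place of the head, so the
      spine is computed anew before the argument is reached.\<close>
    obtain h hs where h: "inst 0 rs s = apps h hs" "\<not> is_App h" using ex_head by blast
    have e': "apps (inst 0 rs (App s t)) us = apps h (hs @ ?t # us)" using h by simp
    have "is_mterm \<Sigma> h" using App(4) unfolding e' by (auto simp: is_mterm_iff wt_apps)
    then have "beta_subterm \<Sigma> (conds \<gamma>) (apps h (hs @ ?t # us)) (apps (Fn f) (ts @ vs))"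
      using r(2) h(2) by (intro beta_subterm_arg) auto
    then show ?thesis using r unfolding e' by blast
  qed
next
  case (Lam \<sigma> b)
  let ?b = "inst 1 rs b"
  have g: "tsubst \<gamma>" using Lam(2) by (auto simp: comp_subst_def)
  have lr: "\<forall>r\<in>set rs. lc 0 r" using Lam(6) by blast
  have op: "inst 0 [a] ?b = inst 0 (rs @ [a]) b" for a using inst_append[OF lr, of 0 "[a]" b] by simp
  have L: "inst 0 rs (Lam \<sigma> b) = Lam \<sigma> ?b" by simp
  obtain \<tau>L where "wt \<Sigma> [] (Lam \<sigma> ?b) \<tau>L" using Lam(3) unfolding L wt_apps by blast
  then obtain \<tau>b where wb: "wt \<Sigma> [\<sigma>] ?b \<tau>b" by auto
  then have wL: "wt \<Sigma> [] (Lam \<sigma> ?b) (\<sigma> \<rightarrow> \<tau>b)" by simp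
  then have mL: "is_mterm \<Sigma> (Lam \<sigma> ?b)" unfolding is_mterm_iff by blast
  have FL: "\<forall>Z\<in>FMV ?b. Inr Z \<in> sdom \<Sigma> \<gamma> \<and> computable (\<gamma> (Inr Z))" using Lam(8) by simp
  have tL: "tm (subst \<Sigma> \<gamma> (Lam \<sigma> ?b)) (\<sigma> \<rightarrow> \<tau>b)" using FL by (intro tm_subst[OF g wL]) simp
  show ?case
  proof (cases us)
    case Nil
    then have "\<not> computable (Lam \<sigma> (subst \<Sigma> \<gamma> ?b))" using Lam(9) by simp
    then have "\<not> comp_at (\<sigma> \<rightarrow> \<tau>b) (Lam \<sigma> (subst \<Sigma> \<gamma> ?b))" using comp_at_computable by blast
    then obtain a where a: "comp_at \<sigma> a" "\<not> comp_at \<tau>b (inst 0 [a] (subst \<Sigma> \<gamma> ?b))"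
      using comp_at_Lam[OF tL[unfolded subst.simps]] by blast
    let ?S = "FV ?b \<union> (\<Union>r\<in>set rs. FV r)"
    obtain x where x: "vtype \<Sigma> x = \<sigma>" "x \<notin> ?S" using fresh[of ?S \<sigma>] by (meson List.finite_set finite_FV finite_UN finite_Un)
    \<comment> \<open>The argument that refutes the abstraction becomes the value of a fresh
      variable. Thus the descent continues in a meta-term, and the non-computable term remains its
      instance.\<close>
    define \<gamma>' where "\<gamma>' = \<gamma>(Inl x := a)"
    have ta: "tm a \<sigma>" using comp_at_tm[OF a(1)] .
    have g': "comp_subst \<gamma> \<gamma>'" unfolding \<gamma>'_def using Lam(2) ta comp_at_computable[OF a(1)] x by (intro comp_subst_upd) auto
    then have gg: "comp_subst \<gamma>' \<gamma>'" by (simp add: comp_subst_def)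
    have sr: "subst \<Sigma> \<gamma>' r = subst \<Sigma> \<gamma> r" if "r \<in> set rs" for r
      using that x(2) by (intro subst_cong) (auto simp: \<gamma>'_def)
    have e: "inst 0 [a] (subst \<Sigma> \<gamma> ?b) = subst \<Sigma> \<gamma>' (inst 0 (rs @ [Fv x]) b)"
      using subst_inst_fresh[OF tsubst_lc[OF g] tm_lc[OF ta], of x ?b 0] x(2) op by (simp add: \<gamma>'_def)
    have wbx: "wt \<Sigma> [] (inst 0 (rs @ [Fv x]) b) \<tau>b"
      using wt_inst0[of \<Sigma> "[\<sigma>]" ?b \<tau>b "[Fv x]"] wb x(1) op by simp
    have Fx: "\<forall>Z\<in>FMV (inst 0 (rs @ [Fv x]) b). Inr Z \<in> sdom \<Sigma> \<gamma> \<and> computable (\<gamma> (Inr Z))"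
      using FL FMV_inst[of 0 "[Fv x]" ?b] op by auto
    have "\<exists>\<gamma>'' f ts vs. comp_subst \<gamma>' \<gamma>'' \<and> beta_subterm \<Sigma> (conds \<gamma>') (apps (inst 0 (rs @ [Fv x]) b) []) (apps (Fn f) (ts @ vs)) \<and>
      min_noncomp f (map (subst \<Sigma> \<gamma>'') ts)"
    proof (rule Lam(1)[OF gg])
      show "wt \<Sigma> [] (apps (inst 0 (rs @ [Fv x]) b) []) \<tau>b" using wbx by simp
      show "min_args k 0 b" using Lam(4) by simp
      show "\<forall>r\<in>set (rs @ [Fv x]). lc 0 r \<and> computable (subst \<Sigma> \<gamma>' r)"
        using Lam(6) sr comp_at_computable[OF a(1)] by (auto simp: \<gamma>'_def)
      show "\<forall>Z\<in>FMV (apps (inst 0 (rs @ [Fv x]) b) []). Inr Z \<in> sdom \<Sigma> \<gamma>' \<and> computable (\<gamma>' (Inr Z))"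
        using Fx comp_subst_sdom[OF g'] g' by (simp add: comp_subst_def)
      have "tm (subst \<Sigma> \<gamma>' (inst 0 (rs @ [Fv x]) b)) \<tau>b"
        using Fx comp_subst_sdom[OF g'] g' by (intro tm_subst[OF _ wbx]) (auto simp: comp_subst_def)
      then show "\<not> computable (subst \<Sigma> \<gamma>' (apps (inst 0 (rs @ [Fv x]) b) []))" using a(2) computable_comp_at e by auto
    qed auto
    then obtain \<gamma>'' f ts vs where r: "comp_subst \<gamma>' \<gamma>''" "beta_subterm \<Sigma> (conds \<gamma>) (inst 0 (rs @ [Fv x]) b) (apps (Fn f) (ts @ vs))"
      "min_noncomp f (map (subst \<Sigma> \<gamma>'') ts)" using conds_comp_subst[OF g'] by auto
    have "beta_subterm \<Sigma> (conds \<gamma>) (Lam \<sigma> ?b) (apps (Fn f) (ts @ vs))"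
      using r(2) op[of "Fv x"] x by (intro beta_subterm_Lam[OF mL, of x]) auto
    then show ?thesis using r comp_subst_trans[OF g' r(1)] Nil unfolding L by auto
  next
    case (Cons u us')
    have tw: "tm (subst \<Sigma> \<gamma> (apps (Lam \<sigma> ?b) us)) \<tau>" using tm_subst[OF g Lam(3)[unfolded L]] Lam(8)[unfolded L] by blast
    have lu: "lc 0 u" using Lam(3) wt_lc[of \<Sigma> "[]"] unfolding Cons by fastforce
    have "wt \<Sigma> [] (apps (App (Lam \<sigma> ?b) u) us') \<tau>" using Lam(3) Cons by simp
    then obtain \<sigma>s where s: "wt \<Sigma> [] (App (Lam \<sigma> ?b) u) (arrows \<sigma>s \<tau>)" "list_all2 (wt \<Sigma> []) us' \<sigma>s" unfolding wt_apps by blast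
    then have "wt \<Sigma> [\<sigma>] ?b (arrows \<sigma>s \<tau>)" "wt \<Sigma> [] u \<sigma>" by auto
    then have "wt \<Sigma> [] (inst 0 (rs @ [u]) b) (arrows \<sigma>s \<tau>)" using wt_inst0[of \<Sigma> "[\<sigma>]" ?b _ "[u]"] op by simp
    then have w': "wt \<Sigma> [] (apps (inst 0 (rs @ [u]) b) us') \<tau>" using s(2) unfolding wt_apps by blast
    have cu: "computable (subst \<Sigma> \<gamma> u)" using Lam(7) Cons by simp
    \<comment> \<open>The argument \<open>u\<close> is computable and hence terminates, so
      non-computability passes to the contractum, which is \<open>b\<close> in the environment
      extended by \<open>u\<close>.\<close>
    have "head_beta (subst \<Sigma> \<gamma> (apps (Lam \<sigma> ?b) us)) (subst \<Sigma> \<gamma> (apps (inst 0 [u] ?b) us'))"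
      unfolding head_beta_def Cons using computable_SN[OF cu] subst_inst[OF tsubst_lc[OF g], of 0 "[u]" ?b] by auto
    then have "computable (subst \<Sigma> \<gamma> (apps (Lam \<sigma> ?b) us)) \<longleftrightarrow> computable (subst \<Sigma> \<gamma> (apps (inst 0 [u] ?b) us'))"
      using tw by (intro computable_head_beta) (auto simp: trm_def)
    then have n: "\<not> computable (subst \<Sigma> \<gamma> (apps (inst 0 (rs @ [u]) b) us'))" using Lam(9) op unfolding L by simp
    have "\<exists>\<gamma>' f ts vs. comp_subst \<gamma> \<gamma>' \<and> beta_subterm \<Sigma> (conds \<gamma>) (apps (inst 0 (rs @ [u]) b) us') (apps (Fn f) (ts @ vs)) \<and>
      min_noncomp f (map (subst \<Sigma> \<gamma>') ts)"
    proof (rule Lam(1)[OF Lam(2) w' _ _ _ _ _ n])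
      show "min_args k 0 b" using Lam(4) by simp
      show "\<forall>r\<in>set (rs @ [u]). lc 0 r \<and> computable (subst \<Sigma> \<gamma> r)" using Lam(6) cu lu by auto
      show "\<forall>u\<in>set us'. computable (subst \<Sigma> \<gamma> u)" using Lam(7) Cons by auto
      show "\<forall>Z\<in>FMV (apps (inst 0 (rs @ [u]) b) us'). Inr Z \<in> sdom \<Sigma> \<gamma> \<and> computable (\<gamma> (Inr Z))"
        using Lam(8) FMV_inst[of 0 "[u]" ?b] op unfolding Cons by fastforce
    qed simp
    then obtain \<gamma>' f ts vs where r: "comp_subst \<gamma> \<gamma>'" "beta_subterm \<Sigma> (conds \<gamma>) (apps (inst 0 [u] ?b) us') (apps (Fn f) (ts @ vs))"
      "min_noncomp f (map (subst \<Sigma> \<gamma>') ts)" using op by auto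
    from beta_subterm_contract[OF mL lu r(2)] show ?thesis using r(1,3) unfolding L Cons by blast
  qed
next
  case (Meta Z ts)
  let ?ts = "map (inst 0 rs) ts" let ?T = "map (subst \<Sigma> \<gamma>) ?ts"
  have g: "tsubst \<gamma>" using Meta(2) by (auto simp: comp_subst_def)
  have L: "inst 0 rs (Meta Z ts) = Meta Z ?ts" by simp
  have Z: "Inr Z \<in> sdom \<Sigma> \<gamma>" "computable (\<gamma> (Inr Z))" using Meta(8) by auto
  obtain \<tau>M where "wt \<Sigma> [] (Meta Z ?ts) \<tau>M" using Meta(3) unfolding L wt_apps by blast
  then obtain \<sigma>s where s: "mtype \<Sigma> Z = arrows \<sigma>s \<tau>M" "length \<sigma>s = arity \<Sigma> Z" "list_all2 (wt \<Sigma> []) ?ts \<sigma>s" by auto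
  have FT: "\<forall>Y\<in>FMV t. Inr Y \<in> sdom \<Sigma> \<gamma> \<and> computable (\<gamma> (Inr Y))" if "t \<in> set ?ts" for t using Meta(8) that by auto
  have sT: "list_all2 tm ?T \<sigma>s"
    unfolding list_all2_map1[of _ "subst \<Sigma> \<gamma>"] using s(3)
    by (rule list.rel_mono_strong) (use FT tm_subst[OF g] in blast)
  have tZ: "tm (\<gamma> (Inr Z)) (arrows \<sigma>s \<tau>M)" using g Z s(1) by (auto simp: tsubst_def)
  have tw: "trm (subst \<Sigma> \<gamma> (apps (Meta Z ?ts) us))" using tm_subst[OF g Meta(3)] Meta(8) by (auto simp: trm_def)
  have e: "subst \<Sigma> \<gamma> (apps (Meta Z ?ts) us) = apps (meta_inst (\<gamma> (Inr Z)) ?T) (map (subst \<Sigma> \<gamma>) us)" using Z by simp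
  have "\<not> computable (meta_inst (\<gamma> (Inr Z)) ?T)"
  proof
    assume c: "computable (meta_inst (\<gamma> (Inr Z)) ?T)"
    have "computable (apps (meta_inst (\<gamma> (Inr Z)) ?T) (map (subst \<Sigma> \<gamma>) us))"
      using computable_apps[OF c] Meta(7) tw unfolding e by auto
    then show False using Meta(9) e unfolding L by simp
  qed
  from Meta_noncomputable[OF tZ Z(2) sT this] obtain j where
    j: "j < length ts" "needs j (\<gamma> (Inr Z))" "\<not> computable (subst \<Sigma> \<gamma> (inst 0 rs (ts ! j)))" by auto
  have lts: "length ts = arity \<Sigma> Z" using list_all2_lengthD[OF s(3)] s(2) by simp
  then have cj: "(Z, Suc j) \<in> conds \<gamma>" using j Z by (auto simp: conds_def)
  have wj: "wt \<Sigma> [] (inst 0 rs (ts ! j)) (\<sigma>s ! j)" using s(3) j by (auto simp: list_all2_conv_all_nth)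
  have "\<exists>\<gamma>' f us vs. comp_subst \<gamma> \<gamma>' \<and> beta_subterm \<Sigma> (conds \<gamma>) (apps (inst 0 rs (ts ! j)) []) (apps (Fn f) (us @ vs)) \<and>
      min_noncomp f (map (subst \<Sigma> \<gamma>') us)"
  proof (rule Meta(1)[OF _ Meta(2)])
    show "ts ! j \<in> set ts" using j by simp
    show "wt \<Sigma> [] (apps (inst 0 rs (ts ! j)) []) (\<sigma>s ! j)" using wj by simp
    show "min_args k 0 (ts ! j)" using Meta(4) j by simp
    show "\<forall>Y\<in>FMV (apps (inst 0 rs (ts ! j)) []). Inr Y \<in> sdom \<Sigma> \<gamma> \<and> computable (\<gamma> (Inr Y))"
      using FT[of "inst 0 rs (ts ! j)"] j by simp
  qed (use Meta(6) j in auto)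
  then obtain \<gamma>' f us' vs where r: "comp_subst \<gamma> \<gamma>'" "beta_subterm \<Sigma> (conds \<gamma>) (inst 0 rs (ts ! j)) (apps (Fn f) (us' @ vs))"
      "min_noncomp f (map (subst \<Sigma> \<gamma>') us')" by auto
  have "beta_subterm \<Sigma> (conds \<gamma>) (apps (Meta Z ?ts) us) (apps (Fn f) (us' @ vs))"
    using cj j r(2) by (intro beta_subterm.intros(8)[of Z "Suc j"]) auto
  then show ?case using r unfolding L by blast
qed

end

context afsm_system
begin

lemma not_terminating_SN: "\<not> terminating \<Sigma> R \<Longrightarrow> \<exists>s. trm s \<and> \<not> SN s"
proof -
  assume "\<not> terminating \<Sigma> R"
  then obtain s :: "nat \<Rightarrow> _" where s: "\<And>i. is_term \<Sigma> (s i)" "\<And>i. rstep \<Sigma> R (s i) (s (Suc i))"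
    by (auto simp: terminating_def)
  have "x \<noteq> s i" if "SN x" for x i
    using that
  proof (induct arbitrary: i rule: SN_induct)
    case (step x)
    then show ?case using s(2)[of i] by blast
  qed
  then have "\<not> SN (s 0)" by blast
  then show ?thesis using s(1) is_term_iff by blast
qed

end

context static_dp
begin

section \<open>Existence of minimal non-computable terms and one step between them\<close>

lemma ex_min_noncomp: assumes "trm s" "\<not> SN s" shows "\<exists>f us. min_noncomp f us"
proof (rule ccontr)
  assume n: "\<not> ?thesis"
  obtain \<tau> where t: "tm s \<tau>" using assms by (auto simp: trm_def)
  have c: "comp_subst (id_subst \<Sigma>) (id_subst \<Sigma>)" using tsubst_id by (simp add: comp_subst_def)
  have "\<not> computable s" using assms(2) computable_SN by blast
  then have "\<exists>\<gamma>' f ts vs. comp_subst (id_subst \<Sigma>) \<gamma>' \<and>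
     beta_subterm \<Sigma> (conds (id_subst \<Sigma>)) (apps (inst 0 [] s) []) (apps (Fn f) (ts @ vs)) \<and> min_noncomp f (map (subst \<Sigma> \<gamma>') ts)"
    \<comment> \<open>An arbitrary term may apply defined symbols to too few arguments, so
      \<open>k\<close> is 0 throughout and the assumption to be refuted serves as the second
      alternative.\<close>
    using n t by (intro noncomputable_candidate[where k = "\<lambda>_. 0" and n = 0 and \<tau> = \<tau>, OF _ c]) (auto simp: tm_def min_args_0)
  then show False using n by blast
qed

lemma min_noncomp_next:
  assumes "min_noncomp f us"
  obtains ls r \<delta> ws \<gamma> g ts A where "list_all2 rsteps us ws" "(apps (Fn f) ls, r) \<in> R" "is_subst \<Sigma> \<delta>"
    "sdom \<Sigma> \<delta> = Inr ` FMV (apps (Fn f) ls)" "subst \<Sigma> \<delta> (apps (Fn f) ls) = apps (Fn f) ws"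
    "comp_subst \<delta> \<gamma>" "(apps (Fn g) ts, A) \<in> cand \<Sigma> R r" "A \<subseteq> conds \<delta>" "min_noncomp g (map (subst \<Sigma> \<gamma>) ts)"
proof -
  obtain ws ls r \<delta> where w: "list_all2 rsteps us ws" "(apps (Fn f) ls, r) \<in> R" "is_subst \<Sigma> \<delta>"
    "sdom \<Sigma> \<delta> = Inr ` FMV (apps (Fn f) ls)" "subst \<Sigma> \<delta> (apps (Fn f) ls) = apps (Fn f) ws" "\<not> computable (subst \<Sigma> \<delta> r)"
    using min_noncomp_step[OF assms] by metis
  have "apps (Fn f) (map (subst \<Sigma> \<delta>) ls) = apps (Fn f) ws" using w(5) by simp
  then have ws: "map (subst \<Sigma> \<delta>) ls = ws" by (subst (asm) apps_eq_iff) auto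
  have "computable (ws ! i)" if "i < length ws" for i
    using w(1) that assms computable_rsteps by (auto simp: list_all2_conv_all_nth min_noncomp_def)
  then have "\<forall>l\<in>set ls. computable (subst \<Sigma> \<delta> l)" using ws by (metis in_set_conv_nth length_map nth_map)
  from rule_subst_computable[OF w(2,3,4) this] have cZ: "\<forall>Z\<in>FMV r. computable (\<delta> (Inr Z))" by blast
  obtain \<tau> where r: "wt \<Sigma> [] r \<tau>" "FMV r \<subseteq> FMV (apps (Fn f) ls)" using ruleD[OF w(2)] by metis
  have c: "comp_subst \<delta> \<delta>"
  proof -
    have "\<delta> (Inl x) = Fv x" for x
    proof -
      have "Inl x \<notin> sdom \<Sigma> \<delta>" using w(4) by auto
      then show ?thesis by (simp add: sdom_def)
    qed
    then show ?thesis using w(3) is_subst_iff by (simp add: comp_subst_def)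
  qed
  let ?k = "\<lambda>f. if f \<in> defined R then minar \<Sigma> R f else 0"
  have "\<exists>\<gamma> g ts vs. comp_subst \<delta> \<gamma> \<and> beta_subterm \<Sigma> (conds \<delta>) (apps (inst 0 [] r) []) (apps (Fn g) (ts @ vs)) \<and>
      min_noncomp g (map (subst \<Sigma> \<gamma>) ts)"
    using r w(4,6) cZ rule_min_args[OF w(2)]
    by (intro noncomputable_candidate[where k = ?k and n = 0 and \<tau> = \<tau>, OF _ c]) auto
  then obtain \<gamma> g ts vs where g: "comp_subst \<delta> \<gamma>" "beta_subterm \<Sigma> (conds \<delta>) r (apps (apps (Fn g) ts) vs)"
     "min_noncomp g (map (subst \<Sigma> \<gamma>) ts)" by auto
  \<comment> \<open>\<open>S\<close> admits surplus arguments \<open>vs\<close>, as the existence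
    clause of \<open>cand\<close> does. The minimality clause of \<open>cand\<close> concerns the
    candidate alone and is covered by \<open>vs = []\<close>.\<close>
  define S where "S = {A. A \<subseteq> conds \<delta> \<and> (\<exists>vs. beta_subterm \<Sigma> A r (apps (apps (Fn g) ts) vs))}"
  \<comment> \<open>Finiteness of the satisfied conditions is what makes a minimal element of
    \<open>S\<close> available.\<close>
  have "conds \<delta> \<subseteq> (\<Union>Z\<in>FMV (apps (Fn f) ls). {Z} \<times> {..arity \<Sigma> Z})" using w(4) by (auto simp: conds_def)
  moreover have "finite (\<Union>Z\<in>FMV (apps (Fn f) ls). {Z} \<times> {..arity \<Sigma> Z})"
    using finite_FMV by (intro finite_UN_I) auto
  ultimately have "finite (conds \<delta>)" by (rule finite_subset)
  then have "finite S" using finite_subset[of S "Pow (conds \<delta>)"] by (auto simp: S_def)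
  moreover have "S \<noteq> {}" unfolding S_def using g(2) by blast
  ultimately obtain A where A: "A \<in> S" "\<forall>B\<in>S. B \<subseteq> A \<longrightarrow> A = B" using finite_has_minimal[of S] by blast
  have "\<not> (\<exists>A'. A' \<subset> A \<and> beta_subterm \<Sigma> A' r (apps (Fn g) ts))"
  proof
    assume "\<exists>A'. A' \<subset> A \<and> beta_subterm \<Sigma> A' r (apps (Fn g) ts)"
    then obtain A' where A': "A' \<subset> A" "beta_subterm \<Sigma> A' r (apps (Fn g) ts)" by (elim exE conjE)
    then have "A' \<in> S" using A(1) unfolding S_def by (intro CollectI conjI exI[of _ "[]"]) auto
    then show False using A(2) A'(1) by auto
  qed
  then have "(apps (Fn g) ts, A) \<in> cand \<Sigma> R r"
    unfolding cand_def using A(1) g(3) by (auto simp: min_noncomp_def S_def)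
  moreover have "A \<subseteq> conds \<delta>" using A(1) by (simp add: S_def)
  ultimately show thesis using that[OF w(1-5) g(1) _ _ g(3)] by blast
qed

end

section \<open>Marked symbols\<close>

text \<open>
  A constant for the abbreviation \<open>emb\<close>, whose identity arguments would be unfolded to
  \<open>\<lambda>a. a\<close> in the middle of inductions.
\<close>

definition plain :: "('f, 'v, 'm, 's) mt \<Rightarrow> ('f sharp_sym, 'v, 'm, 's) mt" where
  "plain = emb"

lemma plain_simps [simp]:
  "plain (Bd i) = Bd i" "plain (Fv x) = Fv x" "plain (Fn f) = Fn (Plain f)"
  "plain (App s t) = App (plain s) (plain t)" "plain (Lam \<sigma> s) = Lam \<sigma> (plain s)"
  "plain (Meta Z ss) = Meta Z (map plain ss)"
  by (auto simp: plain_def ty.map_id)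

lemma plain_Bd_comp [simp]: "plain \<circ> Bd = Bd" by auto

lemma plain_apps [simp]: "plain (apps h ss) = apps (plain h) (map plain ss)"
  by (induct ss arbitrary: h) auto
lemma plain_close [simp]: "plain (close x d s) = close x d (plain s)"
  by (induct s arbitrary: d) auto
lemma plain_lift [simp]: "plain (lift c n s) = lift c n (plain s)"
  by (induct s arbitrary: c) auto
lemma plain_inst [simp]: "plain (inst d ss s) = inst d (map plain ss) (plain s)"
  by (induct s arbitrary: d) (auto simp: rev_map)
lemma FV_plain [simp]: "FV (plain s) = FV s" by (simp add: plain_def mt.set_map)
lemma FMV_plain [simp]: "FMV (plain s) = FMV s" by (simp add: plain_def mt.set_map)

lemma plain_eq_iff [simp]: "plain s = plain t \<longleftrightarrow> s = t"
proof -
  have "inj plain" unfolding plain_def by (rule mt.inj_map) (auto simp: inj_def)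
  then show ?thesis by (auto simp: inj_def)
qed

lemma strip_lams_plain: "strip_lams k (plain t) = (fst (strip_lams k t), plain (snd (strip_lams k t)))"
  by (induct k t rule: strip_lams.induct) (auto split: prod.splits)

lemma plain_meta_inst: "plain (meta_inst t ss) = meta_inst (plain t) (map plain ss)"
  by (auto simp: meta_inst_def strip_lams_plain take_map drop_map split: prod.splits)

lemma sharp_sig_simps [simp]:
  "vtype (sharp_sig \<Sigma> R) = vtype \<Sigma>" "mtype (sharp_sig \<Sigma> R) = mtype \<Sigma>" "arity (sharp_sig \<Sigma> R) = arity \<Sigma>"
  "ftype (sharp_sig \<Sigma> R) (Plain f) = ftype \<Sigma> f" "ftype (sharp_sig \<Sigma> R) (Sharp f) = ftype \<Sigma> f"
  "Plain f \<in> funs (sharp_sig \<Sigma> R) \<longleftrightarrow> f \<in> funs \<Sigma>" "Sharp f \<in> funs (sharp_sig \<Sigma> R) \<longleftrightarrow> f \<in> defined R"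
  by (auto simp: sharp_sig_def)

lemma wf_sharp_sig: "wf_sig \<Sigma> \<Longrightarrow> wf_sig (sharp_sig \<Sigma> R)" by (simp add: wf_sig_def)

lemma plain_lam: "plain (lam \<Sigma> x s) = lam (sharp_sig \<Sigma> R) x (plain s)"
  by (simp add: lam_def)

lemma plain_foldr_Lam: "plain (foldr Lam \<sigma>s u) = foldr Lam \<sigma>s (plain u)"
  by (induct \<sigma>s) auto

lemma plain_id_subst: "plain (id_subst \<Sigma> a) = id_subst (sharp_sig \<Sigma> R) a"
  by (cases a) (auto simp: id_subst_def id_meta_def plain_foldr_Lam)

lemma sdom_plain: "sdom (sharp_sig \<Sigma> R) (\<lambda>a. plain (\<gamma> a)) = sdom \<Sigma> \<gamma>"
  by (simp add: sdom_def flip: plain_id_subst[where R = R])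

lemma plain_subst: "plain (subst \<Sigma> \<gamma> s) = subst (sharp_sig \<Sigma> R) (\<lambda>a. plain (\<gamma> a)) (plain s)"
proof (induct s)
  case (Meta Z ss)
  then have "map plain (map (subst \<Sigma> \<gamma>) ss) = map (subst (sharp_sig \<Sigma> R) (\<lambda>a. plain (\<gamma> a))) (map plain ss)" by (simp add: o_def)
  then show ?case by (simp add: sdom_plain plain_meta_inst del: map_map)
qed auto

lemma plain_has_type: "has_type \<Sigma> s \<tau> \<Longrightarrow> has_type (sharp_sig \<Sigma> R) (plain s) \<tau>"
proof (induct rule: has_type.induct)
  case (var x)
  then show ?case using has_type.var[of "sharp_sig \<Sigma> R" x] by simp
next
  case (fn f)
  then show ?case using has_type.fn[of "Plain f" "sharp_sig \<Sigma> R"] by simp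
next
  case (app s \<sigma> \<tau> t)
  then show ?case using has_type.app by fastforce
next
  case (lam s \<tau> x)
  then show ?case using has_type.lam[of "sharp_sig \<Sigma> R" "plain s" \<tau> x] by (simp add: plain_lam[where R = R])
next
  case (meta Z \<sigma>s \<tau> ss)
  then have "list_all2 (has_type (sharp_sig \<Sigma> R)) (map plain ss) \<sigma>s" by (auto simp: list_all2_conv_all_nth)
  then show ?case using meta(1,2) has_type.meta[of "sharp_sig \<Sigma> R" Z \<sigma>s] by simp
qed

lemma plain_is_mterm: "is_mterm \<Sigma> s \<Longrightarrow> is_mterm (sharp_sig \<Sigma> R) (plain s)"
  using plain_has_type unfolding is_mterm_def by blast
lemma plain_is_term: "is_term \<Sigma> s \<Longrightarrow> is_term (sharp_sig \<Sigma> R) (plain s)"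
  using plain_is_mterm[of \<Sigma> s R] by (simp add: is_term_def)

lemma plain_is_subst: "is_subst \<Sigma> \<delta> \<Longrightarrow> is_subst (sharp_sig \<Sigma> R) (\<lambda>a. plain (\<delta> a))"
  unfolding is_subst_def sdom_plain sharp_sig_simps using plain_is_term plain_has_type by blast

lemma plain_subst1: "plain (subst1 \<Sigma> x t s) = subst1 (sharp_sig \<Sigma> R) x (plain t) (plain s)"
proof -
  have "(\<lambda>a. plain (((id_subst \<Sigma>)(Inl x := t)) a)) = (id_subst (sharp_sig \<Sigma> R))(Inl x := plain t)"
    by (rule ext) (simp add: plain_id_subst[where R = R])
  then show ?thesis unfolding subst1_def by (subst plain_subst[where R = R]) simp
qed

lemma plain_rstep: "rstep \<Sigma> R s t \<Longrightarrow> rstep (sharp_sig \<Sigma> R) (emb_rules R) (plain s) (plain t)"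
proof (induct rule: rstep.induct)
  case (rule l r \<delta>)
  have "(plain l, plain r) \<in> emb_rules R" using rule(1) by (force simp: emb_rules_def plain_def)
  then show ?case unfolding plain_subst[where R = R]
    by (rule rstep.rule) (use rule plain_is_subst in \<open>auto simp: sdom_plain\<close>)
next
  case (beta s t x)
  have "rstep (sharp_sig \<Sigma> R) (emb_rules R) (App (lam (sharp_sig \<Sigma> R) x (plain s)) (plain t)) (subst1 (sharp_sig \<Sigma> R) x (plain t) (plain s))"
    using beta plain_is_term plain_has_type by (intro rstep.beta) fastforce+
  then show ?case by (simp add: plain_lam[where R = R] plain_subst1[where R = R])
next
  case (appl s s' t)
  then show ?case using plain_is_term[OF appl(3)] by (auto intro: rstep.appl)
next
  case (appr t t' s)
  then show ?case using plain_is_term[OF appr(3)] by (auto intro: rstep.appr)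
next
  case (lam s s' x)
  then show ?case by (simp add: plain_lam[where R = R] rstep.lam)
qed

lemma plain_rsteps: "(rstep \<Sigma> R)\<^sup>*\<^sup>* s t \<Longrightarrow> (rstep (sharp_sig \<Sigma> R) (emb_rules R))\<^sup>*\<^sup>* (plain s) (plain t)"
  by (induct rule: rtranclp_induct) (auto intro: plain_rstep rtranclp.rtrancl_into_rtrancl)

lemma sharp_apps: "sharp (apps (Fn f) ss) = apps (Fn (Sharp f)) (map plain ss)"
  by (induct ss rule: rev_induct) (auto simp flip: plain_def)

section \<open>Fresh meta-variables in place of free variables\<close>

lemma FMV_subst_variables:
  assumes "\<And>Z. Inr Z \<notin> sdom \<Sigma> \<gamma>" "\<And>x. FMV (\<gamma> (Inl x)) \<subseteq> X"
  shows "FMV (subst \<Sigma> \<gamma> s) \<subseteq> FMV s \<union> X"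
proof (induct s)
  case (Fv x)
  then show ?case using assms(2)[of x] by simp
next
  case (Meta Z ss)
  then show ?case using assms(1)[of Z] by fastforce
qed auto

lemma FMV_subst1: "FMV (subst1 \<Sigma> x a s) \<subseteq> FMV s \<union> FMV a"
  unfolding subst1_def by (rule FMV_subst_variables) auto

text \<open>Neither descent nor contraction introduces meta-variables, so those of a candidate occur
  in the left-hand side and already have values.\<close>

lemma beta_subterm_FMV: "beta_subterm \<Sigma> A s t \<Longrightarrow> FMV t \<subseteq> FMV s"
proof (induct rule: beta_subterm.induct)
  case (4 u x s0 ss t)
  then show ?case using FMV_subst1[of \<Sigma> x s0 u] by (auto simp: lam_def)
next
  case (8 Z i ts t ss)
  then have "ts ! (i - 1) \<in> set ts" by auto
  then have "FMV (ts ! (i - 1)) \<subseteq> FMV (apps (Meta Z ts) ss)" by auto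
  with 8(5) show ?case by (rule subset_trans)
qed (auto simp: lam_def)

lemma ex_fresh_metas:
  assumes "\<And>\<sigma>. infinite {Z. mt Z = \<sigma> \<and> ar Z = (0::nat)}" "finite X" "finite F"
  shows "\<exists>\<nu>. inj_on \<nu> F \<and> (\<forall>x\<in>F. mt (\<nu> x) = vt x \<and> ar (\<nu> x) = 0 \<and> \<nu> x \<notin> X)"
  using assms(3)
proof (induct F rule: finite_induct)
  case (insert x F)
  then obtain \<nu> where n: "inj_on \<nu> F" "\<forall>x\<in>F. mt (\<nu> x) = vt x \<and> ar (\<nu> x) = 0 \<and> \<nu> x \<notin> X" by blast
  have "finite (X \<union> \<nu> ` F)" using assms(2) insert by simp
  then have "infinite ({Z. mt Z = vt x \<and> ar Z = 0} - (X \<union> \<nu> ` F))" using assms(1) by (rule Diff_infinite_finite)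
  then have "{Z. mt Z = vt x \<and> ar Z = 0} - (X \<union> \<nu> ` F) \<noteq> {}" by (metis finite.emptyI)
  then obtain Z where Z: "mt Z = vt x" "ar Z = 0" "Z \<notin> X \<union> \<nu> ` F" by blast
  have "inj_on (\<nu>(x := Z)) (insert x F)" using n(1) Z insert(2) by (auto simp: inj_on_def)
  moreover have "\<forall>y\<in>insert x F. mt ((\<nu>(x := Z)) y) = vt y \<and> ar ((\<nu>(x := Z)) y) = 0 \<and> (\<nu>(x := Z)) y \<notin> X"
    using n(2) Z insert(2) by auto
  ultimately show ?case by blast
qed simp

lemma metafy_cases:
  assumes "wf_sig \<Sigma>" "finite X"
  obtains \<nu> where "inj_on \<nu> (FV s)"
    "\<And>x. x \<in> FV s \<Longrightarrow> mtype \<Sigma> (\<nu> x) = vtype \<Sigma> x \<and> arity \<Sigma> (\<nu> x) = 0 \<and> \<nu> x \<notin> X \<union> FMV s"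
    "metafy \<Sigma> X s = subst \<Sigma> (case_sum (\<lambda>x. if x \<in> FV s then Meta (\<nu> x) [] else Fv x) (id_meta \<Sigma>)) s"
proof -
  let ?P = "\<lambda>\<nu>. inj_on \<nu> (FV s) \<and> (\<forall>x\<in>FV s. mtype \<Sigma> (\<nu> x) = vtype \<Sigma> x \<and> arity \<Sigma> (\<nu> x) = 0 \<and> \<nu> x \<notin> X \<union> FMV s)"
  have "\<exists>\<nu>. ?P \<nu>"
    by (rule ex_fresh_metas) (use assms in \<open>auto simp: wf_sig_def\<close>)
  then have "?P (SOME \<nu>. ?P \<nu>)" by (rule someI_ex)
  then show thesis using that[of "SOME \<nu>. ?P \<nu>"] unfolding metafy_def Let_def by blast
qed

lemma FMV_subst_metafy:
  "FV s \<subseteq> V \<Longrightarrow> FMV (subst \<Sigma> (case_sum (\<lambda>x. if x \<in> V then Meta (\<nu> x) [] else Fv x) (id_meta \<Sigma>)) s) = FMV s \<union> \<nu> ` FV s"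
proof (induct s)
  case (Meta Z ss)
  have "Inr Z \<notin> sdom \<Sigma> (case_sum (\<lambda>x. if x \<in> V then Meta (\<nu> x) [] else Fv x) (id_meta \<Sigma>))"
    by (simp add: sdom_def id_subst_def)
  then show ?case using Meta by (fastforce simp: SUP_le_iff)
qed auto

text \<open>Without arguments the instance of a meta-variable is its value as it stands, so each
  fresh \<open>\<nu> x\<close> simply passes on the value of \<theta> at \<open>x\<close>.\<close>

lemma subst_subst_metafy:
  assumes "\<And>x. x \<in> V \<Longrightarrow> Inr (\<nu> x) \<in> sdom \<Sigma> \<gamma> \<and> \<gamma> (Inr (\<nu> x)) = \<theta> (Inl x)"
    "\<And>Z. Z \<in> FMV s \<Longrightarrow> \<gamma> (Inr Z) = \<theta> (Inr Z)" "FV s \<subseteq> V"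
  shows "subst \<Sigma> \<gamma> (subst \<Sigma> (case_sum (\<lambda>x. if x \<in> V then Meta (\<nu> x) [] else Fv x) (id_meta \<Sigma>)) s) = subst \<Sigma> \<theta> s"
  using assms(2,3)
proof (induct s)
  case (Fv x)
  then show ?case using assms(1)[of x] by (simp add: meta_inst_def)
next
  case (Meta Z ss)
  let ?\<mu> = "case_sum (\<lambda>x. if x \<in> V then Meta (\<nu> x) [] else Fv x) (id_meta \<Sigma>)"
  have "Inr Z \<notin> sdom \<Sigma> ?\<mu>" by (simp add: sdom_def id_subst_def)
  moreover have "\<gamma> (Inr Z) = \<theta> (Inr Z)" using Meta(2) by simp
  moreover from this have "Inr Z \<in> sdom \<Sigma> \<gamma> \<longleftrightarrow> Inr Z \<in> sdom \<Sigma> \<theta>" by (simp add: sdom_def)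
  moreover have "map (subst \<Sigma> \<gamma>) (map (subst \<Sigma> ?\<mu>) ss) = map (subst \<Sigma> \<theta>) ss"
  proof -
    have "subst \<Sigma> \<gamma> (subst \<Sigma> ?\<mu> s) = subst \<Sigma> \<theta> s" if s: "s \<in> set ss" for s
      by (rule Meta(1)[OF s]) (use Meta(2,3) s in auto)
    then show ?thesis by simp
  qed
  ultimately show ?case by (simp del: map_map)
qed auto

context static_dp
begin

section \<open>Construction of the chain\<close>

definition dp_instance where
  "dp_instance l p A s t \<longleftrightarrow> (l, p, A) \<in> SDP \<Sigma> R \<and> is_term (sharp_sig \<Sigma> R) s \<and> is_term (sharp_sig \<Sigma> R) t \<and>
    (\<exists>\<gamma>. is_subst (sharp_sig \<Sigma> R) \<gamma> \<and> sdom (sharp_sig \<Sigma> R) \<gamma> = Inr ` (FMV l \<union> FMV p) \<and>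
      respects_conds (sharp_sig \<Sigma> R) \<gamma> A \<and> s = subst (sharp_sig \<Sigma> R) \<gamma> l \<and> t = subst (sharp_sig \<Sigma> R) \<gamma> p)"

abbreviation "sharp_rsteps \<equiv> (rstep (sharp_sig \<Sigma> R) (emb_rules R))\<^sup>*\<^sup>*"

lemma chain_step:
  assumes "min_noncomp f us"
  shows "\<exists>l p A ws g us'. dp_instance l p A (apps (Fn (Sharp f)) ws) (apps (Fn (Sharp g)) (map plain us')) \<and>
    list_all2 sharp_rsteps (map plain us) ws \<and> min_noncomp g us'"
proof -
  let ?\<Sigma> = "sharp_sig \<Sigma> R"
  obtain ls r \<delta> ws \<gamma> g ts A where w: "list_all2 rsteps us ws" "(apps (Fn f) ls, r) \<in> R" "is_subst \<Sigma> \<delta>"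
    "sdom \<Sigma> \<delta> = Inr ` FMV (apps (Fn f) ls)" "subst \<Sigma> \<delta> (apps (Fn f) ls) = apps (Fn f) ws"
    "comp_subst \<delta> \<gamma>" "(apps (Fn g) ts, A) \<in> cand \<Sigma> R r" "A \<subseteq> conds \<delta>" "min_noncomp g (map (subst \<Sigma> \<gamma>) ts)"
    using min_noncomp_next[OF assms] by metis
  let ?l = "apps (Fn f) ls" let ?p = "apps (Fn g) ts"
  have FMVp: "FMV ?p \<subseteq> FMV ?l"
  proof -
    obtain vs where "beta_subterm \<Sigma> A r (apps ?p vs)" using w(7) by (auto simp: cand_def)
    from beta_subterm_FMV[OF this] have "FMV ?p \<subseteq> FMV r" by simp
    moreover have "FMV r \<subseteq> FMV ?l" using ruleD[OF w(2)] by metis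
    ultimately show ?thesis by simp
  qed
  have FVl: "FV ?l = {}" using ruleD[OF w(2)] by metis
  have Fl: "FMV (sharp ?l) = FMV ?l" "FV (sharp ?l) = {}" and Fp: "FMV (sharp ?p) = FMV ?p" "FV (sharp ?p) = FV ?p"
    using FVl by (auto simp: sharp_apps)
  obtain \<nu> where n: "inj_on \<nu> (FV ?p)"
    "\<And>x. x \<in> FV ?p \<Longrightarrow> mtype \<Sigma> (\<nu> x) = vtype \<Sigma> x \<and> arity \<Sigma> (\<nu> x) = 0 \<and> \<nu> x \<notin> FMV ?l \<union> FMV ?p"
    "metafy ?\<Sigma> (FMV ?l) (sharp ?p) = subst ?\<Sigma> (case_sum (\<lambda>x. if x \<in> FV ?p then Meta (\<nu> x) [] else Fv x) (id_meta ?\<Sigma>)) (sharp ?p)"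
    using metafy_cases[OF wf_sharp_sig[OF wf, of R] finite_FMV[of ?l], where s = "sharp ?p", unfolded Fp sharp_sig_simps]
    by blast
  let ?p' = "metafy ?\<Sigma> (FMV ?l) (sharp ?p)"
  have Fp': "FMV ?p' = FMV ?p \<union> \<nu> ` FV ?p" using FMV_subst_metafy[of "sharp ?p" "FV ?p" ?\<Sigma> \<nu>] n(3) Fp by simp
  \<comment> \<open>Meta-variables of the left-hand side keep their values, and each fresh one
    receives the value of the variable it replaces. Variables stay fixed, since the domain
    prescribed for a chain contains only meta-variables.\<close>
  define \<gamma>' where "\<gamma>' = case_sum Fv (\<lambda>Z. if Z \<in> FMV ?l then plain (\<gamma> (Inr Z))
     else if Z \<in> \<nu> ` FV ?p then plain (\<gamma> (Inl (inv_into (FV ?p) \<nu> Z))) else id_meta ?\<Sigma> Z)"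
  have gx: "\<gamma>' (Inl x) = Fv x" for x by (simp add: \<gamma>'_def)
  have gl: "\<gamma>' (Inr Z) = plain (\<gamma> (Inr Z))" if "Z \<in> FMV ?l" for Z using that by (simp add: \<gamma>'_def)
  have gn: "\<gamma>' (Inr (\<nu> x)) = plain (\<gamma> (Inl x))" if "x \<in> FV ?p" for x
    using that n(1) n(2)[OF that] by (simp add: \<gamma>'_def)
  have go: "\<gamma>' (Inr Z) = id_subst ?\<Sigma> (Inr Z)" if "Z \<notin> FMV ?l" "Z \<notin> \<nu> ` FV ?p" for Z
    using that by (simp add: \<gamma>'_def id_subst_def)
  have tg: "tsubst \<gamma>" using w(6) by (simp add: comp_subst_def)
  have tl: "tm (\<gamma> (Inr Z)) (mtype \<Sigma> Z)" if "Z \<in> FMV ?l" for Z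
    using tg comp_subst_sdom[OF w(6)] w(4) that by (simp add: tsubst_def)
  have tn: "tm (\<gamma> (Inl x)) (vtype \<Sigma> x)" for x using tg by (simp add: tsubst_def)
  \<comment> \<open>The domain must be exactly the given set; a value without meta-variables differs
    from the identity value at \<open>Z\<close>, which contains \<open>Z\<close>.\<close>
  have ne: "plain s \<noteq> id_subst ?\<Sigma> (Inr Z)" if "tm s \<tau>" for s \<tau> Z
  proof
    assume "plain s = id_subst ?\<Sigma> (Inr Z)"
    then have "FMV (plain s) = {Z}" using id_subst_FMV by metis
    then show False using that by (simp add: tm_def)
  qed
  have sd: "sdom ?\<Sigma> \<gamma>' = Inr ` (FMV ?l \<union> \<nu> ` FV ?p)"
  proof (rule set_eqI)
    fix a show "a \<in> sdom ?\<Sigma> \<gamma>' \<longleftrightarrow> a \<in> Inr ` (FMV ?l \<union> \<nu> ` FV ?p)"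
    proof (cases a)
      case (Inl x)
      then show ?thesis using gx by (auto simp: sdom_def)
    next
      case (Inr Z)
      consider "Z \<in> FMV ?l" | x where "x \<in> FV ?p" "Z = \<nu> x" | "Z \<notin> FMV ?l" "Z \<notin> \<nu> ` FV ?p" by blast
      then show ?thesis
      proof cases
        case 1
        then have "a \<in> sdom ?\<Sigma> \<gamma>'" using gl ne[OF tl] Inr by (simp add: sdom_def)
        then show ?thesis using 1 Inr by simp
      next
        case 2
        then have "a \<in> sdom ?\<Sigma> \<gamma>'" using gn ne[OF tn] Inr by (simp add: sdom_def)
        then show ?thesis using 2 Inr by simp
      next
        case 3
        then have "a \<notin> sdom ?\<Sigma> \<gamma>'" using go Inr by (simp add: sdom_def)
        then show ?thesis using 3 Inr by auto
      qed
    qed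
  qed
  have pt: "is_term ?\<Sigma> (plain s) \<and> has_type ?\<Sigma> (plain s) \<tau>" if "tm s \<tau>" for s \<tau>
    using that plain_is_term[of \<Sigma> s R] plain_has_type[of \<Sigma> s \<tau> R] is_term_iff has_type_iff[OF wf] by (auto simp: trm_def tm_def)
  have sub: "is_subst ?\<Sigma> \<gamma>'" unfolding is_subst_def
  proof
    fix a assume "a \<in> sdom ?\<Sigma> \<gamma>'"
    then consider Z where "a = Inr Z" "Z \<in> FMV ?l" | x where "x \<in> FV ?p" "a = Inr (\<nu> x)" using sd by auto
    then show "is_term ?\<Sigma> (\<gamma>' a) \<and> has_type ?\<Sigma> (\<gamma>' a) (case_sum (vtype ?\<Sigma>) (mtype ?\<Sigma>) a)"
    proof cases
      case 1
      then show ?thesis using pt[OF tl] gl by simp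
    next
      case 2
      then show ?thesis using pt[OF tn] gn n(2) by simp
    qed
  qed
  have resp: "respects_conds ?\<Sigma> \<gamma>' A" unfolding respects_conds_def
  proof (intro ballI, clarify)
    fix Z i assume "(Z, i) \<in> A"
    then have c: "Inr Z \<in> sdom \<Sigma> \<delta>" "1 \<le> i" "needs (i - 1) (\<delta> (Inr Z))" using w(8) by (auto simp: conds_def)
    then have Z: "Z \<in> FMV ?l" using w(4) by auto
    have d: "\<gamma> (Inr Z) = \<delta> (Inr Z)" using w(6) by (simp add: comp_subst_def)
    have wZ: "wt \<Sigma> [] (\<delta> (Inr Z)) (mtype \<Sigma> Z)" using tl[OF Z] d by (simp add: tm_def)
    obtain xs u where u: "\<delta> (Inr Z) = foldr (lam \<Sigma>) xs u" "distinct xs" "is_mterm \<Sigma> u" "\<nexists>\<sigma> b. u = Lam \<sigma> b"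
      "\<And>j. needs j (\<delta> (Inr Z)) \<Longrightarrow> j \<ge> length xs \<or> xs ! j \<in> FV u" using ex_lam_form[OF wZ, of "{}"] by blast
    have "plain (foldr (lam \<Sigma>) xs u) = foldr (lam ?\<Sigma>) xs (plain u)"
      by (induct xs) (auto simp: plain_lam[where R = R])
    then have "\<gamma>' (Inr Z) = foldr (lam ?\<Sigma>) xs (plain u)" using gl[OF Z] d u(1) by simp
    moreover have "\<nexists>\<sigma> b. plain u = Lam \<sigma> b" using u(4) by (cases u) auto
    \<comment> \<open>Conditions count from 1 and \<open>needs\<close> from 0;
      \<open>1 \<le> i\<close> prevents the truncated \<open>i - 1\<close> from misreading position
      0.\<close>
    moreover have "i > length xs \<or> i \<le> length xs \<and> xs ! (i - 1) \<in> FV (plain u)" using u(5)[OF c(3)] c(2) by auto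
    ultimately show "\<exists>xs t. \<gamma>' (Inr Z) = foldr (lam ?\<Sigma>) xs t \<and> distinct xs \<and> is_mterm ?\<Sigma> t \<and> (\<nexists>\<sigma> u. t = Lam \<sigma> u) \<and>
         (length xs < i \<or> i \<le> length xs \<and> xs ! (i - 1) \<in> FV t)"
      using u(2) plain_is_mterm[OF u(3)] by blast
  qed
  have ws: "map (subst \<Sigma> \<delta>) ls = ws"
  proof -
    have "apps (Fn f) (map (subst \<Sigma> \<delta>) ls) = apps (Fn f) ws" using w(5) by simp
    then show ?thesis by (subst (asm) apps_eq_iff) auto
  qed
  have sl: "subst ?\<Sigma> \<gamma>' (sharp ?l) = apps (Fn (Sharp f)) (map plain ws)"
  proof -
    \<comment> \<open>The left-hand side is closed, so the values that \<gamma> chose for variables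
      during the descent do not matter here.\<close>
    have "subst ?\<Sigma> \<gamma>' (sharp ?l) = subst ?\<Sigma> (\<lambda>a. plain (\<delta> a)) (sharp ?l)"
      using Fl gl w(6) by (intro subst_cong) (auto simp: comp_subst_def)
    also have "\<dots> = apps (Fn (Sharp f)) (map plain ws)"
      by (simp add: sharp_apps o_def plain_subst[where R = R] flip: ws)
    finally show ?thesis .
  qed
  have sp: "subst ?\<Sigma> \<gamma>' ?p' = apps (Fn (Sharp g)) (map plain (map (subst \<Sigma> \<gamma>) ts))"
  proof -
    have "subst ?\<Sigma> \<gamma>' ?p' = subst ?\<Sigma> (\<lambda>a. plain (\<gamma> a)) (sharp ?p)"
      unfolding n(3)
    proof (rule subst_subst_metafy)
      show "Inr (\<nu> x) \<in> sdom ?\<Sigma> \<gamma>' \<and> \<gamma>' (Inr (\<nu> x)) = plain (\<gamma> (Inl x))" if "x \<in> FV ?p" for x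
        using gn[OF that] that unfolding sd by blast
      show "\<gamma>' (Inr Z) = plain (\<gamma> (Inr Z))" if "Z \<in> FMV (sharp ?p)" for Z
        using gl FMVp that unfolding Fp by blast
    qed (simp add: Fp)
    also have "\<dots> = apps (Fn (Sharp g)) (map plain (map (subst \<Sigma> \<gamma>) ts))"
      by (simp add: sharp_apps o_def plain_subst[where R = R])
    finally show ?thesis .
  qed
  have st: "is_term ?\<Sigma> (apps (Fn (Sharp h)) (map plain vs))" if "h \<in> defined R" "trm (apps (Fn h) vs)" for h vs
  proof -
    from that(2) obtain \<tau> \<sigma>s where v: "tm (Fn h) (arrows \<sigma>s \<tau>)" "list_all2 tm vs \<sigma>s" by (auto simp: trm_def tm_apps)
    have "list_all2 (wt ?\<Sigma> []) (map plain vs) \<sigma>s"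
      unfolding list_all2_map1 using v(2) by (rule list_all2_mono) (use pt has_type_wt in blast)
    moreover have "wt ?\<Sigma> [] (Fn (Sharp h)) (arrows \<sigma>s \<tau>)" using v(1) that(1) by (simp add: tm_def)
    ultimately have "wt ?\<Sigma> [] (apps (Fn (Sharp h)) (map plain vs)) \<tau>" unfolding wt_apps by blast
    then have "is_mterm ?\<Sigma> (apps (Fn (Sharp h)) (map plain vs))"
      unfolding is_mterm_def has_type_iff[OF wf_sharp_sig[OF wf]] by blast
    moreover have "FMV (apps (Fn (Sharp h)) (map plain vs)) = {}"
      using list_all2_in_set1[OF v(2)] by (auto simp: tm_def)
    ultimately show ?thesis by (simp add: is_term_def)
  qed
  have "tsubst \<delta>" using w(3) is_subst_iff by simp
  moreover obtain \<tau> where "wt \<Sigma> [] ?l \<tau>" using ruleD[OF w(2)] by metis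
  ultimately have "tm (apps (Fn f) ws) \<tau>" using tm_subst[of \<delta> ?l \<tau>] w(4,5) by simp
  then have "is_term ?\<Sigma> (apps (Fn (Sharp f)) (map plain ws))"
    using assms by (intro st) (auto simp: min_noncomp_def trm_def)
  moreover have "is_term ?\<Sigma> (apps (Fn (Sharp g)) (map plain (map (subst \<Sigma> \<gamma>) ts)))"
    using w(9) by (intro st) (auto simp: min_noncomp_def)
  moreover have "(sharp ?l, ?p', A) \<in> SDP \<Sigma> R" unfolding SDP_def using w(2,7) by blast
  moreover have "list_all2 sharp_rsteps (map plain us) (map plain ws)"
    unfolding list_all2_map1 list_all2_map2 using w(1) by (rule list_all2_mono) (rule plain_rsteps)
  moreover have "sdom ?\<Sigma> \<gamma>' = Inr ` (FMV (sharp ?l) \<union> FMV ?p')" unfolding sd Fl(1) Fp' using FMVp by blast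
  ultimately have "dp_instance (sharp ?l) ?p' A (apps (Fn (Sharp f)) (map plain ws))
      (apps (Fn (Sharp g)) (map plain (map (subst \<Sigma> \<gamma>) ts)))" "list_all2 sharp_rsteps (map plain us) (map plain ws)"
    unfolding dp_instance_def using sub resp sl sp by auto
  then show ?thesis using w(9) by blast
qed

lemma ex_chain:
  assumes "min_noncomp f us"
  shows "\<exists>c. infinite_chain (sharp_sig \<Sigma> R) (SDP \<Sigma> R) (emb_rules R) c"
proof -
  let ?\<Sigma> = "sharp_sig \<Sigma> R"
  \<comment> \<open>Besides the chain element, the state records the unmarked symbol and arguments
    of the minimal term, from which the next element is produced.\<close>
  define P where "P = (\<lambda>(l, p, A, s, t, g, us'). dp_instance l p A s t \<and>
    t = apps (Fn (Sharp g)) (map plain us') \<and> min_noncomp g us')"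
  define Q where "Q = (\<lambda>(l :: ('a sharp_sym, 'b, 'c, 'd) mt, p :: ('a sharp_sym, 'b, 'c, 'd) mt, A :: ('c \<times> nat) set,
      s :: ('a sharp_sym, 'b, 'c, 'd) mt, t :: ('a sharp_sym, 'b, 'c, 'd) mt, f, us)
    (l' :: ('a sharp_sym, 'b, 'c, 'd) mt, p' :: ('a sharp_sym, 'b, 'c, 'd) mt, A' :: ('c \<times> nat) set,
      s', t' :: ('a sharp_sym, 'b, 'c, 'd) mt, f' :: 'a, us' :: ('a, 'b, 'c, 'd) mt list).
    \<exists>ws. s' = apps (Fn (Sharp f)) ws \<and> list_all2 sharp_rsteps (map plain us) ws)"
  have step: "\<exists>e'. P e' \<and> Q (l, p, A, s, t, f, us) e'" if "min_noncomp f us" for l p A s t f us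
    using chain_step[OF that] unfolding P_def Q_def by fast
  have "\<exists>e. \<forall>n. P (e n) \<and> Q (e n) (e (Suc n))"
  proof (rule dependent_nat_choice)
    \<comment> \<open>\<open>step\<close> depends on its predecessor only through the minimal term,
      so it also supplies the first element.\<close>
    show "\<exists>e. P e" using step[OF assms] by blast
    fix e n assume "P e"
    then show "\<exists>e'. P e' \<and> Q e e'" using step by (cases e) (simp add: P_def)
  qed
  then obtain e where e: "\<And>n. P (e n)" "\<And>n. Q (e n) (e (Suc n))" by blast
  define c where "c n = (case e n of (l, p, A, s, t, _) \<Rightarrow> ((l, p, A), s, t))" for n
  have "infinite_chain ?\<Sigma> (SDP \<Sigma> R) (emb_rules R) c"
    unfolding infinite_chain_def
  proof (rule allI, goal_cases)
    case (1 i)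
    obtain l p A s t g us where ei: "e i = (l, p, A, s, t, g, us)" by (metis prod.exhaust)
    obtain l' p' A' s' t' g' us' where es: "e (Suc i) = (l', p', A', s', t', g', us')" by (metis prod.exhaust)
    have p: "dp_instance l p A s t" "t = apps (Fn (Sharp g)) (map plain us)"
      using e(1)[of i] by (auto simp: ei P_def)
    obtain ws where "s' = apps (Fn (Sharp g)) ws" "list_all2 sharp_rsteps (map plain us) ws"
      using e(2)[of i] unfolding ei es Q_def by auto
    moreover have ci: "c (Suc i) = ((l', p', A'), s', t')" "c i = ((l, p, A), s, t)" by (simp_all add: c_def ei es)
    ultimately have "\<exists>f us ws dp' t'. t = apps (Fn f) us \<and> c (Suc i) = (dp', apps (Fn f) ws, t') \<and>
          list_all2 sharp_rsteps us ws" using p(2) by blast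
    then show ?case
      using p(1)[unfolded dp_instance_def] ci(2)
      by (intro exI[of _ l] exI[of _ p] exI[of _ A] exI[of _ s] exI[of _ t]) simp
  qed
  then show ?thesis by (rule exI[of _ c])
qed

end

theorem theorem32:
  fixes \<Sigma> :: "('f, 'v, 'm, 's) afsm_sig" and R :: "('f, 'v, 'm, 's) rule set"
  assumes "afsm \<Sigma> R"
    and "properly_applied \<Sigma> R"
    and "accessible_function_passing \<Sigma> R"
    and "\<not> terminating \<Sigma> R"
  shows "\<exists>c. infinite_chain (sharp_sig \<Sigma> R) (SDP \<Sigma> R) (emb_rules R) c"
proof -
  interpret afsm_system \<Sigma> R using assms(1) by unfold_locales
  obtain ge where ge: "sort_order ge" "\<And>f ls r Z. (apps (Fn f) ls, r) \<in> R \<Longrightarrow> Z \<in> FMV r \<Longrightarrow>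
      \<exists>l\<in>set ls. \<exists>xs. acc_subterm \<Sigma> ge l (Meta Z (map Fv xs))"
    using assms(3) unfolding accessible_function_passing_def by blast
  obtain C where C: "\<forall>\<iota>. C \<iota> = comp_op ge C \<iota>" using ex_computability_fixpoint[OF ge(1)] by blast
  interpret static_dp \<Sigma> R ge C
    using ge C assms(2) by unfold_locales blast+
  obtain s where "trm s" "\<not> SN s" using not_terminating_SN[OF assms(4)] by blast
  then obtain f us where "min_noncomp f us" using ex_min_noncomp by blast
  then show ?thesis by (rule ex_chain)
qed

end
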